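(* Let $n\ge 1$, let $D\subset\mathbf R^n$ be a bounded domain, let $\max\{1,\tfrac n2\}<r\le\infty$, and let $q=r^*$ be the Hölder conjugate exponent of $r$. Suppose that for some real-valued $V\in L^r(D)$ the equation $-\Delta u=Vu$ in $D$ has a nontrivial distributional solution $u\in W^{1,2}_0(D)$. Then $$(K_q^* )^{2}\,|D|^{\frac 2n-\frac1r}\,\|V_+\|_r\ \ge\ 1 ,$$ where $K_q^*$ is the Sobolev constant $K_q(B)$ of a ball $B\subset\mathbf R^n$ of volume $1$.
   Context: $W^{1,2}_0(D)$ is the closure of $C_0^\infty(D)$ with respect to the norm $\|\nabla u\|_2$. $\|\cdot\|_p$ is the norm of $L^p(D)$, $|D|$ is Lebesgue measure, $V_+=\max\{V,0\}$. The conjugate exponent satisfies $\frac1q+\frac1r=1$, with $\infty^*=1$. For a bounded domain $\Omega\subset\mathbf R^n$, the Sobolev constant is $K_q(\Omega)=\sup\{\|u\|_{L^{2q}(\Omega)}/\|\nabla u\|_{L^2(\Omega)} : u\in W^{1,2}_0(\Omega),\ u\ne0\}$. A function $u\in W_0^{1,2}(D)$ is a distributional solution of $-\Delta u=Vu$ if $\int_D\nabla u\cdot\nabla\psi\,dx=\int_D Vu\psi\,dx$ for all $\psi\in C_0^\infty(D)$; it is nontrivial if it is not a.e. zero. Solutions may be complex-valued. *)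

theory Defs
  imports "HOL-Analysis.Analysis" "HOL-Probability.Essential_Supremum"
begin

section \<open>Lebesgue spaces\<close>

text \<open>
  Norms take values in \<open>[0, \<infinity>]\<close> and exponents \<open>p\<close> in \<open>[1, \<infinity>]\<close>; on \<^typ>\<open>ennreal\<close> we have
  \<open>1 / \<infinity> = 0\<close>. The case distinction is needed because \<^const>\<open>powr\<close> is not available on
  \<^typ>\<open>ennreal\<close>.
\<close>

definition ennpow :: "ennreal \<Rightarrow> real \<Rightarrow> ennreal" where
  "ennpow x a = (if x = \<infinity> then \<infinity> else ennreal (enn2real x powr a))"

definition Lp_norm :: "ennreal \<Rightarrow> 'a::euclidean_space set \<Rightarrow> ('a \<Rightarrow> 'b::real_normed_vector) \<Rightarrow> ennreal" where
  "Lp_norm p D f =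
    (if p = \<infinity> then esssup (lebesgue_on D) (\<lambda>x. ennreal (norm (f x)))
     else ennpow (\<integral>\<^sup>+ x. ennreal (norm (f x) powr enn2real p) \<partial>lebesgue_on D) (1 / enn2real p))"

definition Lp_space :: "ennreal \<Rightarrow> 'a::euclidean_space set \<Rightarrow> ('a \<Rightarrow> 'b::real_normed_vector) set" where
  "Lp_space p D = {f. f \<in> borel_measurable (lebesgue_on D) \<and> Lp_norm p D f < \<infinity>}"


section \<open>Test functions\<close>

fun Ck :: "nat \<Rightarrow> ('a::real_normed_vector \<Rightarrow> 'b::real_normed_vector) \<Rightarrow> bool" where
  "Ck 0 f \<longleftrightarrow> continuous_on UNIV f"
| "Ck (Suc k) f \<longleftrightarrow> (\<forall>x. f differentiable (at x)) \<and> (\<forall>v. Ck k (\<lambda>x. frechet_derivative f (at x) v))"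

definition test_functions :: "(real ^ 'n) set \<Rightarrow> (real ^ 'n \<Rightarrow> complex) set" where
  "test_functions D = {\<phi>. (\<forall>k. Ck k \<phi>) \<and> compact (closure {x. \<phi> x \<noteq> 0}) \<and> closure {x. \<phi> x \<noteq> 0} \<subseteq> D}"

definition gradient :: "(real ^ 'n \<Rightarrow> complex) \<Rightarrow> real ^ 'n \<Rightarrow> complex ^ 'n" where
  "gradient \<phi> x = (\<chi> i. frechet_derivative \<phi> (at x) (axis i 1))"


section \<open>Sobolev spaces\<close>

text \<open>\<open>W12 D u g\<close>: \<open>u \<in> W\<^sup>1\<^sup>,\<^sup>2(D)\<close> and \<open>g\<close> is (a representative of) its distributional gradient.\<close>

definition W12 :: "(real ^ 'n) set \<Rightarrow> (real ^ 'n \<Rightarrow> complex) \<Rightarrow> (real ^ 'n \<Rightarrow> complex ^ 'n) \<Rightarrow> bool" where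
  "W12 D u g \<longleftrightarrow> u \<in> Lp_space 2 D \<and> g \<in> Lp_space 2 D \<and>
     (\<forall>\<psi>\<in>test_functions D. \<forall>i.
        (LINT x|lebesgue_on D. u x * gradient \<psi> x $ i) = - (LINT x|lebesgue_on D. g x $ i * \<psi> x))"

text \<open>
  \<open>W12_0 D u g\<close>: \<open>u\<close> lies in the closure of \<^term>\<open>test_functions D\<close> and \<open>\<nabla>u = g\<close>. On a bounded
  domain \<open>\<parallel>\<nabla>u\<parallel>\<^sub>2\<close> is, by the Poincare inequality, equivalent on test functions to the full
  \<open>W\<^sup>1\<^sup>,\<^sup>2\<close> norm, so the completion in the former is the closure in the latter. The convergence in
  \<open>L\<^sup>2\<close> is what identifies the limit of the completion with a function; without it the constants,
  having gradient zero, would be limits of the zero sequence.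
\<close>

definition W12_0 :: "(real ^ 'n) set \<Rightarrow> (real ^ 'n \<Rightarrow> complex) \<Rightarrow> (real ^ 'n \<Rightarrow> complex ^ 'n) \<Rightarrow> bool" where
  "W12_0 D u g \<longleftrightarrow> W12 D u g \<and>
     (\<exists>\<phi> :: nat \<Rightarrow> real ^ 'n \<Rightarrow> complex. (\<forall>k. \<phi> k \<in> test_functions D) \<and>
        (\<lambda>k. Lp_norm 2 D (\<lambda>x. gradient (\<phi> k) x - g x)) \<longlonglongrightarrow> 0 \<and>
        (\<lambda>k. Lp_norm 2 D (\<lambda>x. \<phi> k x - u x)) \<longlonglongrightarrow> 0)"

definition nontrivial_on :: "(real ^ 'n) set \<Rightarrow> (real ^ 'n \<Rightarrow> complex) \<Rightarrow> bool" where
  "nontrivial_on D u \<longleftrightarrow> \<not> (AE x in lebesgue_on D. u x = 0)"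

definition sobolev_constant :: "ennreal \<Rightarrow> (real ^ 'n) set \<Rightarrow> ennreal" where
  "sobolev_constant q \<Omega> =
     Sup {Lp_norm (2 * q) \<Omega> u / Lp_norm 2 \<Omega> g | u g. W12_0 \<Omega> u g \<and> nontrivial_on \<Omega> u}"


section \<open>The equation\<close>

text \<open>The dot product of gradients is bilinear, without complex conjugation.\<close>

definition distributional_solution ::
    "(real ^ 'n) set \<Rightarrow> (real ^ 'n \<Rightarrow> real) \<Rightarrow> (real ^ 'n \<Rightarrow> complex) \<Rightarrow> bool" where
  "distributional_solution D V u \<longleftrightarrow>
     (\<exists>g. W12_0 D u g \<and>
        (\<forall>\<psi>\<in>test_functions D.
           (LINT x|lebesgue_on D. (\<Sum>i\<in>UNIV. g x $ i * gradient \<psi> x $ i)) =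
           (LINT x|lebesgue_on D. complex_of_real (V x) * u x * \<psi> x)))"

end

theory Submission
  imports Defs "HOL-Complex_Analysis.Great_Picard"
begin

text \<open>
  Testing the equation with \<open>u\<close> and applying Hoelder's inequality gives \<open>1 \<le> S\<^sup>2 \<parallel>V\<^sub>+\<parallel>\<^sub>r\<close> for every
  Sobolev constant \<open>S\<close> of \<open>D\<close>, so the point is to compare \<open>D\<close> with the ball of the same volume.
  Instead of rearranging Sobolev functions, one works with the difference energies
  \<open>E\<^sub>t(f) = \<integral>\<integral>\<^bsub>|x - y| < t\<^esub> |f x - f y|\<^sup>2\<close>: they are at most a universal multiple of
  \<open>t\<^bsup>n+2\<^esup> \<parallel>\<nabla>f\<parallel>\<^sup>2\<close>, with equality in the limit \<open>t \<rightarrow> 0\<close>, and they decrease under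
  polarization and under convolution. Among all functions obtained from \<open>|\<phi>|\<close> (uniformly Lipschitz,
  supported in a fixed ball, with no larger energies), a minimizer of the second moment exists by
  Arzela-Ascoli and is fixed by every polarization towards the origin; hence it is radially
  decreasing. Its mollifications are test functions on the ball, and their gradient norm is
  controlled by the energies of \<open>|\<phi>|\<close>, that is by \<open>\<parallel>\<nabla>\<phi>\<parallel>\<close>.
\<close>

subsection \<open>Invariance of Lebesgue measure and reflections\<close>

text \<open>Mollification enlarges supports, so the rearranged function must leave a margin inside
  the ball. The margin comes from test functions: a compact subset of the connected bounded open set
  \<open>D\<close> has strictly smaller measure than \<open>D\<close>. Scaling from volume
  \<open>|D|\<close> to volume 1 then produces the power of \<open>|D|\<close>. The competitors obey
  one-sided conditions only (positivity set not larger, power integral not smaller, energies not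
  larger), since these survive pointwise limits. The solution is not itself an admissible test
  function. The equation is tested with conjugates of approximating test functions, and products are
  written as half of a sum of squares minus a squared difference, so that the error is a multiple of
  the squared distance of the gradients. Finally, finiteness of the constant of the ball is not
  presupposed. If it is infinite, the product could only fail to be infinite through
  \<open>V_+ = 0\<close>; this is excluded by a crude finite constant for \<open>D\<close>, which
  the energies of a radially decreasing function at dyadic scales provide.\<close>

text \<open>The library has invariance under orthogonal maps only for index types of class
  \<open>wellorder\<close>; uniqueness of translation-invariant measures, by Fubini, avoids the ordering.\<close>

lemma translation_invariant_eq_lborel:
  fixes M :: "'a::euclidean_space measure"
  assumes sets_M[measurable_cong]: "sets M = sets borel" and "sigma_finite_measure M"
    and transl: "\<And>a. distr M borel (\<lambda>x. a + x) = M"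
    and ball1: "emeasure M (ball 0 1) = emeasure lborel (ball (0::'a) 1)"
  shows "M = lborel"
proof (rule measure_eqI)
  show "sets M = sets lborel" using sets_M by simp
next
  fix A assume "A \<in> sets M"
  then have A[measurable]: "A \<in> sets borel" using sets_M by simp
  define B where "B = ball (0::'a) 1"
  have B[measurable]: "B \<in> sets borel" by (simp add: B_def)
  interpret M: sigma_finite_measure M by fact
  interpret P: pair_sigma_finite lborel M ..
  have M_shift: "(\<integral>\<^sup>+x. indicator C (a + x) \<partial>M) = emeasure M C" if C[measurable]: "C \<in> sets borel" for C a
  proof -
    have "emeasure M C = emeasure (distr M borel (\<lambda>x. a + x)) C" by (simp add: transl)
    also have "\<dots> = (\<integral>\<^sup>+x. indicator C x \<partial>distr M borel (\<lambda>x. a + x))"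
      by (rule nn_integral_indicator[symmetric]) simp
    also have "\<dots> = (\<integral>\<^sup>+x. indicator C (a + x) \<partial>M)"
      by (rule nn_integral_distr) measurable
    finally show ?thesis by simp
  qed
  \<comment> \<open>One double integral is evaluated in two ways. Invariance of \<open>M\<close>
    gives the inner integral the value \<open>emeasure M A\<close> for every \<open>y\<close>;
    Fubini, invariance of \<open>lborel\<close>, Fubini again and invariance of \<open>M\<close>
    then exchange the roles of \<open>A\<close> and \<open>B\<close>.\<close>
  have "emeasure lborel B * emeasure M A = (\<integral>\<^sup>+y. indicator B y * emeasure M A \<partial>lborel)"
    by (simp add: nn_integral_multc)
  also have "\<dots> = (\<integral>\<^sup>+y. (\<integral>\<^sup>+x. indicator B y * indicator A (y + x) \<partial>M) \<partial>lborel)"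
    by (simp add: nn_integral_cmult M_shift)
  also have "\<dots> = (\<integral>\<^sup>+x. (\<integral>\<^sup>+y. indicator B y * indicator A (y + x) \<partial>lborel) \<partial>M)"
    by (rule P.Fubini'[symmetric]) measurable
  also have "\<dots> = (\<integral>\<^sup>+x. (\<integral>\<^sup>+y. indicator B (y - x) * indicator A y \<partial>lborel) \<partial>M)"
  proof (rule nn_integral_cong)
    fix x :: 'a
    have "(\<integral>\<^sup>+y. indicator B (y - x) * indicator A y \<partial>lborel) =
        (\<integral>\<^sup>+y. indicator B (y - x) * indicator A y \<partial>distr lborel borel (\<lambda>y. x + y))"
      by (simp add: lborel_distr_plus)
    also have "\<dots> = (\<integral>\<^sup>+y. indicator B y * indicator A (y + x) \<partial>lborel)"
      by (subst nn_integral_distr) (auto simp: add.commute)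
    finally show "(\<integral>\<^sup>+y. indicator B y * indicator A (y + x) \<partial>lborel) =
        (\<integral>\<^sup>+y. indicator B (y - x) * indicator A y \<partial>lborel)" by (rule sym)
  qed
  also have "\<dots> = (\<integral>\<^sup>+y. (\<integral>\<^sup>+x. indicator B (y - x) * indicator A y \<partial>M) \<partial>lborel)"
    by (rule P.Fubini') measurable
  \<comment> \<open>The unit ball is symmetric about 0, so \<open>y - x\<close> may be replaced by
    \<open>- y + x\<close>, which is a translation of \<open>x\<close>.\<close>
  also have "\<dots> = (\<integral>\<^sup>+y. (\<integral>\<^sup>+x. indicator B (- y + x) * indicator A y \<partial>M) \<partial>lborel)"
    by (auto simp: B_def indicator_def norm_minus_commute intro!: nn_integral_cong)
  also have "\<dots> = emeasure M B * emeasure lborel A"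
    using M_shift[OF B, of "- _"] by (simp add: nn_integral_multc nn_integral_cmult)
  finally have *: "emeasure lborel B * emeasure M A = emeasure lborel B * emeasure lborel A"
    using ball1 by (simp add: B_def)
  have "emeasure lborel B \<noteq> 0" "emeasure lborel B \<noteq> \<infinity>"
    using unit_ball_vol_pos[of "real DIM('a)"] by (auto simp: B_def emeasure_ball simp del: unit_ball_vol_pos)
  with * show "emeasure M A = emeasure lborel A"
    by (simp add: ennreal_mult_cancel_left)
qed

text \<open>The image measure is again translation invariant, because every translation vector is
  the image under \<open>T\<close> of another one; \<open>T\<close> preserves the unit ball, which
  fixes the normalization.\<close>

lemma distr_lborel_orthogonal_transformation:
  fixes T :: "'a::euclidean_space \<Rightarrow> 'a"
  assumes T: "orthogonal_transformation T"
  shows "distr lborel borel T = lborel"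
proof (rule translation_invariant_eq_lborel)
  have lin: "linear T" using T by (rule orthogonal_transformation_linear)
  have [measurable]: "T \<in> borel_measurable borel"
    using lin by (intro borel_measurable_continuous_onI linear_continuous_on linear_conv_bounded_linear[THEN iffD1])
  have nT: "norm (T x) = norm x" for x using T by (rule orthogonal_transformation_norm)
  have surj: "surj T" using T by (rule orthogonal_transformation_surj)
  have ball: "T -` ball 0 r = ball 0 r" for r by (auto simp: nT)
  show "sets (distr lborel borel T) = sets borel" by simp
  show "emeasure (distr lborel borel T) (ball 0 1) = emeasure lborel (ball (0::'a) 1)"
    by (subst emeasure_distr) (simp_all add: ball)
  show "sigma_finite_measure (distr lborel borel T)"
  proof
    have "ball 0 (real n) \<in> sets (distr lborel borel T)"
      "emeasure (distr lborel borel T) (ball 0 (real n)) \<noteq> \<infinity>" for n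
      by (auto simp: emeasure_distr ball emeasure_ball)
    moreover have "(\<Union>n. ball (0::'a) (real n)) = UNIV"
      using reals_Archimedean2 by (auto simp: set_eq_iff)
    ultimately show "\<exists>A. countable A \<and> A \<subseteq> sets (distr lborel borel T) \<and> \<Union>A = space (distr lborel borel T) \<and>
        (\<forall>a\<in>A. emeasure (distr lborel borel T) a \<noteq> \<infinity>)"
      by (intro exI[of _ "range (\<lambda>n. ball (0::'a) (real n))"]) auto
  qed
  show "distr (distr lborel borel T) borel ((+) a) = distr lborel borel T" for a
  proof -
    obtain b where b: "a = T b" using surj by (metis surjD)
    have "distr (distr lborel borel T) borel ((+) a) = distr lborel borel (\<lambda>x. T (b + x))"
      by (subst distr_distr) (auto simp: o_def b linear_add[OF lin])
    also have "\<dots> = distr (distr lborel borel ((+) b)) borel T"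
      by (subst distr_distr) (auto simp: o_def)
    finally show ?thesis by (simp add: lborel_distr_plus)
  qed
qed

section \<open>Changes of variables in Lebesgue integrals\<close>

lemma nn_integral_lborel_translate:
  fixes f :: "'a::euclidean_space \<Rightarrow> ennreal"
  assumes [measurable]: "f \<in> borel_measurable borel"
  shows "(\<integral>\<^sup>+x. f (x + a) \<partial>lborel) = (\<integral>\<^sup>+x. f x \<partial>lborel)"
proof -
  have "(\<integral>\<^sup>+x. f x \<partial>distr lborel borel ((+) a)) = (\<integral>\<^sup>+x. f (x + a) \<partial>lborel)"
    by (subst nn_integral_distr) (auto simp: add.commute)
  then show ?thesis by (simp add: lborel_distr_plus)
qed

lemma nn_integral_lborel_orthogonal_transformation:
  fixes f :: "'a::euclidean_space \<Rightarrow> ennreal" and T :: "'a \<Rightarrow> 'a"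
  assumes [measurable]: "f \<in> borel_measurable borel" and T: "orthogonal_transformation T"
  shows "(\<integral>\<^sup>+x. f (T x) \<partial>lborel) = (\<integral>\<^sup>+x. f x \<partial>lborel)"
proof -
  have [measurable]: "T \<in> borel_measurable borel"
    using T by (intro borel_measurable_continuous_onI linear_continuous_on)
      (simp add: orthogonal_transformation_linear flip: linear_conv_bounded_linear)
  have "(\<integral>\<^sup>+x. f x \<partial>distr lborel borel T) = (\<integral>\<^sup>+x. f (T x) \<partial>lborel)"
    by (subst nn_integral_distr) auto
  then show ?thesis by (simp add: distr_lborel_orthogonal_transformation[OF T])
qed

lemma nn_integral_lborel_scale:
  fixes f :: "'a::euclidean_space \<Rightarrow> ennreal"
  assumes [measurable]: "f \<in> borel_measurable borel" and c: "c > 0"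
  shows "(\<integral>\<^sup>+x. f (c *\<^sub>R x) \<partial>lborel) = ennreal (c powr - real DIM('a)) * (\<integral>\<^sup>+x. f x \<partial>lborel)"
proof -
  have "(\<integral>\<^sup>+x. f x \<partial>lborel) = ennreal (c ^ DIM('a)) * (\<integral>\<^sup>+x. f (c *\<^sub>R x) \<partial>lborel)"
    using c by (subst lborel_affine[of c 0])
      (simp_all add: nn_integral_density nn_integral_distr nn_integral_cmult)
  moreover have "ennreal (c powr - real DIM('a)) * ennreal (c ^ DIM('a)) = 1"
    using c by (simp add: powr_minus powr_realpow flip: ennreal_mult)
  ultimately show ?thesis by (simp add: mult.assoc[symmetric])
qed

lemma open_AE_not_mem_imp_empty:
  fixes U :: "'a::euclidean_space set"
  assumes U: "open U" and AE: "AE x in lborel. x \<notin> U"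
  shows "U = {}"
proof (rule ccontr)
  assume "U \<noteq> {}"
  moreover have "U \<in> null_sets lborel" using AE U by (subst AE_iff_null_sets) auto
  then have "negligible U" by (simp add: negligible_iff_null_sets null_sets_completionI)
  ultimately show False using open_not_negligible[OF U] by blast
qed

section \<open>Reflection in the hyperplane \<open>d \<bullet> z = s\<close>, for a unit vector
  \<open>d\<close>\<close>

definition hreflect :: "'a::real_inner \<Rightarrow> real \<Rightarrow> 'a \<Rightarrow> 'a" where
  "hreflect d s z = z - (2 * (d \<bullet> z - s)) *\<^sub>R d"

context
  fixes d :: "'a::euclidean_space" and s :: real
  assumes d: "norm d = 1"
begin

lemma inner_unit_self: "d \<bullet> d = 1" using d by (simp add: norm_eq_1)

lemma inner_hreflect: "d \<bullet> hreflect d s z - s = - (d \<bullet> z - s)"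
  by (simp add: hreflect_def inner_diff_right inner_unit_self)

lemma hreflect_involution [simp]: "hreflect d s (hreflect d s z) = z"
  unfolding hreflect_def[of d s "hreflect d s z"] inner_hreflect by (simp add: hreflect_def algebra_simps)

text \<open>The last product is nonnegative when \<open>x\<close> and \<open>y\<close> lie on the
  same side of the mirror. All comparisons between distances to a point and to its mirror image come
  from this identity.\<close>

lemma norm_diff_hreflect_sq:
  "(norm (x - hreflect d s y))\<^sup>2 = (norm (x - y))\<^sup>2 + 4 * ((d \<bullet> x - s) * (d \<bullet> y - s))"
proof -
  have eq: "x - hreflect d s y = (x - y) + (2 * (d \<bullet> y - s)) *\<^sub>R d" by (simp add: hreflect_def)
  have sq: "(norm (a + k *\<^sub>R d))\<^sup>2 = (norm a)\<^sup>2 + 2 * k * (d \<bullet> a) + k\<^sup>2" for a k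
    by (simp add: power2_norm_eq_inner inner_add_left inner_add_right inner_unit_self inner_commute[of a d])
      (simp add: power2_eq_square distrib_left)
  show ?thesis
    unfolding eq sq inner_diff_right by algebra
qed

lemma norm_diff_hreflect:
  assumes "0 \<le> (d \<bullet> x - s) * (d \<bullet> y - s)"
  shows "norm (x - y) \<le> norm (x - hreflect d s y)"
  by (rule power2_le_imp_le) (use norm_diff_hreflect_sq[of x y] assms in auto)

lemma norm_hreflect_diff [simp]: "norm (hreflect d s x - hreflect d s y) = norm (x - y)"
proof -
  have "(norm (hreflect d s x - hreflect d s y))\<^sup>2 = (norm (x - y))\<^sup>2"
    using norm_diff_hreflect_sq[of "hreflect d s x" y] norm_diff_hreflect_sq[of y x]
    by (simp add: inner_hreflect norm_minus_commute algebra_simps)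
  then show ?thesis by (simp add: power2_eq_iff_nonneg)
qed

lemma norm_diff_hreflect_commute: "norm (hreflect d s x - y) = norm (x - hreflect d s y)"
  using norm_hreflect_diff[of x "hreflect d s y"] by simp

lemma continuous_on_hreflect [continuous_intros]:
  "continuous_on S f \<Longrightarrow> continuous_on S (\<lambda>x. hreflect d s (f x))"
  unfolding hreflect_def by (intro continuous_intros)

lemma borel_measurable_hreflect [measurable]: "hreflect d s \<in> borel_measurable borel"
  by (intro borel_measurable_continuous_onI continuous_intros)

lemma nn_integral_hreflect:
  assumes [measurable]: "f \<in> borel_measurable borel"
  shows "(\<integral>\<^sup>+x. f (hreflect d s x) \<partial>lborel) = (\<integral>\<^sup>+x. f x \<partial>lborel)"
proof -
  define T where "T z = z - (2 * (d \<bullet> z)) *\<^sub>R d" for z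
  have T: "orthogonal_transformation T"
    unfolding orthogonal_transformation T_def
  proof
    show "linear (\<lambda>z. z - (2 * (d \<bullet> z)) *\<^sub>R d)"
      by (rule linearI) (simp_all add: inner_add_right algebra_simps)
    have "norm (z - (2 * (d \<bullet> z)) *\<^sub>R d) = norm z" for z
      unfolding norm_eq_sqrt_inner
      by (simp add: inner_diff_left inner_diff_right inner_unit_self inner_commute[of z d])
    then show "\<forall>z. norm (z - (2 * (d \<bullet> z)) *\<^sub>R d) = norm z" by blast
  qed
  have eq: "hreflect d s x = T x + (2 * s) *\<^sub>R d" for x by (simp add: T_def hreflect_def algebra_simps)
  have "(\<integral>\<^sup>+x. f (hreflect d s x) \<partial>lborel) = (\<integral>\<^sup>+x. f (x + (2 * s) *\<^sub>R d) \<partial>lborel)"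
    unfolding eq by (rule nn_integral_lborel_orthogonal_transformation[OF _ T]) measurable
  also have "\<dots> = (\<integral>\<^sup>+x. f x \<partial>lborel)" by (rule nn_integral_lborel_translate) measurable
  finally show ?thesis .
qed

end

subsection \<open>Polarization\<close>

text \<open>The kernel is a nonincreasing function of the distance; on this property the two-point
  comparison below rests.\<close>

definition energy :: "real \<Rightarrow> ('a::euclidean_space \<Rightarrow> 'b::real_normed_vector) \<Rightarrow> ennreal" where
  "energy t f = (\<integral>\<^sup>+x. \<integral>\<^sup>+y. ennreal (indicat_real (ball 0 t) (x - y) * (norm (f x - f y))\<^sup>2) \<partial>lborel \<partial>lborel)"

text \<open>This is the two-point rearrangement: of the values at a point and at its mirror image,
  the larger one goes to the half-space \<open>d \<bullet> x \<le> s\<close>, which contains the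
  origin when \<open>0 \<le> s\<close>.\<close>

definition polarize :: "'a::euclidean_space \<Rightarrow> real \<Rightarrow> ('a \<Rightarrow> real) \<Rightarrow> 'a \<Rightarrow> real" where
  "polarize d s v x =
    (if d \<bullet> x \<le> s then max (v x) (v (hreflect d s x)) else min (v x) (v (hreflect d s x)))"

text \<open>Here \<open>k\<close> weighs the two near pairs and \<open>k'\<close> the two far pairs.
  If \<open>(a, a')\<close> and \<open>(b, b')\<close> are ordered alike, sorting changes nothing.
  If they are ordered oppositely, only the mixed products change, and the right side exceeds the
  left by \<open>2 * (k - k') * \<bar>a - a'\<bar> * \<bar>b - b'\<bar>\<close>.\<close>

lemma two_point_inequality:
  fixes a a' b b' k k' :: real
  assumes "k' \<le> k"
  shows "k * (max a a' - max b b')\<^sup>2 + k' * (min a a' - max b b')\<^sup>2 + k' * (max a a' - min b b')\<^sup>2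
      + k * (min a a' - min b b')\<^sup>2
    \<le> k * (a - b)\<^sup>2 + k' * (a' - b)\<^sup>2 + k' * (a - b')\<^sup>2 + k * (a' - b')\<^sup>2"
proof -
  have 1: "0 \<le> (k - k') * ((a - a') * (b' - b))" if "a \<ge> a'" "b \<le> b'"
    using that assms by simp
  have 2: "0 \<le> (k - k') * ((a' - a) * (b - b'))" if "a \<le> a'" "b \<ge> b'"
    using that assms by simp
  consider "a \<ge> a'" "b \<ge> b'" | "a \<le> a'" "b \<le> b'" | "a \<ge> a'" "b \<le> b'" | "a \<le> a'" "b \<ge> b'" by linarith
  then show ?thesis
  proof cases
    case 3
    then show ?thesis using 1[OF 3] by (simp add: max_def min_def) (auto simp: power2_eq_square algebra_simps)
  next
    case 4
    then show ?thesis using 2[OF 4] by (simp add: max_def min_def) (auto simp: power2_eq_square algebra_simps)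
  qed (auto simp: max_def min_def)
qed

context
  fixes d :: "'a::euclidean_space" and s :: real and v :: "'a \<Rightarrow> real"
  assumes d: "norm d = 1" and v[measurable]: "v \<in> borel_measurable borel"
begin

interpretation pair_sigma_finite lborel lborel ..

abbreviation (input) "\<sigma> \<equiv> hreflect d s"

lemma polarize_left:
  assumes "d \<bullet> x \<le> s"
  shows "polarize d s v x = max (v x) (v (\<sigma> x))" "polarize d s v (\<sigma> x) = min (v x) (v (\<sigma> x))"
proof -
  show "polarize d s v x = max (v x) (v (\<sigma> x))" using assms by (simp add: polarize_def)
  show "polarize d s v (\<sigma> x) = min (v x) (v (\<sigma> x))"
  proof (cases "d \<bullet> x = s")
    case True
    then have "\<sigma> x = x" by (simp add: hreflect_def)
    then show ?thesis by (simp add: polarize_def)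
  next
    case False
    then show ?thesis using assms inner_hreflect[OF d, of s x] d
      by (simp add: polarize_def min.commute)
  qed
qed

lemma inner_hreflect_le: "\<not> d \<bullet> x \<le> s \<Longrightarrow> d \<bullet> \<sigma> x \<le> s"
  using inner_hreflect[OF d, of s x] by simp

lemma borel_measurable_polarize [measurable]: "polarize d s v \<in> borel_measurable borel"
  unfolding polarize_def[abs_def] using d by measurable

text \<open>Polarization at most swaps the values at a point and its mirror image, so the integrand
  summed over such a pair is unchanged.\<close>

lemma nn_integral_polarize:
  assumes [measurable]: "G \<in> borel_measurable borel"
  shows "(\<integral>\<^sup>+x. G (polarize d s v x) \<partial>lborel) = (\<integral>\<^sup>+x. G (v x) \<partial>lborel)"
proof -
  have [measurable]: "\<sigma> \<in> borel_measurable borel" using d by measurable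
  have eq: "2 * (\<integral>\<^sup>+x. G (w x) \<partial>lborel) = (\<integral>\<^sup>+x. G (w x) + G (w (\<sigma> x)) \<partial>lborel)"
    if [measurable]: "w \<in> borel_measurable borel" for w :: "'a \<Rightarrow> real"
    using nn_integral_hreflect[OF d, of "\<lambda>x. G (w x)" s] by (simp add: nn_integral_add mult_2)
  have "G (polarize d s v x) + G (polarize d s v (\<sigma> x)) = G (v x) + G (v (\<sigma> x))" for x
  proof (cases "d \<bullet> x \<le> s")
    case True
    then show ?thesis by (simp add: polarize_left max_def min_def add.commute)
  next
    case False
    then show ?thesis using polarize_left[of "\<sigma> x"] inner_hreflect_le[of x] d
      by (simp add: max_def min_def add.commute)
  qed
  then have "2 * (\<integral>\<^sup>+x. G (polarize d s v x) \<partial>lborel) = 2 * (\<integral>\<^sup>+x. G (v x) \<partial>lborel)"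
    by (simp add: eq)
  then show ?thesis by (simp add: ennreal_mult_cancel_left)
qed

text \<open>Reflecting either variable preserves the double integral. After summing over the four
  reflected pairs, both points may be assumed in the half-space
  \<open>d \<bullet> x \<le> s\<close>, where the integrands compare by the two-point
  inequality.\<close>

lemma energy_polarize: "energy t (polarize d s v) \<le> energy t v"
proof -
  have [measurable]: "\<sigma> \<in> borel_measurable borel" using d by measurable
  define F where "F w x y = indicat_real (ball 0 t) (x - y) * (w x - w y)\<^sup>2" for w :: "'a \<Rightarrow> real" and x y
  have F0: "0 \<le> F w x y" for w x y by (simp add: F_def)
  have Fm[measurable]: "case_prod (F w) \<in> borel_measurable (borel \<Otimes>\<^sub>M borel)"
    if w[measurable]: "w \<in> borel_measurable borel" for w
  proof -
    have [measurable]: "ball (0::'a) t \<in> sets borel" by simp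
    have [measurable]: "(\<lambda>z. w (fst z)) \<in> borel_measurable (borel \<Otimes>\<^sub>M borel)"
      "(\<lambda>z. w (snd z)) \<in> borel_measurable (borel \<Otimes>\<^sub>M borel)" by measurable
    show ?thesis unfolding F_def by measurable
  qed
  define S where "S w x y = F w x y + F w (\<sigma> x) y + F w x (\<sigma> y) + F w (\<sigma> x) (\<sigma> y)" for w x y
  have S1: "S w (\<sigma> x) y = S w x y" and S2: "S w x (\<sigma> y) = S w x y" for w x y
    using d by (simp_all add: S_def)
  have eq: "4 * energy t w = (\<integral>\<^sup>+x. \<integral>\<^sup>+y. ennreal (S w x y) \<partial>lborel \<partial>lborel)"
    if [measurable]: "w \<in> borel_measurable borel" for w
  proof -
    let ?F = "\<lambda>x y. ennreal (F w x y)"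
    have y: "(\<integral>\<^sup>+y. ?F x (\<sigma> y) \<partial>lborel) = (\<integral>\<^sup>+y. ?F x y \<partial>lborel)" for x
      by (rule nn_integral_hreflect[OF d]) measurable
    have x: "(\<integral>\<^sup>+x. \<integral>\<^sup>+y. ?F (\<sigma> x) y \<partial>lborel \<partial>lborel) = (\<integral>\<^sup>+x. \<integral>\<^sup>+y. ?F x y \<partial>lborel \<partial>lborel)"
      by (rule nn_integral_hreflect[OF d]) measurable
    have "(\<integral>\<^sup>+x. \<integral>\<^sup>+y. ennreal (S w x y) \<partial>lborel \<partial>lborel)
        = (\<integral>\<^sup>+x. \<integral>\<^sup>+y. ?F x y + ?F (\<sigma> x) y + ?F x (\<sigma> y) + ?F (\<sigma> x) (\<sigma> y) \<partial>lborel \<partial>lborel)"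
      by (simp add: S_def F0)
    also have "\<dots> = 4 * (\<integral>\<^sup>+x. \<integral>\<^sup>+y. ?F x y \<partial>lborel \<partial>lborel)"
    proof -
      have "a + a + a + a = 4 * a" for a :: ennreal
      proof -
        have "a + a + a + a = (1 + 1 + 1 + 1) * a" by (simp only: distrib_right mult_1)
        then show ?thesis by simp
      qed
      then show ?thesis by (simp add: nn_integral_add y x)
    qed
    finally show ?thesis by (simp add: energy_def F_def)
  qed
  have core: "S (polarize d s v) x y \<le> S v x y" if x: "d \<bullet> x \<le> s" and y: "d \<bullet> y \<le> s" for x y
  proof -
    define k where "k = indicat_real (ball 0 t) (x - y)"
    define k' where "k' = indicat_real (ball 0 t) (x - \<sigma> y)"
    have nn: "norm (x - y) \<le> norm (x - \<sigma> y)"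
      by (rule norm_diff_hreflect[OF d]) (use x y in \<open>simp add: mult_nonpos_nonpos\<close>)
    then have kk: "k' \<le> k" by (auto simp: k_def k'_def indicator_def)
    have k1: "indicat_real (ball 0 t) (\<sigma> x - y) = k'" "indicat_real (ball 0 t) (\<sigma> x - \<sigma> y) = k"
      using norm_diff_hreflect_commute[OF d, of s x y] norm_hreflect_diff[OF d, of s x y]
      by (auto simp: k_def k'_def indicator_def)
    have Sw: "S w x y = k * (w x - w y)\<^sup>2 + k' * (w (\<sigma> x) - w y)\<^sup>2 + k' * (w x - w (\<sigma> y))\<^sup>2
        + k * (w (\<sigma> x) - w (\<sigma> y))\<^sup>2" for w
      by (simp add: S_def F_def k1 flip: k_def k'_def)
    show ?thesis unfolding Sw polarize_left[OF x] polarize_left[OF y]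
      by (rule two_point_inequality[OF kk])
  qed
  have "S (polarize d s v) x y \<le> S v x y" for x y
    using core[of x y] core[of "\<sigma> x" y] core[of x "\<sigma> y"] core[of "\<sigma> x" "\<sigma> y"]
      inner_hreflect_le[of x] inner_hreflect_le[of y]
    by (cases "d \<bullet> x \<le> s"; cases "d \<bullet> y \<le> s") (simp_all add: S1 S2)
  then have "4 * energy t (polarize d s v) \<le> 4 * energy t v"
    by (simp add: eq nn_integral_mono ennreal_leI)
  then show ?thesis by (subst (asm) ennreal_mult_le_mult_iff) auto
qed

text \<open>Maximum and minimum of a Lipschitz function and its reflection keep the constant. For
  points on opposite sides a maximum meets a minimum, and then all four distances between the points
  and their images are at most \<open>norm (x - \<sigma> y)\<close>, where \<open>x\<close> and
  \<open>y\<close> are taken on the near side.\<close>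

lemma lipschitz_polarize:
  assumes lip: "\<And>x y. \<bar>v x - v y\<bar> \<le> L * norm (x - y)" and L: "0 \<le> L"
  shows "\<bar>polarize d s v x - polarize d s v y\<bar> \<le> L * norm (x - y)"
proof -
  have core: "\<bar>max (v x) (v (\<sigma> x)) - max (v y) (v (\<sigma> y))\<bar> \<le> L * norm (x - y)"
       "\<bar>min (v x) (v (\<sigma> x)) - min (v y) (v (\<sigma> y))\<bar> \<le> L * norm (x - y)"
       "\<bar>max (v x) (v (\<sigma> x)) - min (v y) (v (\<sigma> y))\<bar> \<le> L * norm (x - \<sigma> y)"
    if x: "d \<bullet> x \<le> s" and y: "d \<bullet> y \<le> s" for x y
  proof -
    have "norm (x - y) \<le> norm (x - \<sigma> y)"
      by (rule norm_diff_hreflect[OF d]) (use x y in \<open>simp add: mult_nonpos_nonpos\<close>)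
    then have "L * norm (x - y) \<le> L * norm (x - \<sigma> y)" using L by (rule mult_left_mono)
    then show "\<bar>max (v x) (v (\<sigma> x)) - max (v y) (v (\<sigma> y))\<bar> \<le> L * norm (x - y)"
       "\<bar>min (v x) (v (\<sigma> x)) - min (v y) (v (\<sigma> y))\<bar> \<le> L * norm (x - y)"
       "\<bar>max (v x) (v (\<sigma> x)) - min (v y) (v (\<sigma> y))\<bar> \<le> L * norm (x - \<sigma> y)"
      using lip[of x y] lip[of x "\<sigma> y"] lip[of "\<sigma> x" y] lip[of "\<sigma> x" "\<sigma> y"]
        norm_diff_hreflect_commute[OF d, of s x y] norm_hreflect_diff[OF d, of s x y]
      by (auto simp: max_def min_def abs_le_iff)
  qed
  define P where "P = polarize d s v"
  have P: "P x = max (v x) (v (\<sigma> x))" "P (\<sigma> x) = min (v x) (v (\<sigma> x))" if "d \<bullet> x \<le> s" for x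
    unfolding P_def using that by (rule polarize_left)+
  have inv: "\<sigma> (\<sigma> x) = x" for x using d by simp
  have c: "\<bar>P x - P y\<bar> \<le> L * norm (x - y)" "\<bar>P (\<sigma> x) - P (\<sigma> y)\<bar> \<le> L * norm (x - y)"
    "\<bar>P x - P (\<sigma> y)\<bar> \<le> L * norm (x - \<sigma> y)" if "d \<bullet> x \<le> s" "d \<bullet> y \<le> s" for x y
    using core[OF that] by (simp_all add: P that)
  have "\<bar>P x - P y\<bar> \<le> L * norm (x - y)"
  proof (cases "d \<bullet> x \<le> s"; cases "d \<bullet> y \<le> s")
    assume "d \<bullet> x \<le> s" "d \<bullet> y \<le> s" then show ?thesis by (rule c(1))
  next
    assume "d \<bullet> x \<le> s" "\<not> d \<bullet> y \<le> s"
    then show ?thesis using c(3)[of x "\<sigma> y"] inner_hreflect_le[of y] by (simp add: inv)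
  next
    assume "\<not> d \<bullet> x \<le> s" "d \<bullet> y \<le> s"
    then show ?thesis using c(3)[of y "\<sigma> x"] inner_hreflect_le[of x]
      by (simp add: inv norm_minus_commute abs_minus_commute)
  next
    assume "\<not> d \<bullet> x \<le> s" "\<not> d \<bullet> y \<le> s"
    then show ?thesis using c(2)[of "\<sigma> x" "\<sigma> y"] inner_hreflect_le[of x] inner_hreflect_le[of y] norm_hreflect_diff[OF d, of s x y]
      by (simp add: inv)
  qed
  then show ?thesis by (simp add: P_def)
qed

text \<open>For \<open>0 \<le> s\<close> the origin lies on the same side of the mirror as
  \<open>x\<close>.\<close>

lemma norm_le_norm_hreflect:
  assumes "0 \<le> s" "d \<bullet> x \<le> s"
  shows "norm x \<le> norm (\<sigma> x)"
  using norm_diff_hreflect[OF d, of x s 0] norm_diff_hreflect_commute[OF d, of s x 0] assms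
  by (simp add: mult_nonpos_nonpos mult_nonneg_nonneg mult_nonpos_nonneg)

lemma polarize_vanishes:
  assumes "0 \<le> s" "\<And>x. 0 \<le> v x" "\<And>x. R < norm x \<Longrightarrow> v x = 0" "R < norm x"
  shows "polarize d s v x = 0"
proof (cases "d \<bullet> x \<le> s")
  case True
  then show ?thesis using assms(3)[of x] assms(3)[of "\<sigma> x"] assms(4) norm_le_norm_hreflect[OF assms(1) True]
    by (simp add: polarize_def)
next
  case False
  then show ?thesis using assms by (simp add: polarize_def)
qed

lemma polarize_nonneg: "(\<And>x. 0 \<le> v x) \<Longrightarrow> 0 \<le> polarize d s v x"
  by (simp add: polarize_def le_max_iff_disj)

text \<open>Putting the larger value at the smaller weight \<open>(norm x)\<^sup>2\<close> lowers
  the moment of a pair of mirror images by \<open>g x\<close>. If the values were in the wrong order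
  at \<open>x0\<close>, continuity would give a gain on an open set, contradicting the assumption
  that polarization does not decrease the moment.\<close>

lemma moment_polarize:
  assumes s: "0 \<le> s" and v0: "\<And>x. 0 \<le> v x" and cont: "continuous_on UNIV v"
    and fin: "(\<integral>\<^sup>+x. ennreal (v x * (norm x)\<^sup>2) \<partial>lborel) < \<infinity>"
    and min: "(\<integral>\<^sup>+x. ennreal (v x * (norm x)\<^sup>2) \<partial>lborel) \<le>
      (\<integral>\<^sup>+x. ennreal (polarize d s v x * (norm x)\<^sup>2) \<partial>lborel)"
    and x0: "d \<bullet> x0 < s" "norm x0 < norm (\<sigma> x0)"
  shows "v (\<sigma> x0) \<le> v x0"
proof (rule ccontr)
  assume less: "\<not> v (\<sigma> x0) \<le> v x0"
  have [measurable]: "\<sigma> \<in> borel_measurable borel" using d by measurable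
  define J where "J w = (\<integral>\<^sup>+x. ennreal (w x * (norm x)\<^sup>2) \<partial>lborel)" for w :: "'a \<Rightarrow> real"
  define h where "h w x = w x * (norm x)\<^sup>2 + w (\<sigma> x) * (norm (\<sigma> x))\<^sup>2" for w x
  have J2: "2 * J w = (\<integral>\<^sup>+x. ennreal (h w x) \<partial>lborel)"
    if [measurable]: "w \<in> borel_measurable borel" and w0: "\<And>x. 0 \<le> w x" for w
    using nn_integral_hreflect[OF d, of "\<lambda>x. ennreal (w x * (norm x)\<^sup>2)" s]
    by (simp add: h_def J_def mult_2 nn_integral_add w0)
  have hs: "h w (\<sigma> x) = h w x" for w x using d by (simp add: h_def)
  define g where "g x = (v (\<sigma> x) - v x) * ((norm (\<sigma> x))\<^sup>2 - (norm x)\<^sup>2)" for x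
  have le: "h (polarize d s v) x \<le> h v x" if "d \<bullet> x \<le> s" for x
  proof -
    have "v x * (norm x)\<^sup>2 + v (\<sigma> x) * (norm (\<sigma> x))\<^sup>2 - (v (\<sigma> x) * (norm x)\<^sup>2 + v x * (norm (\<sigma> x))\<^sup>2) = g x"
      by (simp add: g_def algebra_simps)
    moreover have "0 \<le> g x" if "v x \<le> v (\<sigma> x)"
      unfolding g_def using that norm_le_norm_hreflect[OF s \<open>d \<bullet> x \<le> s\<close>] by simp
    ultimately show ?thesis
      by (cases "v x \<le> v (\<sigma> x)") (simp_all add: h_def polarize_left[OF that] max_def min_def)
  qed
  have eq: "h (polarize d s v) x + g x = h v x" if "d \<bullet> x \<le> s" "v x \<le> v (\<sigma> x)" for x
    using that by (simp add: h_def g_def polarize_left[OF that(1)] max_def min_def algebra_simps)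
  have le': "h (polarize d s v) x \<le> h v x" for x
    using le[of x] le[of "\<sigma> x"] inner_hreflect_le[of x] by (cases "d \<bullet> x \<le> s") (simp_all add: hs)
  have cs: "continuous_on UNIV (\<lambda>x. v (\<sigma> x))"
    by (rule continuous_on_compose2[OF cont]) (auto intro: continuous_on_hreflect[OF d] continuous_intros)
  \<comment> \<open>Half of the gain at \<open>x0\<close> is exceeded on a whole neighbourhood,
    which gives a uniform lower bound on a set of positive measure.\<close>
  define \<delta> where "\<delta> = g x0 / 2"
  have \<delta>: "0 < \<delta>" using less x0 by (simp add: \<delta>_def g_def power_strict_mono)
  define U where "U = {x. d \<bullet> x < s \<and> v x < v (\<sigma> x) \<and> \<delta> < g x}"
  have "open U" unfolding U_def g_def
    by (intro open_Collect_conj open_Collect_less continuous_intros cont cs continuous_on_hreflect[OF d])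
  moreover have "x0 \<in> U" using x0 less \<delta> by (simp add: U_def \<delta>_def)
  ultimately have posU: "emeasure lborel U \<noteq> 0" and Um[measurable]: "U \<in> sets borel"
    using open_not_negligible[of U] negligible_iff_null_sets[of U]
    by (auto simp: null_sets_completion_iff null_sets_def)
  have hP0: "0 \<le> h (polarize d s v) x" for x
    unfolding h_def by (intro add_nonneg_nonneg mult_nonneg_nonneg polarize_nonneg v0) auto
  have "2 * J (polarize d s v) + ennreal \<delta> * emeasure lborel U
      = (\<integral>\<^sup>+x. ennreal (h (polarize d s v) x) + ennreal \<delta> * indicator U x \<partial>lborel)"
    using d by (subst J2) (auto simp: polarize_nonneg v0 nn_integral_add nn_integral_cmult h_def)
  also have "\<dots> \<le> (\<integral>\<^sup>+x. ennreal (h v x) \<partial>lborel)"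
  proof (rule nn_integral_mono)
    fix x
    show "ennreal (h (polarize d s v) x) + ennreal \<delta> * indicator U x \<le> ennreal (h v x)"
    proof (cases "x \<in> U")
      case True
      then have "h (polarize d s v) x + \<delta> \<le> h v x" using eq[of x] by (simp add: U_def)
      then show ?thesis using True \<delta> hP0[of x] by (simp flip: ennreal_plus add: ennreal_leI)
    qed (simp add: ennreal_leI le')
  qed
  also have "\<dots> = 2 * J v" by (subst J2) (auto simp: v0)
  also have "\<dots> \<le> 2 * J (polarize d s v)" using min by (simp add: J_def mult_left_mono)
  finally have "2 * J (polarize d s v) + ennreal \<delta> * emeasure lborel U \<le> 2 * J (polarize d s v) + 0" by simp
  \<comment> \<open>With \<open>fin\<close> this makes the moment of the polarized function finite,
    so that it cancels from both sides of the inequality above.\<close>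
  moreover have "J (polarize d s v) \<le> J v"
  proof -
    have "2 * J (polarize d s v) \<le> 2 * J v"
      by (subst (1 2) J2) (auto simp: polarize_nonneg v0 le' intro!: nn_integral_mono ennreal_leI)
    then show ?thesis by (subst (asm) ennreal_mult_le_mult_iff) auto
  qed
  then have "2 * J (polarize d s v) < \<infinity>" using fin by (auto simp: J_def ennreal_mult_less_top)
  ultimately have "ennreal \<delta> * emeasure lborel U = 0"
    by (metis ennreal_add_left_cancel_le infinity_ennreal_def le_zero_eq not_less_iff_gr_or_eq)
  then show False using \<delta> posU by simp
qed

end

subsection \<open>Existence of a radially decreasing competitor\<close>

text \<open>Each condition is stable under polarization with \<open>0 \<le> s\<close> and under
  pointwise limits. The first three give compactness. The inequalities point in the direction that
  the comparison of Sobolev quotients wants, and for positivity sets and energies they are what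
  Fatou's lemma preserves.\<close>

definition competitor :: "real \<Rightarrow> real \<Rightarrow> real \<Rightarrow> ('a::euclidean_space \<Rightarrow> real) \<Rightarrow> ('a \<Rightarrow> real) \<Rightarrow> bool" where
  "competitor e L R v0 v \<longleftrightarrow>
     (\<forall>x y. \<bar>v x - v y\<bar> \<le> L * norm (x - y)) \<and> (\<forall>x. 0 \<le> v x) \<and> (\<forall>x. R < norm x \<longrightarrow> v x = 0) \<and>
     emeasure lborel {x. 0 < v x} \<le> emeasure lborel {x. 0 < v0 x} \<and>
     (\<integral>\<^sup>+x. ennreal (v0 x powr e) \<partial>lborel) \<le> (\<integral>\<^sup>+x. ennreal (v x powr e) \<partial>lborel) \<and>
     (\<forall>t. energy t v \<le> energy t v0)"

lemma lipschitz_imp_continuous: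
  fixes v :: "'a::real_normed_vector \<Rightarrow> real"
  assumes "\<And>x y. \<bar>v x - v y\<bar> \<le> L * norm (x - y)"
  shows "continuous_on UNIV v"
proof -
  have "\<bar>v x - v y\<bar> \<le> max L 0 * norm (x - y)" for x y
    by (rule order_trans[OF assms mult_right_mono]) auto
  then have "(max L 0)-lipschitz_on UNIV v" by (intro lipschitz_onI) (auto simp: dist_norm)
  then show ?thesis by (rule lipschitz_on_continuous_on)
qed

text \<open>A point of norm \<open>R + 1\<close>, where \<open>v\<close> vanishes, lies within
  \<open>2 * R + 1\<close> of every \<open>x\<close> in the ball of radius \<open>R\<close>.\<close>

lemma lipschitz_vanishing_bound:
  fixes v :: "'a::euclidean_space \<Rightarrow> real"
  assumes lip: "\<And>x y. \<bar>v x - v y\<bar> \<le> L * norm (x - y)" and "0 \<le> L" "0 \<le> R"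
    and van: "\<And>x. R < norm x \<Longrightarrow> v x = 0"
  shows "\<bar>v x\<bar> \<le> L * (2 * R + 1)"
proof (cases "R < norm x")
  case False
  obtain b :: 'a where b: "norm b = R + 1"
    using vector_choose_size[of "R + 1"] \<open>0 \<le> R\<close> by auto
  have "\<bar>v x - v b\<bar> \<le> L * norm (x - b)" by (rule lip)
  also have "\<dots> \<le> L * (2 * R + 1)"
    using norm_triangle_ineq4[of x b] False b \<open>0 \<le> L\<close> by (intro mult_left_mono) auto
  finally show ?thesis using van[of b] b by simp
qed (use assms in auto)

lemma lipschitz_pointwise_subsequence:
  fixes F :: "nat \<Rightarrow> 'a::euclidean_space \<Rightarrow> real"
  assumes lip: "\<And>n x y. \<bar>F n x - F n y\<bar> \<le> L * norm (x - y)" and L: "0 \<le> L" and R: "0 \<le> R"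
    and van: "\<And>n x. R < norm x \<Longrightarrow> F n x = 0"
  obtains r w where "strict_mono (r :: nat \<Rightarrow> nat)" "\<And>x. (\<lambda>k. F (r k) x) \<longlonglongrightarrow> w x"
proof -
  have equi: "\<exists>d. 0 < d \<and> (\<forall>n y. y \<in> cball 0 R \<and> norm (x - y) < d \<longrightarrow> norm (F n x - F n y) < e)"
    if "x \<in> cball 0 R" "0 < e" for x :: 'a and e
  \<comment> \<open>Adding 1 to \<open>L\<close> covers \<open>L = 0\<close>.\<close>
  proof (intro exI[of _ "e / (L + 1)"] conjI allI impI)
    show "0 < e / (L + 1)" using \<open>0 < e\<close> L by simp
    fix n y assume "y \<in> cball 0 R \<and> norm (x - y) < e / (L + 1)"
    then have "norm (x - y) * (L + 1) < e" using L by (simp add: pos_less_divide_eq)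
    moreover have "L * norm (x - y) \<le> norm (x - y) * (L + 1)" by (simp add: algebra_simps)
    ultimately show "norm (F n x - F n y) < e" using lip[of n x y] unfolding real_norm_def by linarith
  qed
  have bd: "norm (F n x) \<le> L * (2 * R + 1)" for n x
    using lipschitz_vanishing_bound[of "F n" L R x] lip L R van by simp
  obtain g r where g: "continuous_on (cball 0 R) g" "strict_mono (r :: nat \<Rightarrow> nat)"
    and conv: "\<And>e. 0 < e \<Longrightarrow> \<exists>N. \<forall>n x. n \<ge> N \<and> x \<in> cball 0 R \<longrightarrow> norm (F (r n) x - g x) < e"
    by (rule Arzela_Ascoli[OF compact_cball bd equi]) auto
  show ?thesis
  proof (rule that[OF g(2)])
    fix x
    show "(\<lambda>k. F (r k) x) \<longlonglongrightarrow> (if norm x \<le> R then g x else 0)"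
    proof (cases "norm x \<le> R")
      case True
      have "\<exists>N. \<forall>n\<ge>N. norm (F (r n) x - g x) < e" if "0 < e" for e
        using conv[OF that] True by auto
      then show ?thesis using True by (simp add: LIMSEQ_iff)
    qed (simp add: van)
  qed
qed

text \<open>Fatou's lemma, once in each variable.\<close>

lemma energy_le_liminf:
  fixes F :: "nat \<Rightarrow> 'a::euclidean_space \<Rightarrow> 'b::euclidean_space"
  assumes [measurable]: "\<And>n. F n \<in> borel_measurable borel" and lim: "\<And>x. (\<lambda>k. F k x) \<longlonglongrightarrow> w x"
  shows "energy t w \<le> liminf (\<lambda>k. energy t (F k))"
proof -
  have [measurable]: "ball (0::'a) t \<in> sets borel" by simp
  define G where "G k x y = ennreal (indicat_real (ball 0 t) (x - y) * (norm (F k x - F k y))\<^sup>2)" for k x y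
  have [measurable]: "(\<lambda>z. F k (fst z)) \<in> borel_measurable (borel \<Otimes>\<^sub>M borel)"
    "(\<lambda>z. F k (snd z)) \<in> borel_measurable (borel \<Otimes>\<^sub>M borel)" for k by measurable
  have Gm[measurable]: "case_prod (G k) \<in> borel_measurable (borel \<Otimes>\<^sub>M borel)" for k
    unfolding G_def by measurable
  have [measurable]: "G k x \<in> borel_measurable borel" for k x
    using measurable_Pair2[OF Gm, of x k] by simp
  have "energy t w = (\<integral>\<^sup>+x. \<integral>\<^sup>+y. liminf (\<lambda>k. G k x y) \<partial>lborel \<partial>lborel)"
    unfolding energy_def G_def
    by (intro nn_integral_cong lim_imp_Liminf[symmetric] tendsto_ennrealI tendsto_intros lim) simp
  also have "\<dots> \<le> (\<integral>\<^sup>+x. liminf (\<lambda>k. \<integral>\<^sup>+y. G k x y \<partial>lborel) \<partial>lborel)"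
    by (intro nn_integral_mono nn_integral_liminf) measurable
  also have "\<dots> \<le> liminf (\<lambda>k. \<integral>\<^sup>+x. \<integral>\<^sup>+y. G k x y \<partial>lborel \<partial>lborel)"
    by (rule nn_integral_liminf) measurable
  finally show ?thesis by (simp add: energy_def G_def)
qed

text \<open>Where the limit is positive, the approximants eventually are, so Fatou bounds the
  positivity set; Fatou also bounds the energies. The power integral needs the opposite direction
  and passes to the limit by dominated convergence, with a constant on the fixed ball as
  majorant.\<close>

lemma competitor_limit:
  fixes v0 :: "'a::euclidean_space \<Rightarrow> real"
  assumes F: "\<And>n. competitor e L R v0 (F n)" and lim: "\<And>x. (\<lambda>k. F k x) \<longlonglongrightarrow> w x"
    and L: "0 \<le> L" and R: "0 \<le> R" and e: "0 < e"
  shows "competitor e L R v0 w"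
proof -
  have lip: "\<bar>F n x - F n y\<bar> \<le> L * norm (x - y)" for n x y using F by (simp add: competitor_def)
  have F0: "0 \<le> F n x" for n x using F by (simp add: competitor_def)
  have van: "F n x = 0" if "R < norm x" for n x using F that by (simp add: competitor_def)
  have Fmeas: "emeasure lborel {x. 0 < F n x} \<le> emeasure lborel {x. 0 < v0 x}" for n
    using F by (simp add: competitor_def)
  have Fen: "energy t (F n) \<le> energy t v0" for t n using F by (simp add: competitor_def)
  have Fm[measurable]: "F n \<in> borel_measurable borel" for n
    by (rule borel_measurable_continuous_onI[OF lipschitz_imp_continuous[OF lip]])
  have wlip: "\<bar>w x - w y\<bar> \<le> L * norm (x - y)" for x y
    by (rule LIMSEQ_le_const2[OF tendsto_rabs[OF tendsto_diff[OF lim lim]]]) (simp add: lip)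
  have wm[measurable]: "w \<in> borel_measurable borel"
    by (rule borel_measurable_continuous_onI[OF lipschitz_imp_continuous[OF wlip]])
  have w0: "0 \<le> w x" for x
    by (rule LIMSEQ_le_const[OF lim]) (auto intro: F0)
  have wvan: "w x = 0" if "R < norm x" for x
    using lim[of x] by (simp add: van that LIMSEQ_const_iff)
  have meas: "emeasure lborel {x. 0 < w x} \<le> emeasure lborel {x. 0 < v0 x}"
  proof -
    have "emeasure lborel {x. 0 < w x} = (\<integral>\<^sup>+x. indicator {x. 0 < w x} x \<partial>lborel)" by simp
    also have "\<dots> \<le> (\<integral>\<^sup>+x. liminf (\<lambda>n. indicator {x. 0 < F n x} x) \<partial>lborel)"
    proof (rule nn_integral_mono)
      fix x
      show "indicator {x. 0 < w x} x \<le> liminf (\<lambda>n. indicator {x. 0 < F n x} x :: ennreal)"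
      proof (cases "0 < w x")
        case True
        have "\<forall>\<^sub>F n in sequentially. 0 < F n x" using lim[of x] True by (rule order_tendstoD)
        then have "\<forall>\<^sub>F n in sequentially. indicator {x. 0 < w x} x \<le> (indicator {x. 0 < F n x} x :: ennreal)"
          by eventually_elim (simp add: True)
        then show ?thesis by (rule Liminf_bounded)
      qed simp
    qed
    also have "\<dots> \<le> liminf (\<lambda>n. \<integral>\<^sup>+x. indicator {x. 0 < F n x} x \<partial>lborel)"
      by (rule nn_integral_liminf) measurable
    also have "\<dots> = liminf (\<lambda>n. emeasure lborel {x. 0 < F n x})" by simp
    also have "\<dots> \<le> emeasure lborel {x. 0 < v0 x}"
      by (rule Liminf_le) (simp_all add: Fmeas)
    finally show ?thesis .
  qed
  have int: "(\<integral>\<^sup>+x. ennreal (v0 x powr e) \<partial>lborel) \<le> (\<integral>\<^sup>+x. ennreal (w x powr e) \<partial>lborel)"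
  proof (rule LIMSEQ_le_const)
    show "(\<lambda>n. \<integral>\<^sup>+x. ennreal (F n x powr e) \<partial>lborel) \<longlonglongrightarrow> (\<integral>\<^sup>+x. ennreal (w x powr e) \<partial>lborel)"
    proof -
      define W :: "'a \<Rightarrow> ennreal" where
        "W = (\<lambda>x. ennreal ((L * (2 * R + 1)) powr e) * indicator (cball 0 R) x)"
      have Wm: "W \<in> borel_measurable lborel" unfolding W_def
        by (intro borel_measurable_times_ennreal borel_measurable_const borel_measurable_indicator) simp
      have Wfin: "(\<integral>\<^sup>+x. W x \<partial>lborel) < \<infinity>"
        using R unfolding W_def by (subst nn_integral_cmult_indicator) (auto simp: emeasure_cball ennreal_mult_less_top)
      have bound: "ennreal (F j x powr e) \<le> W x" for j x
      proof (cases "norm x \<le> R")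
        case True
        have "F j x powr e \<le> (L * (2 * R + 1)) powr e"
          using lipschitz_vanishing_bound[of "F j" L R x, OF lip L R van] F0[of j x] e
          by (intro powr_mono2) auto
        then show ?thesis using True by (simp add: W_def ennreal_leI)
      qed (simp add: van)
      have conv: "(\<lambda>i. ennreal (F i x powr e)) \<longlonglongrightarrow> ennreal (w x powr e)" for x
      proof (rule tendsto_ennrealI)
        show "(\<lambda>i. F i x powr e) \<longlonglongrightarrow> w x powr e"
          by (rule tendsto_powr2[OF lim tendsto_const]) (simp_all add: F0 e)
      qed
      have m1: "(\<lambda>x. ennreal (F j x powr e)) \<in> borel_measurable lborel" for j by measurable
      have m2: "(\<lambda>x. ennreal (w x powr e)) \<in> borel_measurable lborel" by measurable
      show ?thesis
        by (rule nn_integral_dominated_convergence[OF m1 m2 Wm AE_I2[OF bound] Wfin AE_I2[OF conv]])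
    qed
    show "\<exists>N. \<forall>n\<ge>N. (\<integral>\<^sup>+x. ennreal (v0 x powr e) \<partial>lborel) \<le> (\<integral>\<^sup>+x. ennreal (F n x powr e) \<partial>lborel)"
      using F by (simp add: competitor_def)
  qed
  have en: "energy t w \<le> energy t v0" for t
  proof -
    have "energy t w \<le> liminf (\<lambda>k. energy t (F k))" by (rule energy_le_liminf[OF Fm lim])
    also have "\<dots> \<le> energy t v0" by (rule Liminf_le) (simp_all add: Fen)
    finally show ?thesis .
  qed
  show ?thesis unfolding competitor_def by (intro conjI allI impI wlip w0 wvan meas int en)
qed

theorem exists_radial_competitor:
  fixes v0 :: "'a::euclidean_space \<Rightarrow> real"
  assumes lip: "\<And>x y. \<bar>v0 x - v0 y\<bar> \<le> L * norm (x - y)" and L: "0 \<le> L" and R: "0 \<le> R" and e: "0 < e"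
    and nonneg: "\<And>x. 0 \<le> v0 x" and van: "\<And>x. R < norm x \<Longrightarrow> v0 x = 0"
  obtains v where "competitor e L R v0 v" "\<And>x y. norm x < norm y \<Longrightarrow> v y \<le> v x"
proof -
  define J where "J w = (\<integral>\<^sup>+x. ennreal (w x * (norm x)\<^sup>2) \<partial>lborel)" for w :: "'a \<Rightarrow> real"
  have "competitor e L R v0 v0" using assms by (auto simp: competitor_def)
  then have ne: "J ` Collect (competitor e L R v0) \<noteq> {}" by blast
  obtain f :: "nat \<Rightarrow> ennreal" where f: "decseq f" "range f \<subseteq> J ` Collect (competitor e L R v0)"
    and Inf: "Inf (J ` Collect (competitor e L R v0)) = (INF i. f i)"
    using ennreal_Inf_countable_INF[OF ne] by blast
  have "\<exists>G. \<forall>n. competitor e L R v0 (G n) \<and> f n = J (G n)"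
    using f(2) by (intro choice) blast
  then obtain G where G: "\<And>n. competitor e L R v0 (G n)" "\<And>n. f n = J (G n)" by blast
  obtain r v where r: "strict_mono r" and lim: "\<And>x. (\<lambda>k. G (r k) x) \<longlonglongrightarrow> v x"
  proof (rule lipschitz_pointwise_subsequence[of G L R])
    show "\<bar>G n x - G n y\<bar> \<le> L * norm (x - y)" for n x y using G(1)[of n] by (simp add: competitor_def)
    show "G n x = 0" if "R < norm x" for n x using G(1)[of n] that by (simp add: competitor_def)
  qed (use L R in auto)
  have cv: "competitor e L R v0 v"
    by (rule competitor_limit[OF G(1) lim L R e])
  have meas: "w \<in> borel_measurable borel" if "competitor e L R v0 w" for w
    using that lipschitz_imp_continuous[of w L] by (intro borel_measurable_continuous_onI) (simp add: competitor_def)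
  have Gm[measurable]: "G n \<in> borel_measurable borel" for n using meas[OF G(1)] .
  \<comment> \<open>The values \<open>f\<close> decrease to the infimum of the second moment, and by
    Fatou the limit \<open>v\<close> attains it.\<close>
  have Jv: "J v \<le> J w" if "competitor e L R v0 w" for w
  proof -
    have "J v = (\<integral>\<^sup>+x. liminf (\<lambda>k. ennreal (G (r k) x * (norm x)\<^sup>2)) \<partial>lborel)"
      unfolding J_def
      by (intro nn_integral_cong lim_imp_Liminf[symmetric] tendsto_ennrealI tendsto_intros lim) simp
    also have "\<dots> \<le> liminf (\<lambda>k. J (G (r k)))"
      unfolding J_def by (rule nn_integral_liminf) measurable
    also have "\<dots> = liminf (f \<circ> r)" by (simp add: G(2) o_def)
    also have "\<dots> = (INF i. f i)"
      using LIMSEQ_subseq_LIMSEQ[OF LIMSEQ_INF[OF f(1)] r] by (intro lim_imp_Liminf) simp_all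
    also have "\<dots> \<le> J w" unfolding Inf[symmetric] using that by (intro Inf_lower) blast
    finally show ?thesis .
  qed
  have vlip: "\<bar>v x - v y\<bar> \<le> L * norm (x - y)" and v0: "0 \<le> v x" and vvan: "R < norm x \<Longrightarrow> v x = 0" for x y
    using cv by (simp_all add: competitor_def)
  have fin: "J v < \<infinity>"
  proof -
    have "J v \<le> (\<integral>\<^sup>+x. ennreal (L * (2 * R + 1) * R\<^sup>2) * indicator (cball 0 R) x \<partial>(lborel :: 'a measure))"
      unfolding J_def
    proof (rule nn_integral_mono)
      fix x :: 'a
      show "ennreal (v x * (norm x)\<^sup>2) \<le> ennreal (L * (2 * R + 1) * R\<^sup>2) * indicator (cball 0 R) x"
        using lipschitz_vanishing_bound[of v L R x] vlip L R vvan[of x] v0[of x]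
        by (cases "norm x \<le> R") (auto intro!: ennreal_leI mult_mono power_mono simp: vvan simp del: ennreal_mult')
    qed
    also have "\<dots> < \<infinity>" using R by (subst nn_integral_cmult_indicator) (auto simp: emeasure_cball ennreal_mult_less_top)
    finally show ?thesis .
  qed
  have vm[measurable]: "v \<in> borel_measurable borel" by (rule meas[OF cv])
  have "v y \<le> v x" if xy: "norm x < norm y" for x y
  proof -
    define N where "N = norm (y - x)"
    have N: "0 < N" using xy by (auto simp: N_def)
    \<comment> \<open>The mirror \<open>d \<bullet> z = s\<close> is the perpendicular bisector of
      the segment from \<open>x\<close> to \<open>y\<close>, so \<open>y\<close> is the mirror image
      of \<open>x\<close>; \<open>0 \<le> s\<close> because \<open>x\<close> is closer to the
      origin. Minimality of \<open>v\<close> against its polarization then orders the two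
      values.\<close>
    define d where "d = (1 / N) *\<^sub>R (y - x)"
    define s where "s = ((norm y)\<^sup>2 - (norm x)\<^sup>2) / (2 * N)"
    have d: "norm d = 1" using N by (simp add: d_def N_def)
    have s: "0 \<le> s" using N xy by (simp add: s_def power_mono)
    have "N\<^sup>2 = (norm y)\<^sup>2 + (norm x)\<^sup>2 - 2 * (y \<bullet> x)"
      by (simp add: N_def power2_norm_eq_inner inner_diff_left inner_diff_right inner_commute)
    moreover have "d \<bullet> x = (y \<bullet> x - (norm x)\<^sup>2) / N"
      using N by (simp add: d_def inner_diff_left power2_norm_eq_inner)
    ultimately have dx: "d \<bullet> x - s = - N / 2"
      using N by (simp add: s_def field_simps power2_eq_square)
    have refl: "hreflect d s x = y" unfolding hreflect_def dx using N by (simp add: d_def)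
    have "competitor e L R v0 (polarize d s v)"
      unfolding competitor_def
    proof (intro conjI allI impI)
      fix a b t
      show "\<bar>polarize d s v a - polarize d s v b\<bar> \<le> L * norm (a - b)"
        by (rule lipschitz_polarize[OF d vm vlip L])
      show "0 \<le> polarize d s v a" by (rule polarize_nonneg[OF d vm v0])
      show "R < norm a \<Longrightarrow> polarize d s v a = 0" by (rule polarize_vanishes[OF d vm s v0 vvan])
      show "energy t (polarize d s v) \<le> energy t v0"
        by (rule order_trans[OF energy_polarize[OF d vm]]) (use cv in \<open>simp add: competitor_def\<close>)
      have "(\<integral>\<^sup>+x. ennreal (polarize d s v x powr e) \<partial>lborel) = (\<integral>\<^sup>+x. ennreal (v x powr e) \<partial>lborel)"
        using nn_integral_polarize[OF d vm, of "\<lambda>z. ennreal (z powr e)"] by simp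
      then show "(\<integral>\<^sup>+x. ennreal (v0 x powr e) \<partial>lborel) \<le> (\<integral>\<^sup>+x. ennreal (polarize d s v x powr e) \<partial>lborel)"
        using cv by (simp add: competitor_def)
      have [measurable]: "polarize d s v \<in> borel_measurable borel" by (rule borel_measurable_polarize[OF d vm])
      have pos: "emeasure lborel {x. 0 < u x} = (\<integral>\<^sup>+x. indicator {0<..} (u x) \<partial>lborel)"
        if [measurable]: "u \<in> borel_measurable borel" for u :: "'a \<Rightarrow> real"
      proof -
        have "indicator {0<..} (u x) = (indicator {x. 0 < u x} x :: ennreal)" for x by (simp add: indicator_def)
        then show ?thesis by simp
      qed
      have "emeasure lborel {x. 0 < polarize d s v x} = (\<integral>\<^sup>+x. indicator {0<..} (polarize d s v x) \<partial>lborel)"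
        by (rule pos[OF borel_measurable_polarize[OF d vm]])
      also have "\<dots> = (\<integral>\<^sup>+x. indicator {0<..} (v x) \<partial>lborel)"
        by (rule nn_integral_polarize[OF d vm]) measurable
      also have "\<dots> = emeasure lborel {x. 0 < v x}"
        by (rule pos[OF vm, symmetric])
      finally show "emeasure lborel {x. 0 < polarize d s v x} \<le> emeasure lborel {x. 0 < v0 x}"
        using cv by (simp add: competitor_def)
    qed
    then have "J v \<le> J (polarize d s v)" by (rule Jv)
    then have "v (hreflect d s x) \<le> v x"
      using fin xy N dx refl unfolding J_def
      by (intro moment_polarize[OF d vm s v0 lipschitz_imp_continuous[OF vlip]]) auto
    then show ?thesis by (simp add: refl)
  qed
  then show ?thesis by (rule that[OF cv])
qed

subsection \<open>Difference energy and gradient\<close>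

text \<open>The fundamental theorem of calculus along the segment from \<open>x\<close> to
  \<open>x + h\<close>, followed by Cauchy-Schwarz against the indicator of the unit interval, whose
  integral is 1.\<close>

lemma norm_difference_sq_le_nn_integral:
  fixes f :: "'a::euclidean_space \<Rightarrow> 'b::euclidean_space"
  assumes der: "\<And>x. (f has_derivative f' x) (at x)"
    and cont: "\<And>h. continuous_on UNIV (\<lambda>x. f' x h)"
  shows "ennreal ((norm (f (x + h) - f x))\<^sup>2)
    \<le> (\<integral>\<^sup>+s. indicator {0..1} s * ennreal ((norm (f' (x + s *\<^sub>R h) h))\<^sup>2) \<partial>lborel)"
proof -
  define w where "w s = f' (x + s *\<^sub>R h) h" for s
  have cw: "continuous_on UNIV w"
    unfolding w_def by (rule continuous_on_compose2[OF cont]) (auto intro!: continuous_intros)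
  have wm[measurable]: "w \<in> borel_measurable borel" by (rule borel_measurable_continuous_onI[OF cw])
  have vd: "((\<lambda>s. f (x + s *\<^sub>R h)) has_vector_derivative w s) (at s within {0..1})" for s
  proof -
    have "((\<lambda>s. f (x + s *\<^sub>R h)) has_derivative (\<lambda>r. f' (x + s *\<^sub>R h) (r *\<^sub>R h))) (at s within {0..1})"
      by (rule has_derivative_compose[OF _ der]) (auto intro!: derivative_eq_intros)
    moreover have "linear (f' (x + s *\<^sub>R h))" using der by (rule has_derivative_linear)
    ultimately show ?thesis by (simp add: has_vector_derivative_def w_def linear_scale)
  qed
  have int: "(LINT s|lborel. indicator {0..1} s *\<^sub>R w s) = f (x + 1 *\<^sub>R h) - f (x + 0 *\<^sub>R h)"
    by (rule integral_FTC_Icc[OF _ vd]) (auto intro: continuous_on_subset[OF cw])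
  have "integrable lborel (\<lambda>s. indicator {0..1} s *\<^sub>R w s)"
    using borel_integrable_compact[of "{0..1}" w] continuous_on_subset[OF cw] by (auto simp: set_integrable_def)
  then have "ennreal (norm (f (x + h) - f x)) \<le> (\<integral>\<^sup>+s. norm (indicator {0..1} s *\<^sub>R w s) \<partial>lborel)"
    using integral_norm_bound_ennreal[of lborel "\<lambda>s. indicator {0..1} s *\<^sub>R w s"] int by simp
  also have "\<dots> = (\<integral>\<^sup>+s. indicator {0..1} s * ennreal (norm (indicator {0..1} s *\<^sub>R w s)) \<partial>lborel)"
    by (intro nn_integral_cong) (auto simp: indicator_def)
  finally have "(ennreal (norm (f (x + h) - f x)))\<^sup>2
      \<le> (\<integral>\<^sup>+s. indicator {0..1} s * ennreal (norm (indicator {0..1} s *\<^sub>R w s)) \<partial>lborel)\<^sup>2"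
    by (rule power_mono) simp
  also have "\<dots> \<le> (\<integral>\<^sup>+s. (indicator {0..1::real} s)\<^sup>2 \<partial>lborel) * (\<integral>\<^sup>+s. (ennreal (norm (indicator {0..1} s *\<^sub>R w s)))\<^sup>2 \<partial>lborel)"
    by (rule Cauchy_Schwarz_nn_integral) auto
  also have "(\<integral>\<^sup>+s. (indicator {0..1::real} s)\<^sup>2 \<partial>lborel) = (\<integral>\<^sup>+s. indicator {0..1::real} s \<partial>lborel)"
    by (intro nn_integral_cong) (auto simp: indicator_def)
  also have "\<dots> = 1" by simp
  also have "(\<integral>\<^sup>+s. (ennreal (norm (indicator {0..1} s *\<^sub>R w s)))\<^sup>2 \<partial>lborel)
      = (\<integral>\<^sup>+s. indicator {0..1} s * ennreal ((norm (w s))\<^sup>2) \<partial>lborel)"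
    by (intro nn_integral_cong) (auto simp: indicator_def ennreal_power)
  finally show ?thesis by (simp add: w_def ennreal_power)
qed

text \<open>After Fubini each point \<open>s\<close> of the segment contributes the same integral,
  by translation invariance.\<close>

lemma nn_integral_difference_le:
  fixes f :: "'a::euclidean_space \<Rightarrow> 'b::euclidean_space"
  assumes der: "\<And>x. (f has_derivative f' x) (at x)"
    and cont: "\<And>h. continuous_on UNIV (\<lambda>x. f' x h)"
  shows "(\<integral>\<^sup>+x. ennreal ((norm (f (x + h) - f x))\<^sup>2) \<partial>lborel) \<le> (\<integral>\<^sup>+x. ennreal ((norm (f' x h))\<^sup>2) \<partial>lborel)"
proof -
  have [measurable]: "(\<lambda>x. f' x h) \<in> borel_measurable borel" by (rule borel_measurable_continuous_onI[OF cont])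
  have "(\<integral>\<^sup>+x. ennreal ((norm (f (x + h) - f x))\<^sup>2) \<partial>lborel) \<le>
      (\<integral>\<^sup>+x. \<integral>\<^sup>+s. indicator {0..1} s * ennreal ((norm (f' (x + s *\<^sub>R h) h))\<^sup>2) \<partial>lborel \<partial>lborel)"
    by (intro nn_integral_mono norm_difference_sq_le_nn_integral[OF der cont])
  also have "\<dots> = (\<integral>\<^sup>+s. \<integral>\<^sup>+x. indicator {0..1} s * ennreal ((norm (f' (x + s *\<^sub>R h) h))\<^sup>2) \<partial>lborel \<partial>lborel)"
  proof (rule lborel_pair.Fubini'[symmetric])
    have "(\<lambda>z::'a \<times> real. f' (fst z + snd z *\<^sub>R h) h) \<in> borel_measurable borel"
      by (intro borel_measurable_continuous_onI continuous_on_compose2[OF cont]) (auto intro!: continuous_intros)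
    then have [measurable]: "(\<lambda>z::'a \<times> real. f' (fst z + snd z *\<^sub>R h) h) \<in> borel_measurable (borel \<Otimes>\<^sub>M borel)"
      by (simp add: borel_prod)
    show "(\<lambda>(x, s). indicator {0..1} s * ennreal ((norm (f' (x + s *\<^sub>R h) h))\<^sup>2)) \<in> borel_measurable (lborel \<Otimes>\<^sub>M lborel)"
      unfolding split_beta by measurable
  qed
  also have "\<dots> = (\<integral>\<^sup>+s. indicator {0..1::real} s * (\<integral>\<^sup>+x. ennreal ((norm (f' x h))\<^sup>2) \<partial>lborel) \<partial>lborel)"
  proof (rule nn_integral_cong)
    fix s :: real
    have [measurable]: "(\<lambda>x. f' (x + s *\<^sub>R h) h) \<in> borel_measurable borel"
      by (intro borel_measurable_continuous_onI continuous_on_compose2[OF cont]) (auto intro!: continuous_intros)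
    have "(\<integral>\<^sup>+x. ennreal ((norm (f' (x + s *\<^sub>R h) h))\<^sup>2) \<partial>lborel) = (\<integral>\<^sup>+x. ennreal ((norm (f' x h))\<^sup>2) \<partial>lborel)"
      by (rule nn_integral_lborel_translate) measurable
    then show "(\<integral>\<^sup>+x. indicator {0..1} s * ennreal ((norm (f' (x + s *\<^sub>R h) h))\<^sup>2) \<partial>lborel) =
        indicator {0..1} s * (\<integral>\<^sup>+x. ennreal ((norm (f' x h))\<^sup>2) \<partial>lborel)"
      by (subst nn_integral_cmult) auto
  qed
  also have "\<dots> = (\<integral>\<^sup>+x. ennreal ((norm (f' x h))\<^sup>2) \<partial>lborel)"
    by (simp add: nn_integral_multc)
  finally show ?thesis .
qed

lemma energy_translation_form:
  fixes f :: "'a::euclidean_space \<Rightarrow> 'b::euclidean_space"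
  assumes f[measurable]: "f \<in> borel_measurable borel"
  shows "energy t f = (\<integral>\<^sup>+x. \<integral>\<^sup>+h. ennreal (indicat_real (ball 0 t) h * (norm (f (x + h) - f x))\<^sup>2) \<partial>lborel \<partial>lborel)"
  unfolding energy_def
proof (rule nn_integral_cong)
  fix x :: 'a
  have [measurable]: "ball (0::'a) t \<in> sets borel" by simp
  have "(\<integral>\<^sup>+h. ennreal (indicat_real (ball 0 t) (x - (h + x)) * (norm (f x - f (h + x)))\<^sup>2) \<partial>lborel) =
      (\<integral>\<^sup>+y. ennreal (indicat_real (ball 0 t) (x - y) * (norm (f x - f y))\<^sup>2) \<partial>lborel)"
    by (rule nn_integral_lborel_translate) measurable
  then show "(\<integral>\<^sup>+y. ennreal (indicat_real (ball 0 t) (x - y) * (norm (f x - f y))\<^sup>2) \<partial>lborel) =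
      (\<integral>\<^sup>+h. ennreal (indicat_real (ball 0 t) h * (norm (f (x + h) - f x))\<^sup>2) \<partial>lborel)"
    by (simp add: indicator_def norm_minus_commute add.commute)
qed

text \<open>Sorting pairs by their displacement \<open>h\<close> exhibits the energy as an integral
  of squared \<open>L\<^sup>2\<close> distances between \<open>f\<close> and its translates. Bounds
  that hold for each \<open>h\<close> separately, as for gradients and convolutions, can then be
  integrated.\<close>

lemma energy_Fubini:
  fixes f :: "'a::euclidean_space \<Rightarrow> 'b::euclidean_space"
  assumes f[measurable]: "f \<in> borel_measurable borel"
  shows "energy t f = (\<integral>\<^sup>+h. indicator (ball 0 t) h * (\<integral>\<^sup>+x. ennreal ((norm (f (x + h) - f x))\<^sup>2) \<partial>lborel) \<partial>lborel)"
proof -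
  have [measurable]: "ball (0::'a) t \<in> sets borel" by simp
  have [measurable]: "(\<lambda>z. f (fst z + snd z)) \<in> borel_measurable (borel \<Otimes>\<^sub>M borel)"
    "(\<lambda>z. f (fst z)) \<in> borel_measurable (borel \<Otimes>\<^sub>M (borel :: 'a measure))" by measurable
  have "energy t f = (\<integral>\<^sup>+h. \<integral>\<^sup>+x. ennreal (indicat_real (ball 0 t) h * (norm (f (x + h) - f x))\<^sup>2) \<partial>lborel \<partial>lborel)"
    unfolding energy_translation_form[OF f] by (rule lborel_pair.Fubini'[symmetric]) measurable
  also have "\<dots> = (\<integral>\<^sup>+h. indicator (ball 0 t) h * (\<integral>\<^sup>+x. ennreal ((norm (f (x + h) - f x))\<^sup>2) \<partial>lborel) \<partial>lborel)"
  proof (rule nn_integral_cong)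
    fix h :: 'a
    have "(\<integral>\<^sup>+x. ennreal (indicat_real (ball 0 t) h * (norm (f (x + h) - f x))\<^sup>2) \<partial>lborel)
      = (\<integral>\<^sup>+x. indicator (ball 0 t) h * ennreal ((norm (f (x + h) - f x))\<^sup>2) \<partial>lborel)"
      by (intro nn_integral_cong) (auto simp: indicator_def)
    then show "(\<integral>\<^sup>+x. ennreal (indicat_real (ball 0 t) h * (norm (f (x + h) - f x))\<^sup>2) \<partial>lborel)
      = indicator (ball 0 t) h * (\<integral>\<^sup>+x. ennreal ((norm (f (x + h) - f x))\<^sup>2) \<partial>lborel)"
      by (simp add: nn_integral_cmult)
  qed
  finally show ?thesis .
qed

text \<open>By rotation invariance the choice of the coordinate \<^const>\<open>undefined\<close> is immaterial.\<close>

definition ball_moment :: "'n::finite itself \<Rightarrow> real \<Rightarrow> ennreal" where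
  "ball_moment _ t = (\<integral>\<^sup>+h. indicator (ball (0::real^'n) t) h * ennreal ((h $ undefined)\<^sup>2) \<partial>lborel)"

text \<open>An orthogonal map carries \<open>norm a\<close> times a coordinate vector to
  \<open>a\<close> and preserves both the ball and the measure.\<close>

lemma ball_moment_inner:
  fixes a :: "real^'n"
  shows "(\<integral>\<^sup>+h. indicator (ball 0 t) h * ennreal ((a \<bullet> h)\<^sup>2) \<partial>lborel)
    = ennreal ((norm a)\<^sup>2) * ball_moment TYPE('n) t"
proof -
  obtain T :: "real^'n \<Rightarrow> real^'n" where T: "orthogonal_transformation T" "T (norm a *\<^sub>R axis undefined 1) = a"
    using orthogonal_transformation_exists[of "norm a *\<^sub>R axis undefined 1" a] by (auto simp: norm_axis_1)
  have [measurable]: "ball (0::real^'n) t \<in> sets borel" by simp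
  have "a \<bullet> T h = norm a * (h $ undefined)" for h
  proof -
    have "a \<bullet> T h = T (norm a *\<^sub>R axis undefined 1) \<bullet> T h" using T(2) by simp
    also have "\<dots> = (norm a *\<^sub>R axis undefined 1) \<bullet> h"
      using T(1) unfolding orthogonal_transformation_def by blast
    finally show ?thesis by (simp add: inner_axis inner_commute)
  qed
  moreover have "norm (T h) = norm h" for h using T(1) by (rule orthogonal_transformation_norm)
  ultimately have eq: "indicator (ball 0 t) (T h) * ennreal ((a \<bullet> T h)\<^sup>2)
      = ennreal ((norm a)\<^sup>2) * (indicator (ball 0 t) h * ennreal ((h $ undefined)\<^sup>2))" for h
    by (simp add: indicator_def power_mult_distrib ennreal_mult)
  have "(\<integral>\<^sup>+h. indicator (ball 0 t) h * ennreal ((a \<bullet> h)\<^sup>2) \<partial>lborel) =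
      (\<integral>\<^sup>+h. indicator (ball 0 t) (T h) * ennreal ((a \<bullet> T h)\<^sup>2) \<partial>lborel)"
    by (rule nn_integral_lborel_orthogonal_transformation[OF _ T(1), symmetric]) measurable
  also have "\<dots> = (\<integral>\<^sup>+h. ennreal ((norm a)\<^sup>2) * (indicator (ball 0 t) h * ennreal ((h $ undefined)\<^sup>2)) \<partial>(lborel :: (real^'n) measure))"
    unfolding eq ..
  also have "\<dots> = ennreal ((norm a)\<^sup>2) * ball_moment TYPE('n) t"
    unfolding ball_moment_def by (rule nn_integral_cmult) measurable
  finally show ?thesis .
qed

text \<open>The exponent is the dimension, from the volume, plus 2, from the squared
  coordinate.\<close>

lemma ball_moment_scale:
  assumes t: "0 < t"
  shows "ball_moment TYPE('n::finite) t = ennreal (t powr (real CARD('n) + 2)) * ball_moment TYPE('n) 1"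
proof -
  have [measurable]: "ball (0::real^'n) t \<in> sets borel" for t by simp
  have "(\<integral>\<^sup>+h. indicator (ball (0::real^'n) t) (t *\<^sub>R h) * ennreal (((t *\<^sub>R h) $ undefined)\<^sup>2) \<partial>lborel)
      = ennreal (t powr - real DIM(real^'n)) * ball_moment TYPE('n) t"
    unfolding ball_moment_def by (rule nn_integral_lborel_scale[OF _ t]) measurable
  moreover have "(\<integral>\<^sup>+h. indicator (ball (0::real^'n) t) (t *\<^sub>R h) * ennreal (((t *\<^sub>R h) $ undefined)\<^sup>2) \<partial>lborel)
      = (\<integral>\<^sup>+h. ennreal (t\<^sup>2) * (indicator (ball (0::real^'n) 1) h * ennreal ((h $ undefined)\<^sup>2)) \<partial>lborel)"
    using t by (intro nn_integral_cong) (auto simp: indicator_def power_mult_distrib ennreal_mult)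
  moreover have "\<dots> = ennreal (t\<^sup>2) * ball_moment TYPE('n) 1"
    unfolding ball_moment_def by (rule nn_integral_cmult) measurable
  ultimately have "ennreal (t powr real CARD('n)) * (ennreal (t\<^sup>2) * ball_moment TYPE('n) 1)
     = ennreal (t powr real CARD('n)) * (ennreal (t powr - real CARD('n)) * ball_moment TYPE('n) t)"
    by simp
  also have "\<dots> = ennreal (t powr real CARD('n) * t powr - real CARD('n)) * ball_moment TYPE('n) t"
    by (simp add: ennreal_mult mult.assoc)
  also have "t powr real CARD('n) * t powr - real CARD('n) = 1" using t by (simp flip: powr_add)
  finally have "ball_moment TYPE('n) t = ennreal (t powr real CARD('n) * t\<^sup>2) * ball_moment TYPE('n) 1"
    by (simp add: ennreal_mult mult.assoc)
  then show ?thesis using t by (simp add: powr_add powr_numeral)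
qed

lemma ball_moment_finite: "ball_moment TYPE('n::finite) t < \<infinity>"
proof -
  have "ball_moment TYPE('n) t \<le> (\<integral>\<^sup>+h. ennreal (t\<^sup>2) * indicator (ball (0::real^'n) t) h \<partial>lborel)"
    unfolding ball_moment_def
  proof (rule nn_integral_mono)
    fix h :: "real^'n"
    have "(h $ undefined)\<^sup>2 \<le> t\<^sup>2" if "norm h < t"
      using component_le_norm_cart[of h undefined] that by (intro abs_le_square_iff[THEN iffD1]) auto
    then show "indicator (ball 0 t) h * ennreal ((h $ undefined)\<^sup>2) \<le> ennreal (t\<^sup>2) * indicator (ball 0 t) h"
      by (auto simp: indicator_def intro: ennreal_leI)
  qed
  also have "\<dots> < \<infinity>"
    using emeasure_lborel_ball_finite[of "0::real^'n" t]
    by (subst nn_integral_cmult_indicator) (auto simp: ennreal_mult_less_top)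
  finally show ?thesis .
qed

lemma ball_moment_pos: "0 < ball_moment TYPE('n::finite) 1"
proof (rule ccontr)
  define U where "U = {h::real^'n. norm h < 1 \<and> 0 < h $ undefined}"
  have [measurable]: "ball (0::real^'n) 1 \<in> sets borel" by simp
  assume "\<not> 0 < ball_moment TYPE('n) 1"
  then have "(\<integral>\<^sup>+h. indicator (ball (0::real^'n) 1) h * ennreal ((h $ undefined)\<^sup>2) \<partial>lborel) = 0"
    by (simp add: ball_moment_def)
  then have "AE h in lborel. indicator (ball (0::real^'n) 1) h * ennreal ((h $ undefined)\<^sup>2) = 0"
    by (subst (asm) nn_integral_0_iff_AE) auto
  then have "AE h in lborel. h \<notin> U"
    by eventually_elim (auto simp: U_def indicator_def)
  moreover have "open U" unfolding U_def
    by (intro open_Collect_conj open_Collect_less continuous_intros)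
  ultimately have "U = {}" by (intro open_AE_not_mem_imp_empty)
  moreover have "(1/2) *\<^sub>R axis undefined 1 \<in> U" by (simp add: U_def norm_axis_1)
  ultimately show False by blast
qed

section \<open>Comparing the difference energy with the Dirichlet integral\<close>

lemma linear_axis_expansion:
  fixes T :: "real^'n \<Rightarrow> 'b::real_vector"
  assumes T: "linear T"
  shows "T h = (\<Sum>i\<in>UNIV. (h $ i) *\<^sub>R T (axis i 1))"
proof -
  have "h = (\<Sum>i\<in>UNIV. (h $ i) *\<^sub>R axis i 1)" by (simp add: basis_expansion flip: scalar_mult_eq_scaleR)
  then have "T h = T (\<Sum>i\<in>UNIV. (h $ i) *\<^sub>R axis i 1)" by simp
  then show ?thesis by (simp add: linear_sum[OF T] linear_scale[OF T])
qed

lemma difference_quotient_tendsto: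
  fixes f :: "'a::real_normed_vector \<Rightarrow> 'b::real_normed_vector"
  assumes der: "(f has_derivative f') (at x)" and T: "\<And>k. 0 < T k" and T0: "T \<longlonglongrightarrow> 0"
  shows "(\<lambda>k. (f (x + T k *\<^sub>R h) - f x) /\<^sub>R T k) \<longlonglongrightarrow> f' h"
proof -
  have "(f has_derivative f') (at (x + 0 *\<^sub>R h))" using der by simp
  then have "((\<lambda>s. f (x + s *\<^sub>R h)) has_derivative (\<lambda>r. f' (r *\<^sub>R h))) (at 0)"
    by (rule has_derivative_compose[rotated]) (auto intro!: derivative_eq_intros)
  moreover have "linear f'" using der by (rule has_derivative_linear)
  ultimately have "((\<lambda>s. norm (f (x + s *\<^sub>R h) - f x - s *\<^sub>R f' h) / norm s) \<longlongrightarrow> 0) (at 0)"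
    by (simp add: has_derivative_at linear_scale)
  then have "(\<lambda>k. norm (f (x + T k *\<^sub>R h) - f x - T k *\<^sub>R f' h) / norm (T k)) \<longlonglongrightarrow> 0"
    by (rule filterlim_compose) (use T0 T in \<open>auto simp: filterlim_at less_imp_neq[symmetric]\<close>)
  moreover have "norm (f (x + T k *\<^sub>R h) - f x - T k *\<^sub>R f' h) / norm (T k)
      = norm ((f (x + T k *\<^sub>R h) - f x) /\<^sub>R T k - f' h)" for k
  proof -
    have "(f (x + T k *\<^sub>R h) - f x) /\<^sub>R T k - f' h = (f (x + T k *\<^sub>R h) - f x - T k *\<^sub>R f' h) /\<^sub>R T k"
      using T[of k] by (simp add: scaleR_diff_right)
    then show ?thesis using T[of k] by (simp add: divide_inverse_commute)
  qed
  ultimately show ?thesis by (simp add: tendsto_norm_zero_iff LIM_zero_iff)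
qed

text \<open>The real and imaginary parts of the derivative are inner products with real vectors
  \<open>a\<close> and \<open>b\<close>, to which the second moment formula applies
  separately.\<close>

lemma norm_gradient_sq:
  fixes f :: "real^'n \<Rightarrow> complex"
  assumes "f differentiable (at x)"
  shows "(\<integral>\<^sup>+h. indicator (ball 0 t) h * ennreal ((norm (frechet_derivative f (at x) h))\<^sup>2) \<partial>lborel)
    = ennreal ((norm (gradient f x))\<^sup>2) * ball_moment TYPE('n) t"
proof -
  have [measurable]: "ball (0::real^'n) t \<in> sets borel" by simp
  let ?D = "frechet_derivative f (at x)"
  have lin: "linear ?D" using assms by (rule linear_frechet_derivative)
  define a b :: "real^'n" where "a = (\<chi> i. Re (?D (axis i 1)))" and "b = (\<chi> i. Im (?D (axis i 1)))"
  note D = linear_axis_expansion[OF lin]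
  have sq: "(norm (?D h))\<^sup>2 = (a \<bullet> h)\<^sup>2 + (b \<bullet> h)\<^sup>2" for h
    unfolding cmod_power2 by (subst (1 2) D) (simp add: a_def b_def inner_vec_def mult.commute)
  have gr: "(norm (gradient f x))\<^sup>2 = (norm a)\<^sup>2 + (norm b)\<^sup>2"
    by (simp add: gradient_def a_def b_def norm_vec_def L2_set_def sum_nonneg cmod_power2 sum.distrib)
  have "(\<integral>\<^sup>+h. indicator (ball 0 t) h * ennreal ((norm (?D h))\<^sup>2) \<partial>lborel) =
     (\<integral>\<^sup>+h. indicator (ball 0 t) h * ennreal ((a \<bullet> h)\<^sup>2) + indicator (ball 0 t) h * ennreal ((b \<bullet> h)\<^sup>2) \<partial>lborel)"
    by (simp add: sq distrib_left)
  also have "\<dots> = ennreal ((norm a)\<^sup>2) * ball_moment TYPE('n) t + ennreal ((norm b)\<^sup>2) * ball_moment TYPE('n) t"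
    by (subst nn_integral_add) (auto simp: ball_moment_inner)
  finally show ?thesis by (simp add: gr distrib_right)
qed

lemma borel_measurable_gradient:
  assumes "\<And>h. continuous_on UNIV (\<lambda>x. frechet_derivative f (at x) h)"
  shows "gradient f \<in> borel_measurable borel"
  unfolding gradient_def[abs_def]
  by (intro borel_measurable_continuous_onI continuous_on_vec_lambda assms)

text \<open>The bound by the directional derivative holds for each displacement. Integrating over
  displacements first, rotation invariance turns directional derivatives into the norm of the
  gradient.\<close>

lemma energy_le_gradient:
  fixes f :: "real^'n \<Rightarrow> complex"
  assumes diff: "\<And>x. f differentiable (at x)"
    and cont: "\<And>h. continuous_on UNIV (\<lambda>x. frechet_derivative f (at x) h)"
  shows "energy t f \<le> (\<integral>\<^sup>+x. ennreal ((norm (gradient f x))\<^sup>2) \<partial>lborel) * ball_moment TYPE('n) t"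
proof -
  let ?D = "\<lambda>x. frechet_derivative f (at x)"
  have der: "(f has_derivative ?D x) (at x)" for x
    using diff by (simp add: frechet_derivative_works)
  have fm[measurable]: "f \<in> borel_measurable borel"
    by (intro borel_measurable_continuous_onI continuous_at_imp_continuous_on)
       (auto intro: has_derivative_continuous der)
  have [measurable]: "ball (0::real^'n) t \<in> sets borel" by simp
  have [measurable]: "(\<lambda>x. ?D x h) \<in> borel_measurable borel" for h
    by (rule borel_measurable_continuous_onI[OF cont])
  note Deq = linear_axis_expansion[OF linear_frechet_derivative[OF diff]]
  have Dm[measurable]: "(\<lambda>z. ?D (fst z) (snd z)) \<in> borel_measurable (borel \<Otimes>\<^sub>M borel)"
  proof -
    have [measurable]: "(\<lambda>h::real^'n. h $ i) \<in> borel_measurable borel" for i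
      by (intro borel_measurable_continuous_onI continuous_intros)
    have "(\<lambda>z. (snd z $ i) *\<^sub>R ?D (fst z) (axis i 1)) \<in> borel_measurable (borel \<Otimes>\<^sub>M borel)" for i
      by (intro borel_measurable_scaleR measurable_compose[OF measurable_snd] measurable_compose[OF measurable_fst]) measurable
    then have "(\<lambda>z. \<Sum>i\<in>UNIV. (snd z $ i) *\<^sub>R ?D (fst z) (axis i 1)) \<in> borel_measurable (borel \<Otimes>\<^sub>M borel)"
      by (rule borel_measurable_sum)
    moreover have "(\<lambda>z. ?D (fst z) (snd z)) = (\<lambda>z. \<Sum>i\<in>UNIV. (snd z $ i) *\<^sub>R ?D (fst z) (axis i 1))"
      by (rule ext) (rule Deq)
    ultimately show ?thesis by simp
  qed
  have "energy t f \<le> (\<integral>\<^sup>+h. indicator (ball 0 t) h * (\<integral>\<^sup>+x. ennreal ((norm (?D x h))\<^sup>2) \<partial>lborel) \<partial>lborel)"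
    unfolding energy_Fubini[OF fm]
    by (intro nn_integral_mono mult_left_mono nn_integral_difference_le[OF der cont]) simp
  also have "\<dots> = (\<integral>\<^sup>+h. \<integral>\<^sup>+x. indicator (ball 0 t) h * ennreal ((norm (?D x h))\<^sup>2) \<partial>lborel \<partial>lborel)"
    by (simp add: nn_integral_cmult)
  also have "\<dots> = (\<integral>\<^sup>+x. \<integral>\<^sup>+h. indicator (ball 0 t) h * ennreal ((norm (?D x h))\<^sup>2) \<partial>lborel \<partial>lborel)"
    by (rule lborel_pair.Fubini') measurable
  also have "\<dots> = (\<integral>\<^sup>+x. ennreal ((norm (gradient f x))\<^sup>2) * ball_moment TYPE('n) t \<partial>lborel)"
    by (simp add: norm_gradient_sq diff)
  also have "\<dots> = (\<integral>\<^sup>+x. ennreal ((norm (gradient f x))\<^sup>2) \<partial>lborel) * ball_moment TYPE('n) t"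
    using borel_measurable_gradient[OF cont] by (simp add: nn_integral_multc)
  finally show ?thesis .
qed

text \<open>Rescaling the displacements to the unit ball turns energies at scale \<open>T k\<close>
  into integrals of squared difference quotients, which converge pointwise to directional
  derivatives. Fatou gives the bound with the factor \<open>ball_moment TYPE('n) 1\<close>, which is
  positive and finite and so cancels.\<close>

lemma gradient_le_energy:
  fixes f :: "real^'n \<Rightarrow> complex"
  assumes diff: "\<And>x. f differentiable (at x)"
    and cont: "\<And>h. continuous_on UNIV (\<lambda>x. frechet_derivative f (at x) h)"
    and en: "\<And>t. 0 < t \<Longrightarrow> energy t f \<le> A * ball_moment TYPE('n) t"
  shows "(\<integral>\<^sup>+x. ennreal ((norm (gradient f x))\<^sup>2) \<partial>lborel) \<le> A"
proof -
  let ?D = "\<lambda>x. frechet_derivative f (at x)"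
  have der: "(f has_derivative ?D x) (at x)" for x
    using diff by (simp add: frechet_derivative_works)
  have fm[measurable]: "f \<in> borel_measurable borel"
    by (intro borel_measurable_continuous_onI continuous_at_imp_continuous_on)
       (auto intro: has_derivative_continuous der)
  have [measurable]: "ball (0::real^'n) t \<in> sets borel" for t by simp
  define T where "T k = inverse (real (Suc k))" for k
  have T: "0 < T k" for k by (simp add: T_def)
  have T0: "T \<longlonglongrightarrow> 0" unfolding T_def[abs_def] by (rule LIMSEQ_inverse_real_of_nat)
  define G where "G k x h = ennreal (indicat_real (ball 0 1) h * (norm (f (x + T k *\<^sub>R h) - f x) / T k)\<^sup>2)" for k x h
  have [measurable]: "(\<lambda>z. f (fst z + T k *\<^sub>R snd z)) \<in> borel_measurable (borel \<Otimes>\<^sub>M borel)"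
    "(\<lambda>z. f (fst z)) \<in> borel_measurable (borel \<Otimes>\<^sub>M (borel :: (real^'n) measure))" for k by measurable
  have Gm[measurable]: "case_prod (G k) \<in> borel_measurable (borel \<Otimes>\<^sub>M borel)" for k
    unfolding G_def by measurable
  have [measurable]: "G k x \<in> borel_measurable borel" for k x
    using measurable_Pair2[OF Gm, of x k] by simp
  have lim: "(\<lambda>k. G k x h) \<longlonglongrightarrow> indicator (ball 0 1) h * ennreal ((norm (?D x h))\<^sup>2)" for x h
  proof -
    have "(\<lambda>k. (f (x + T k *\<^sub>R h) - f x) /\<^sub>R T k) \<longlonglongrightarrow> ?D x h"
      by (rule difference_quotient_tendsto[OF der T T0])
    then have "(\<lambda>k. norm ((f (x + T k *\<^sub>R h) - f x) /\<^sub>R T k)) \<longlonglongrightarrow> norm (?D x h)"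
      by (rule tendsto_norm)
    then have "(\<lambda>k. norm (f (x + T k *\<^sub>R h) - f x) / T k) \<longlonglongrightarrow> norm (?D x h)"
      using less_imp_le[OF T] by (simp add: divide_inverse_commute)
    then have "(\<lambda>k. G k x h) \<longlonglongrightarrow> ennreal (indicat_real (ball 0 1) h * (norm (?D x h))\<^sup>2)"
      unfolding G_def by (intro tendsto_ennrealI tendsto_intros)
    then show ?thesis by (auto simp: indicator_def)
  qed
  have en': "(\<integral>\<^sup>+x. \<integral>\<^sup>+h. G k x h \<partial>lborel \<partial>lborel) \<le> A * ball_moment TYPE('n) 1" for k
  proof -
    \<comment> \<open>The power collects \<open>T k\<close> to the dimension from the substitution
      and \<open>(T k)\<^sup>2\<close> from the difference quotient. It is the factor by which the
      second moment of the ball scales, so the bound becomes independent of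
      \<open>k\<close>.\<close>
    let ?c = "ennreal (T k powr (real CARD('n) + 2))"
    have inner: "?c * (\<integral>\<^sup>+h. G k x h \<partial>lborel) =
      (\<integral>\<^sup>+h. ennreal (indicat_real (ball 0 (T k)) h * (norm (f (x + h) - f x))\<^sup>2) \<partial>lborel)" for x
    proof -
      have "(\<integral>\<^sup>+h. ennreal (indicat_real (ball 0 (T k)) (T k *\<^sub>R h) * (norm (f (x + T k *\<^sub>R h) - f x))\<^sup>2) \<partial>lborel)
        = ennreal (T k powr - real DIM(real^'n)) * (\<integral>\<^sup>+h. ennreal (indicat_real (ball 0 (T k)) h * (norm (f (x + h) - f x))\<^sup>2) \<partial>lborel)"
        by (rule nn_integral_lborel_scale[OF _ T]) measurable
      moreover have "(\<integral>\<^sup>+h. ennreal (indicat_real (ball 0 (T k)) (T k *\<^sub>R h) * (norm (f (x + T k *\<^sub>R h) - f x))\<^sup>2) \<partial>lborel)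
        = (\<integral>\<^sup>+h. ennreal ((T k)\<^sup>2) * G k x h \<partial>lborel)"
        using T[of k] by (intro nn_integral_cong)
          (auto simp: G_def indicator_def power_divide simp flip: ennreal_mult)
      moreover have "\<dots> = ennreal ((T k)\<^sup>2) * (\<integral>\<^sup>+h. G k x h \<partial>lborel)"
        by (rule nn_integral_cmult) measurable
      ultimately have "ennreal (T k powr real CARD('n)) * (ennreal ((T k)\<^sup>2) * (\<integral>\<^sup>+h. G k x h \<partial>lborel))
         = ennreal (T k powr real CARD('n)) * (ennreal (T k powr - real CARD('n)) *
            (\<integral>\<^sup>+h. ennreal (indicat_real (ball 0 (T k)) h * (norm (f (x + h) - f x))\<^sup>2) \<partial>lborel))"
        by simp
      also have "\<dots> = ennreal (T k powr real CARD('n) * T k powr - real CARD('n)) *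
            (\<integral>\<^sup>+h. ennreal (indicat_real (ball 0 (T k)) h * (norm (f (x + h) - f x))\<^sup>2) \<partial>lborel)"
        by (simp add: ennreal_mult mult.assoc)
      also have "T k powr real CARD('n) * T k powr - real CARD('n) = 1" using T[of k] by (simp flip: powr_add)
      finally show ?thesis using T[of k] by (simp add: powr_add powr_numeral ennreal_mult mult.assoc)
    qed
    have "?c * (\<integral>\<^sup>+x. \<integral>\<^sup>+h. G k x h \<partial>lborel \<partial>lborel) = energy (T k) f"
      by (subst nn_integral_cmult[symmetric]) (simp_all add: inner energy_translation_form)
    also have "\<dots> \<le> ?c * (A * ball_moment TYPE('n) 1)"
      using en[OF T, of k] unfolding ball_moment_scale[OF T] by (simp add: ac_simps)
    finally show ?thesis
      using T[of k] by (subst (asm) ennreal_mult_le_mult_iff) auto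
  qed
  have "(\<integral>\<^sup>+x. ennreal ((norm (gradient f x))\<^sup>2) \<partial>lborel) * ball_moment TYPE('n) 1
      = (\<integral>\<^sup>+x. ennreal ((norm (gradient f x))\<^sup>2) * ball_moment TYPE('n) 1 \<partial>lborel)"
    using borel_measurable_gradient[OF cont] by (simp add: nn_integral_multc)
  also have "\<dots> = (\<integral>\<^sup>+x. \<integral>\<^sup>+h. liminf (\<lambda>k. G k x h) \<partial>lborel \<partial>lborel)"
    by (simp add: lim_imp_Liminf[OF _ lim] norm_gradient_sq[OF diff])
  also have "\<dots> \<le> (\<integral>\<^sup>+x. liminf (\<lambda>k. \<integral>\<^sup>+h. G k x h \<partial>lborel) \<partial>lborel)"
    by (intro nn_integral_mono nn_integral_liminf) measurable
  also have "\<dots> \<le> liminf (\<lambda>k. \<integral>\<^sup>+x. \<integral>\<^sup>+h. G k x h \<partial>lborel \<partial>lborel)"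
    by (rule nn_integral_liminf) measurable
  also have "\<dots> \<le> A * ball_moment TYPE('n) 1"
    by (rule Liminf_le) (simp_all add: en')
  finally show ?thesis
    using ball_moment_pos[where 'n='n] ball_moment_finite[of 1, where 'n='n]
    by (subst (asm) (1 2) mult.commute, subst (asm) ennreal_mult_le_mult_iff) auto
qed

subsection \<open>Radial functions and test functions\<close>

lemma dyadic_shell:
  fixes r R :: real
  assumes "0 < r" "r < R"
  obtains k where "R / 2 ^ Suc k \<le> r" "r < R / 2 ^ k"
proof -
  have "\<exists>k. R / 2 ^ Suc k \<le> r"
  proof -
    obtain k where "R / r < 2 ^ k" using real_arch_pow[of 2 "R / r"] by auto
    then have "R < r * 2 ^ k" using assms by (simp add: field_simps)
    also have "\<dots> \<le> r * 2 ^ Suc k" using assms by simp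
    finally have "R / 2 ^ Suc k \<le> r" by (simp add: field_simps)
    then show ?thesis ..
  qed
  then have ex: "\<exists>k. R / 2 ^ Suc k \<le> r" .
  define k where "k = (LEAST k. R / 2 ^ Suc k \<le> r)"
  have "R / 2 ^ Suc k \<le> r" unfolding k_def by (rule LeastI_ex[OF ex])
  moreover have "r < R / 2 ^ k"
  proof (cases k)
    case (Suc j)
    then have "\<not> R / 2 ^ Suc j \<le> r" using not_less_Least[of j "\<lambda>k. R / 2 ^ Suc k \<le> r"] by (simp add: k_def)
    then show ?thesis using Suc by simp
  qed (use assms in simp)
  ultimately show ?thesis by (rule that)
qed

text \<open>On the ball of radius \<open>\<rho>\<close> about 0 the function is at least
  \<open>v (\<rho> *\<^sub>R b)\<close>, on the ball of radius \<open>\<rho>\<close> about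
  \<open>(3 * \<rho>) *\<^sub>R b\<close> at most \<open>v ((2 * \<rho>) *\<^sub>R b)\<close>.
  Points of the two balls are less than \<open>5 * \<rho>\<close> apart, so the energy at that scale
  dominates the squared drop times the product of the two volumes.\<close>

lemma radial_energy_step:
  fixes v :: "real^'n \<Rightarrow> real" and b :: "real^'n"
  assumes rad: "\<And>x y. norm x < norm y \<Longrightarrow> v y \<le> v x"
    and vm[measurable]: "v \<in> borel_measurable borel"
    and en: "\<And>t. 0 < t \<Longrightarrow> energy t v \<le> ennreal (G\<^sup>2) * ball_moment TYPE('n) t"
    and b: "norm b = 1" and \<rho>: "0 < \<rho>" and G: "0 \<le> G"
  shows "v (\<rho> *\<^sub>R b) \<le> v ((2 * \<rho>) *\<^sub>R b) +
    G * (sqrt (enn2real (ball_moment TYPE('n) 1) * 5 powr (real CARD('n) + 2)) / unit_ball_vol (real CARD('n)))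
      * \<rho> powr (1 - real CARD('n) / 2)"
proof -
  define N where "N = real CARD('n)"
  define \<omega> where "\<omega> = unit_ball_vol N"
  define m where "m = enn2real (ball_moment TYPE('n) 1)"
  define \<delta> where "\<delta> = v (\<rho> *\<^sub>R b) - v ((2 * \<rho>) *\<^sub>R b)"
  have \<omega>: "0 < \<omega>" by (simp add: \<omega>_def N_def)
  have m: "0 \<le> m" by (simp add: m_def)
  have bm: "ball_moment TYPE('n) 1 = ennreal m"
    using ball_moment_finite[where t=1 and 'n='n] by (simp add: m_def)
  have \<delta>0: "0 \<le> \<delta>" unfolding \<delta>_def using rad[of "\<rho> *\<^sub>R b" "(2 * \<rho>) *\<^sub>R b"] b \<rho> by simp
  have vol: "emeasure lborel (ball c \<rho>) = ennreal (\<omega> * \<rho> powr N)" for c :: "real^'n"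
    using \<rho> by (simp add: emeasure_ball \<omega>_def N_def powr_realpow)
  have "ennreal (\<delta>\<^sup>2) * (ennreal (\<omega> * \<rho> powr N) * ennreal (\<omega> * \<rho> powr N))
      = (\<integral>\<^sup>+x. \<integral>\<^sup>+y. ennreal (\<delta>\<^sup>2) * indicator (ball 0 \<rho>) x * indicator (ball ((3 * \<rho>) *\<^sub>R b) \<rho>) y \<partial>lborel \<partial>(lborel :: (real^'n) measure))"
  proof -
    have inner: "(\<integral>\<^sup>+y. ennreal (\<delta>\<^sup>2) * indicator (ball 0 \<rho>) x * indicator (ball ((3 * \<rho>) *\<^sub>R b) \<rho>) y \<partial>lborel)
        = ennreal (\<delta>\<^sup>2) * ennreal (\<omega> * \<rho> powr N) * indicator (ball 0 \<rho>) x" for x :: "real^'n"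
      by (subst nn_integral_cmult_indicator) (simp_all add: vol mult_ac)
    have "(\<integral>\<^sup>+x. ennreal (\<delta>\<^sup>2) * ennreal (\<omega> * \<rho> powr N) * indicator (ball 0 \<rho>) x \<partial>(lborel :: (real^'n) measure))
        = ennreal (\<delta>\<^sup>2) * ennreal (\<omega> * \<rho> powr N) * emeasure lborel (ball (0 :: real^'n) \<rho>)"
      by (rule nn_integral_cmult_indicator) simp
    then show ?thesis unfolding inner by (simp add: vol mult.assoc)
  qed
  also have "\<dots> \<le> energy (5 * \<rho>) v"
    unfolding energy_def
  proof (intro nn_integral_mono)
    fix x y :: "real^'n"
    show "ennreal (\<delta>\<^sup>2) * indicator (ball 0 \<rho>) x * indicator (ball ((3 * \<rho>) *\<^sub>R b) \<rho>) y
        \<le> ennreal (indicat_real (ball 0 (5 * \<rho>)) (x - y) * (norm (v x - v y))\<^sup>2)"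
    proof (cases "x \<in> ball 0 \<rho> \<and> y \<in> ball ((3 * \<rho>) *\<^sub>R b) \<rho>")
      case True
      then have x: "norm x < \<rho>" and y: "norm ((3 * \<rho>) *\<^sub>R b - y) < \<rho>" by (auto simp: dist_norm)
      have n3: "norm ((3 * \<rho>) *\<^sub>R b) = 3 * \<rho>" using b \<rho> by simp
      have y1: "2 * \<rho> < norm y" using norm_triangle_ineq2[of "(3 * \<rho>) *\<^sub>R b" y] y n3 by linarith
      have y2: "norm y < 4 * \<rho>"
        using norm_triangle_ineq2[of y "(3 * \<rho>) *\<^sub>R b"] y n3 by (simp add: norm_minus_commute)
      have "norm (x - y) < 5 * \<rho>" using norm_triangle_ineq4[of x y] x y2 by linarith
      moreover have "v (\<rho> *\<^sub>R b) \<le> v x" using x b \<rho> by (intro rad) simp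
      moreover have "v y \<le> v ((2 * \<rho>) *\<^sub>R b)" using y1 b \<rho> by (intro rad) simp
      then have "\<delta> \<le> v x - v y" using calculation(2) by (simp add: \<delta>_def)
      then have "\<delta>\<^sup>2 \<le> (norm (v x - v y))\<^sup>2" using \<delta>0 by (auto intro: power_mono)
      ultimately show ?thesis using True by (simp add: ennreal_leI)
    qed (auto simp: indicator_def)
  qed
  also have "\<dots> \<le> ennreal (G\<^sup>2) * ball_moment TYPE('n) (5 * \<rho>)" using \<rho> by (intro en) simp
  also have "\<dots> = ennreal (G\<^sup>2 * ((5 * \<rho>) powr (N + 2) * m))"
    using \<rho> m by (subst ball_moment_scale) (simp_all add: bm N_def ennreal_mult)
  finally have "ennreal (\<delta>\<^sup>2 * ((\<omega> * \<rho> powr N) * (\<omega> * \<rho> powr N))) \<le> ennreal (G\<^sup>2 * ((5 * \<rho>) powr (N + 2) * m))"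
    using \<omega> by (simp add: ennreal_mult)
  then have main: "\<delta>\<^sup>2 * ((\<omega> * \<rho> powr N) * (\<omega> * \<rho> powr N)) \<le> G\<^sup>2 * ((5 * \<rho>) powr (N + 2) * m)"
    using m by (subst (asm) ennreal_le_iff) simp_all
  \<comment> \<open>\<open>X\<close> is the bound obtained by solving \<open>main\<close> for
    \<open>\<delta>\<close>; the powers of \<open>\<rho>\<close> combine to
    \<open>(N + 2) / 2 - N = 1 - N / 2\<close>.\<close>
  define X where "X = G * (sqrt (m * 5 powr (N + 2)) / \<omega>) * \<rho> powr (1 - N / 2)"
  have X0: "0 \<le> X" using G m \<omega> by (simp add: X_def)
  have "X\<^sup>2 * ((\<omega> * \<rho> powr N) * (\<omega> * \<rho> powr N))
      = G\<^sup>2 * (m * 5 powr (N + 2)) * ((\<rho> powr (1 - N / 2) * \<rho> powr (1 - N / 2)) * (\<rho> powr N * \<rho> powr N))"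
    using \<omega> m by (simp add: X_def power_mult_distrib power_divide power2_eq_square[of "\<rho> powr _"] power2_eq_square[of \<omega>] field_simps)
  also have "(\<rho> powr (1 - N / 2) * \<rho> powr (1 - N / 2)) * (\<rho> powr N * \<rho> powr N) = \<rho> powr (N + 2)"
    by (simp flip: powr_add)
  also have "G\<^sup>2 * (m * 5 powr (N + 2)) * \<rho> powr (N + 2) = G\<^sup>2 * ((5 * \<rho>) powr (N + 2) * m)"
    using \<rho> by (simp add: powr_mult)
  finally have "\<delta>\<^sup>2 * ((\<omega> * \<rho> powr N) * (\<omega> * \<rho> powr N)) \<le> X\<^sup>2 * ((\<omega> * \<rho> powr N) * (\<omega> * \<rho> powr N))"
    using main by simp
  then have "\<delta>\<^sup>2 \<le> X\<^sup>2" using \<omega> \<rho> by (simp add: mult_le_cancel_right)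
  then have "\<delta> \<le> X" using X0 by (rule power2_le_imp_le)
  then show ?thesis unfolding X_def \<delta>_def N_def m_def \<omega>_def by simp
qed

text \<open>The energy bound at scale \<open>5\<rho>\<close> controls the drop of a radially decreasing function
  from radius \<open>\<rho>\<close> to \<open>2\<rho>\<close>; summing over dyadic radii gives the subcritical Sobolev bound.\<close>

lemma radial_sobolev:
  assumes e: "0 < e" "e * (real CARD('n::finite) / 2 - 1) < real CARD('n)" and R: "0 < R"
  obtains C where "0 \<le> C" "\<And>v G. \<lbrakk>\<And>x y :: real^'n. norm x < norm y \<Longrightarrow> v y \<le> v x; v \<in> borel_measurable borel;
      \<And>x. 0 \<le> v x; \<And>x. R < norm x \<Longrightarrow> v x = 0; 0 \<le> G;
      \<And>t. 0 < t \<Longrightarrow> energy t v \<le> ennreal (G\<^sup>2) * ball_moment TYPE('n) t\<rbrakk>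
    \<Longrightarrow> (\<integral>\<^sup>+x. ennreal (v x powr e) \<partial>lborel) \<le> ennreal (C * G powr e)"
proof -
  define N where "N = real CARD('n)"
  have N: "0 < N" by (simp add: N_def)
  define \<omega> where "\<omega> = unit_ball_vol N"
  define K0 where "K0 = sqrt (enn2real (ball_moment TYPE('n) 1) * 5 powr (N + 2)) / \<omega>"
  have \<omega>: "0 < \<omega>" by (simp add: \<omega>_def N_def)
  have K0: "0 \<le> K0" using \<omega> by (simp add: K0_def)
  \<comment> \<open>\<open>\<beta> > N / 2 - 1\<close> bounds the drops at successive dyadic radii
    by a geometric progression of ratio \<open>B\<close>; \<open>\<beta> < N / e\<close> makes
    \<open>B powr e\<close> smaller than the volume ratio \<open>2 powr N\<close>, so that the power
    integral sums; \<open>\<beta> > 0\<close> gives \<open>B > 1\<close>. The hypothesis on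
    \<open>e\<close> leaves room for such a \<open>\<beta>\<close>.\<close>
  have "max 0 (N / 2 - 1) < N / e" using e N by (simp add: N_def pos_less_divide_eq mult.commute)
  then obtain \<beta> where \<beta>: "max 0 (N / 2 - 1) < \<beta>" "\<beta> < N / e" using dense by blast
  define B where "B = 2 powr \<beta>"
  have B1: "1 < B" unfolding B_def using \<beta> by (intro gr_one_powr) auto
  have BN: "2 powr (N / 2 - 1) \<le> B" unfolding B_def using \<beta> by (intro powr_mono) auto
  define x where "x = B powr e / 2 powr N"
  have x: "0 \<le> x" "x < 1"
  proof -
    have "B powr e = 2 powr (\<beta> * e)" by (simp add: B_def powr_powr)
    also have "\<dots> < 2 powr N" using \<beta>(2) e(1) by (simp add: pos_less_divide_eq)
    finally show "x < 1" by (simp add: x_def)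
  qed (simp add: x_def)
  \<comment> \<open>Doubling makes \<open>v\<close> vanish at the starting radius
    \<open>\<rho> 0\<close> of the dyadic induction and puts its support inside the open ball of
    radius \<open>R1\<close>.\<close>
  define R1 where "R1 = 2 * R"
  have R1: "0 < R1" using R by (simp add: R1_def)
  \<comment> \<open>\<open>K2\<close> solves
    \<open>K2 * B = K2 + K0 * R1 powr (1 - N / 2) * B\<close>, so that the bound
    \<open>G * K2 * B ^ k\<close> reproduces itself in the induction step.\<close>
  define K2 where "K2 = K0 * R1 powr (1 - N / 2) * B / (B - 1)"
  have K2: "0 \<le> K2" using K0 B1 by (simp add: K2_def)
  define C where "C = K2 powr e * B powr (2 * e) * (\<omega> * R1 powr N) * (1 / (1 - x))"
  have C: "0 \<le> C" using x \<omega> by (simp add: C_def)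
  show ?thesis
  proof (rule that[OF C])
    fix v :: "real^'n \<Rightarrow> real" and G
    assume rad: "\<And>x y. norm x < norm y \<Longrightarrow> v y \<le> v x" and vm[measurable]: "v \<in> borel_measurable borel"
      and v0: "\<And>x. 0 \<le> v x" and van: "\<And>x. R < norm x \<Longrightarrow> v x = 0" and G: "0 \<le> G"
      and en: "\<And>t. 0 < t \<Longrightarrow> energy t v \<le> ennreal (G\<^sup>2) * ball_moment TYPE('n) t"
    obtain b :: "real^'n" where b: "norm b = 1" using vector_choose_size[of 1] by auto
    define \<rho> where "\<rho> k = R1 / 2 ^ k" for k :: nat
    have \<rho>: "0 < \<rho> k" for k using R1 by (simp add: \<rho>_def)
    have pow: "\<rho> k powr a = R1 powr a * (2 powr (- a)) ^ k" for k a
    proof -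
      have "(2 ^ k :: real) powr a = (2 powr real k) powr a" by (simp add: powr_realpow)
      also have "\<dots> = 2 powr (a * real k)" by (simp add: powr_powr mult.commute)
      finally have 1: "(2 ^ k :: real) powr a = 2 powr (a * real k)" .
      have "(2 powr - a) ^ k = (2 powr - a) powr real k" by (simp add: powr_realpow)
      also have "\<dots> = 1 / 2 powr (a * real k)" by (simp add: powr_powr) (simp add: powr_minus divide_inverse)
      finally show ?thesis using R1 1 by (simp add: \<rho>_def powr_divide)
    qed
    have fk: "v (\<rho> k *\<^sub>R b) \<le> G * K2 * B ^ k" for k
    proof (induction k)
      case 0
      have "v (\<rho> 0 *\<^sub>R b) = 0" using R b by (intro van) (simp add: \<rho>_def R1_def)
      then show ?case using G K2 by simp
    next
      case (Suc k)
      have "v (\<rho> (Suc k) *\<^sub>R b) \<le> v ((2 * \<rho> (Suc k)) *\<^sub>R b) + G * K0 * \<rho> (Suc k) powr (1 - N / 2)"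
        unfolding K0_def \<omega>_def N_def by (rule radial_energy_step[OF rad vm en b \<rho> G])
      also have "2 * \<rho> (Suc k) = \<rho> k" by (simp add: \<rho>_def)
      also have "v (\<rho> k *\<^sub>R b) \<le> G * K2 * B ^ k" by (rule Suc.IH)
      also have "\<rho> (Suc k) powr (1 - N / 2) \<le> R1 powr (1 - N / 2) * B ^ Suc k"
        unfolding pow using BN by (intro mult_left_mono power_mono) auto
      finally have "v (\<rho> (Suc k) *\<^sub>R b) \<le> G * K2 * B ^ k + G * K0 * (R1 powr (1 - N / 2) * B ^ Suc k)"
        using G K0 by (simp add: mult_left_mono)
      also have "\<dots> = G * K2 * B ^ Suc k"
      proof -
        have "K2 * (B - 1) = K0 * R1 powr (1 - N / 2) * B" using B1 by (simp add: K2_def)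
        then have "K2 * B = K2 + K0 * R1 powr (1 - N / 2) * B" by (simp add: algebra_simps)
        then have "G * B ^ k * (K2 * B) = G * B ^ k * (K2 + K0 * R1 powr (1 - N / 2) * B)" by simp
        then show ?thesis by (simp add: algebra_simps)
      qed
      finally show ?case .
    qed
    define c where "c k = (G * K2 * B ^ (k + 2)) powr e" for k :: nat
    have pt: "ennreal (v z powr e) \<le> (\<Sum>k. ennreal (c k) * indicator (ball 0 (\<rho> k)) z)" if "z \<noteq> 0" for z
    proof (cases "R < norm z")
      case False
      then have "norm z < R1" using R by (simp add: R1_def)
      moreover have "0 < norm z" using that by simp
      ultimately obtain k where k: "R1 / 2 ^ Suc k \<le> norm z" "norm z < R1 / 2 ^ k"
        by (metis dyadic_shell)
      \<comment> \<open>Monotonicity is available only between strictly ordered norms, so a point of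
        the shell is compared with the radius one step further in than the inner boundary of the
        shell.\<close>
      have "R1 / 2 ^ (k + 2) < R1 / 2 ^ Suc k" using R1 by (simp add: field_simps)
      then have "v z \<le> v (\<rho> (k + 2) *\<^sub>R b)"
        using k b \<rho>[of "k + 2"] by (intro rad) (simp add: \<rho>_def)
      also have "\<dots> \<le> G * K2 * B ^ (k + 2)" by (rule fk)
      finally have "v z powr e \<le> c k" unfolding c_def using v0 e by (intro powr_mono2) auto
      then have "ennreal (v z powr e) \<le> ennreal (c k) * indicator (ball 0 (\<rho> k)) z"
        using k by (simp add: \<rho>_def ennreal_leI)
      also have "\<dots> \<le> (\<Sum>k. ennreal (c k) * indicator (ball 0 (\<rho> k)) z)"
      proof -
        have "f k \<le> suminf f" for f :: "nat \<Rightarrow> ennreal" using sum_le_suminf[of f "{k}"] by simp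
        then show ?thesis .
      qed
      finally show ?thesis .
    qed (simp add: van)
    have "(\<integral>\<^sup>+z. ennreal (v z powr e) \<partial>lborel) \<le> (\<integral>\<^sup>+z. (\<Sum>k. ennreal (c k) * indicator (ball 0 (\<rho> k)) z) \<partial>(lborel :: (real^'n) measure))"
    proof (rule nn_integral_mono_AE)
      \<comment> \<open>The origin lies in no dyadic shell; it is a null set.\<close>
      have "AE z in lborel. z \<noteq> (0::real^'n)" by (rule AE_lborel_singleton)
      then show "AE z in lborel. ennreal (v z powr e) \<le> (\<Sum>k. ennreal (c k) * indicator (ball 0 (\<rho> k)) z)"
        by eventually_elim (rule pt)
    qed
    also have "\<dots> = (\<Sum>k. \<integral>\<^sup>+z. ennreal (c k) * indicator (ball 0 (\<rho> k)) z \<partial>(lborel :: (real^'n) measure))"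
      by (rule nn_integral_suminf) (intro borel_measurable_times_ennreal borel_measurable_const borel_measurable_indicator, simp)
    also have "\<dots> = (\<Sum>k. ennreal (G powr e * (K2 powr e * B powr (2 * e) * (\<omega> * R1 powr N)) * x ^ k))"
    proof (rule suminf_cong)
      fix k
      have "(\<integral>\<^sup>+z. ennreal (c k) * indicator (ball 0 (\<rho> k)) z \<partial>(lborel :: (real^'n) measure)) = ennreal (c k) * ennreal (\<omega> * \<rho> k powr N)"
        using \<rho>[of k] by (subst nn_integral_cmult_indicator) (simp_all add: emeasure_ball \<omega>_def N_def powr_realpow)
      also have "\<dots> = ennreal (c k * (\<omega> * \<rho> k powr N))" using \<omega> by (subst ennreal_mult) (simp_all add: c_def)
      also have "c k * (\<omega> * \<rho> k powr N) = G powr e * (K2 powr e * B powr (2 * e) * (\<omega> * R1 powr N)) * x ^ k"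
      proof -
        have "B ^ (k + 2) = B powr (real k + 2)" using B1 by (simp add: powr_add powr_realpow powr_numeral power_add power2_eq_square)
        then have "c k = G powr e * K2 powr e * (B powr (2 * e) * (B powr e) ^ k)"
          using B1 by (simp add: c_def powr_mult powr_powr powr_add powr_realpow[symmetric] algebra_simps flip: powr_add)
        moreover have "x ^ k = (B powr e) ^ k * (2 powr - N) ^ k"
          by (simp add: x_def powr_minus divide_inverse power_mult_distrib)
        ultimately show ?thesis unfolding pow by (simp add: algebra_simps)
      qed
      finally show "(\<integral>\<^sup>+z. ennreal (c k) * indicator (ball 0 (\<rho> k)) z \<partial>(lborel :: (real^'n) measure)) =
          ennreal (G powr e * (K2 powr e * B powr (2 * e) * (\<omega> * R1 powr N)) * x ^ k)" .
    qed
    also have "\<dots> = ennreal (G powr e * (K2 powr e * B powr (2 * e) * (\<omega> * R1 powr N)) * (1 / (1 - x)))"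
    proof (rule suminf_ennreal_eq)
      show "0 \<le> G powr e * (K2 powr e * B powr (2 * e) * (\<omega> * R1 powr N)) * x ^ k" for k
        using x \<omega> by simp
      have "norm x < 1" using x by simp
      then show "(\<lambda>k. G powr e * (K2 powr e * B powr (2 * e) * (\<omega> * R1 powr N)) * x ^ k) sums
          (G powr e * (K2 powr e * B powr (2 * e) * (\<omega> * R1 powr N)) * (1 / (1 - x)))"
        by (intro sums_mult geometric_sums)
    qed
    finally show "(\<integral>\<^sup>+z. ennreal (v z powr e) \<partial>lborel) \<le> ennreal (C * G powr e)"
      by (simp add: C_def mult_ac)
  qed
qed

section \<open>Regularity of test functions and their radial replacement\<close>

lemma test_functions_differentiable:
  assumes "\<phi> \<in> test_functions D"
  shows "\<phi> differentiable (at x)" "continuous_on UNIV (\<lambda>x. frechet_derivative \<phi> (at x) h)"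
    "continuous_on UNIV \<phi>"
proof -
  have "Ck (Suc 0) \<phi>" using assms unfolding test_functions_def by blast
  then show "\<phi> differentiable (at x)" "continuous_on UNIV (\<lambda>x. frechet_derivative \<phi> (at x) h)" by simp_all
  have "Ck 0 \<phi>" using assms unfolding test_functions_def by blast
  then show "continuous_on UNIV \<phi>" by simp
qed

lemma frechet_derivative_vanishes:
  fixes \<phi> :: "'a::real_normed_vector \<Rightarrow> 'b::real_normed_vector"
  assumes "x \<notin> closure {x. \<phi> x \<noteq> 0}"
  shows "frechet_derivative \<phi> (at x) = (\<lambda>_. 0)"
proof -
  have "(\<phi> has_derivative (\<lambda>_. 0)) (at x)"
    by (rule has_derivative_transform_within_open[of "\<lambda>_. 0" _ x UNIV "- closure {x. \<phi> x \<noteq> 0}"])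
       (use assms closure_subset[of "{x. \<phi> x \<noteq> 0}"] in \<open>auto simp: open_Compl\<close>)
  then show ?thesis by (metis frechet_derivative_at)
qed

lemma continuous_vanishing_bounded:
  fixes g :: "'a::topological_space \<Rightarrow> 'b::real_normed_vector"
  assumes "continuous_on UNIV g" "compact K" "\<And>x. x \<notin> K \<Longrightarrow> g x = 0"
  obtains B where "0 \<le> B" "\<And>x. norm (g x) \<le> B"
proof -
  have "bounded (g ` K)"
    using assms by (intro compact_imp_bounded compact_continuous_image) (auto intro: continuous_on_subset)
  then obtain B where B: "\<And>x. x \<in> K \<Longrightarrow> norm (g x) \<le> B" by (auto simp: bounded_iff)
  have "norm (g x) \<le> max B 0" for x using B[of x] assms(3)[of x] by (cases "x \<in> K") auto
  then show ?thesis by (intro that[of "max B 0"]) auto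
qed

lemma test_function_lipschitz:
  assumes \<phi>: "\<phi> \<in> test_functions D"
  obtains L where "0 \<le> L" "\<And>x y. norm (\<phi> x - \<phi> y) \<le> L * norm (x - y)"
proof -
  let ?K = "closure {x. \<phi> x \<noteq> 0}"
  have K: "compact ?K" using \<phi> by (simp add: test_functions_def)
  have "\<exists>B. 0 \<le> B \<and> (\<forall>x. norm (frechet_derivative \<phi> (at x) (axis i 1)) \<le> B)" for i
    by (rule continuous_vanishing_bounded[OF test_functions_differentiable(2)[OF \<phi>, of "axis i 1"] K])
       (auto simp: frechet_derivative_vanishes)
  then obtain B where B: "\<And>i. 0 \<le> B i" "\<And>i x. norm (frechet_derivative \<phi> (at x) (axis i 1)) \<le> B i" by metis
  define L where "L = (\<Sum>i\<in>UNIV. B i)"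
  have L: "0 \<le> L" by (simp add: L_def B sum_nonneg)
  have bd: "norm (frechet_derivative \<phi> (at x) h) \<le> L * norm h" for x h
  proof -
    have "frechet_derivative \<phi> (at x) h = (\<Sum>i\<in>UNIV. (h $ i) *\<^sub>R frechet_derivative \<phi> (at x) (axis i 1))"
      by (rule linear_axis_expansion[OF linear_frechet_derivative[OF test_functions_differentiable(1)[OF \<phi>]]])
    also have "norm \<dots> \<le> (\<Sum>i\<in>UNIV. norm h * B i)"
      by (intro sum_norm_le) (auto intro!: mult_mono B component_le_norm_cart)
    finally show ?thesis by (simp add: L_def sum_distrib_left mult.commute)
  qed
  show ?thesis
  proof (rule that[OF L])
    fix x y
    show "norm (\<phi> x - \<phi> y) \<le> L * norm (x - y)"
    proof (rule differentiable_bound[of UNIV \<phi> "\<lambda>x. frechet_derivative \<phi> (at x)"])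
      show "(\<phi> has_derivative frechet_derivative \<phi> (at x)) (at x within UNIV)" for x
        using test_functions_differentiable(1)[OF \<phi>] by (simp add: frechet_derivative_works)
      show "onorm (frechet_derivative \<phi> (at x)) \<le> L" for x
        using bd L by (intro onorm_bound) auto
    qed auto
  qed
qed

text \<open>The competitor problem is posed for the modulus of \<open>\<phi>\<close>, which in
  general is Lipschitz but not smooth. Its energies are bounded by those of \<open>\<phi>\<close>
  through the reverse triangle inequality, so the gradient is taken only of
  \<open>\<phi>\<close>.\<close>

theorem test_function_radial_rearrangement:
  fixes \<phi> :: "real^'n \<Rightarrow> complex"
  assumes \<phi>: "\<phi> \<in> test_functions D" and D: "D \<subseteq> cball 0 R" and R: "0 \<le> R" and e: "0 < e"
  obtains v L where "0 \<le> L" "\<And>x y. \<bar>v x - v y\<bar> \<le> L * norm (x - y)" "\<And>x. 0 \<le> v x"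
    "\<And>x :: real^'n. R < norm x \<Longrightarrow> v x = 0"
    "emeasure lborel {x. 0 < v x} \<le> emeasure lborel {x. \<phi> x \<noteq> 0}"
    "(\<integral>\<^sup>+x. ennreal (norm (\<phi> x) powr e) \<partial>lborel) \<le> (\<integral>\<^sup>+x. ennreal (v x powr e) \<partial>lborel)"
    "\<And>t. energy t v \<le> (\<integral>\<^sup>+x. ennreal ((norm (gradient \<phi> x))\<^sup>2) \<partial>lborel) * ball_moment TYPE('n) t"
    "\<And>x y. norm x < norm y \<Longrightarrow> v y \<le> v x"
proof -
  obtain L where L: "0 \<le> L" "\<And>x y. norm (\<phi> x - \<phi> y) \<le> L * norm (x - y)"
    using test_function_lipschitz[OF \<phi>] by blast
  define v0 where "v0 x = norm (\<phi> x)" for x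
  have lip: "\<bar>v0 x - v0 y\<bar> \<le> L * norm (x - y)" for x y
    using L(2)[of x y] norm_triangle_ineq3[of "\<phi> x" "\<phi> y"] by (simp add: v0_def)
  have nn: "0 \<le> v0 x" for x by (simp add: v0_def)
  have van: "v0 x = 0" if "R < norm x" for x
  proof -
    have "x \<notin> closure {x. \<phi> x \<noteq> 0}" using \<phi> D that by (auto simp: test_functions_def)
    then show ?thesis using closure_subset[of "{x. \<phi> x \<noteq> 0}"] by (auto simp: v0_def)
  qed
  obtain v where c: "competitor e L R v0 v" and rad: "\<And>x y. norm x < norm y \<Longrightarrow> v y \<le> v x"
    using exists_radial_competitor[OF lip L(1) R e nn van] by blast
  have en: "energy t v \<le> (\<integral>\<^sup>+x. ennreal ((norm (gradient \<phi> x))\<^sup>2) \<partial>lborel) * ball_moment TYPE('n) t" for t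
  proof -
    have "energy t v \<le> energy t v0" using c by (simp add: competitor_def)
    also have "\<dots> \<le> energy t \<phi>" unfolding energy_def v0_def
      by (intro nn_integral_mono ennreal_leI mult_left_mono power_mono) (auto simp: norm_triangle_ineq3)
    also have "\<dots> \<le> (\<integral>\<^sup>+x. ennreal ((norm (gradient \<phi> x))\<^sup>2) \<partial>lborel) * ball_moment TYPE('n) t"
      by (rule energy_le_gradient[OF test_functions_differentiable(1,2)[OF \<phi>]])
    finally show ?thesis .
  qed
  have "{x. 0 < v0 x} = {x. \<phi> x \<noteq> 0}" by (simp add: v0_def)
  then show ?thesis
    using c rad en L(1) by (intro that[of L v]) (auto simp: competitor_def v0_def)
qed

subsection \<open>Mollification\<close>

lemma Ck_SucI:
  assumes "\<And>x. (f has_derivative f' x) (at x)" "\<And>h. Ck k (\<lambda>x. f' x h)"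
  shows "Ck (Suc k) f"
proof -
  have "frechet_derivative f (at x) = f' x" for x
    by (rule frechet_derivative_at[OF assms(1), symmetric])
  moreover have "f differentiable (at x)" for x
    unfolding differentiable_def using assms(1) by blast
  ultimately show ?thesis using assms(2) by simp
qed

lemma Ck_SucD:
  assumes "Ck (Suc k) f"
  shows "(f has_derivative frechet_derivative f (at x)) (at x)" "Ck k (\<lambda>x. frechet_derivative f (at x) h)"
  using assms by (simp_all add: frechet_derivative_works[symmetric])

lemma Ck_Suc_imp: "Ck (Suc k) f \<Longrightarrow> Ck k f"
proof (induction k arbitrary: f)
  case 0
  then have "\<And>x. f differentiable (at x)" by simp
  then have "continuous_on UNIV f"
    by (intro continuous_at_imp_continuous_on ballI differentiable_imp_continuous_within)
  then show ?case by simp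
next
  case (Suc k)
  show ?case by (rule Ck_SucI[OF Ck_SucD(1)[OF Suc.prems] Suc.IH[OF Ck_SucD(2)[OF Suc.prems]]])
qed

lemma Ck_const: "Ck k (\<lambda>x. c)"
proof (induction k arbitrary: c)
  case (Suc k)
  show ?case by (rule Ck_SucI[where f' = "\<lambda>_ _. 0"]) (rule has_derivative_const, rule Suc)
qed simp

lemma Ck_add: "Ck k f \<Longrightarrow> Ck k g \<Longrightarrow> Ck k (\<lambda>x. f x + g x)"
proof (induction k arbitrary: f g)
  case (Suc k)
  show ?case
    by (rule Ck_SucI[OF has_derivative_add[OF Ck_SucD(1)[OF Suc.prems(1)] Ck_SucD(1)[OF Suc.prems(2)]]])
       (rule Suc.IH[OF Ck_SucD(2)[OF Suc.prems(1)] Ck_SucD(2)[OF Suc.prems(2)]])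
qed (simp add: continuous_on_add)

lemma Ck_bounded_linear:
  assumes T: "bounded_linear T"
  shows "Ck k f \<Longrightarrow> Ck k (\<lambda>x. T (f x))"
proof (induction k arbitrary: f)
  case 0
  then show ?case using bounded_linear.continuous_on[OF T] by simp
next
  case (Suc k)
  show ?case
    by (rule Ck_SucI[OF bounded_linear.has_derivative[OF T Ck_SucD(1)[OF Suc.prems]]])
       (rule Suc.IH[OF Ck_SucD(2)[OF Suc.prems]])
qed

lemma Ck_linear_map:
  assumes T: "bounded_linear T"
  shows "Ck k T"
proof (cases k)
  case 0
  then show ?thesis using T by (simp add: linear_continuous_on)
next
  case (Suc j)
  show ?thesis unfolding Suc
    by (rule Ck_SucI[where f' = "\<lambda>_. T"]) (rule bounded_linear_imp_has_derivative[OF T], rule Ck_const)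
qed

lemma Ck_diff: "Ck k f \<Longrightarrow> Ck k g \<Longrightarrow> Ck k (\<lambda>x. f x - g x)"
  using Ck_add[of k f "\<lambda>x. - g x"] Ck_bounded_linear[OF bounded_linear_minus[OF bounded_linear_ident], of k g] by simp

lemma Ck_mult:
  fixes f g :: "'a::real_normed_vector \<Rightarrow> 'b::real_normed_algebra"
  shows "Ck k f \<Longrightarrow> Ck k g \<Longrightarrow> Ck k (\<lambda>x. f x * g x)"
proof (induction k arbitrary: f g)
  case (Suc k)
  show ?case
    by (rule Ck_SucI[OF has_derivative_mult[OF Ck_SucD(1)[OF Suc.prems(1)] Ck_SucD(1)[OF Suc.prems(2)]]])
       (intro Ck_add Suc.IH Ck_SucD(2)[OF Suc.prems(1)] Ck_SucD(2)[OF Suc.prems(2)]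
         Ck_Suc_imp[OF Suc.prems(1)] Ck_Suc_imp[OF Suc.prems(2)])
qed (simp add: continuous_on_mult)

text \<open>The functions \<open>exp (- 1 / s) / s ^ m\<close>, extended by 0. The family is, up to
  linear combinations, closed under differentiation, so smoothness of its member
  \<open>flat 0\<close> follows by one induction over all \<open>m\<close>.\<close>

definition flat :: "nat \<Rightarrow> real \<Rightarrow> real" where
  "flat m s = (if 0 < s then exp (- inverse s) * inverse s ^ m else 0)"

text \<open>The exponential series for \<open>exp (inverse s)\<close> dominates its single term of
  degree \<open>m + j\<close>.\<close>

lemma flat_bound: "\<bar>flat m s\<bar> \<le> fact (m + j) * \<bar>s\<bar> ^ j"
proof (cases "0 < s")
  case True
  have "(\<Sum>i\<in>{m + j}. inverse (fact i) *\<^sub>R inverse s ^ i) \<le> (\<Sum>i. inverse (fact i) *\<^sub>R inverse s ^ i)"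
    using True by (intro sum_le_suminf summable_exp_generic) auto
  then have "inverse (fact (m + j)) * inverse s ^ (m + j) \<le> exp (inverse s)"
    by (simp add: exp_def)
  then have "inverse (fact (m + j)) * inverse s ^ (m + j) * exp (- inverse s) \<le> exp (inverse s) * exp (- inverse s)"
    by (rule mult_right_mono) simp
  also have "exp (inverse s) * exp (- inverse s) = 1" by (simp flip: exp_add)
  finally have "inverse (fact (m + j)) * inverse s ^ (m + j) * exp (- inverse s) * (fact (m + j) * s ^ j) \<le> 1 * (fact (m + j) * s ^ j)"
    using True by (intro mult_right_mono) auto
  moreover have "inverse s ^ (m + j) * s ^ j = inverse s ^ m"
    using True by (simp add: power_add power_inverse)
  then have "inverse (fact (m + j)) * inverse s ^ (m + j) * exp (- inverse s) * (fact (m + j) * s ^ j)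
      = exp (- inverse s) * inverse s ^ m"
    by (simp add: mult.assoc mult.left_commute)
  ultimately show ?thesis using True by (simp add: flat_def)
qed (simp add: flat_def)

lemma flat_has_derivative: "(flat m has_real_derivative (flat (m + 2) s - real m * flat (m + 1) s)) (at s)"
proof (cases s "0::real" rule: linorder_cases)
  case less
  have "((\<lambda>_. 0) has_real_derivative 0) (at s)" by simp
  then have "(flat m has_real_derivative 0) (at s)"
    by (rule DERIV_cong_ev[THEN iffD1, OF refl _ refl, rotated])
       (use less in \<open>auto intro!: eventually_mono[OF eventually_nhds_in_open[of "{..<0}"]] simp: flat_def\<close>)
  then show ?thesis using less by (simp add: flat_def)
next
  case greater
  have "((\<lambda>s. exp (- inverse s) * inverse s ^ m) has_real_derivative (flat (m + 2) s - real m * flat (m + 1) s)) (at s)"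
    using greater
    by (auto intro!: derivative_eq_intros simp: flat_def)
       (cases m; simp add: field_simps power2_eq_square)
  then show ?thesis
    by (rule DERIV_cong_ev[THEN iffD1, OF refl _ refl, rotated])
       (use greater in \<open>auto intro!: eventually_mono[OF eventually_nhds_in_open[of "{0<..}"]] simp: flat_def\<close>)
next
  case equal
  \<comment> \<open>At 0 the bound with \<open>j = 2\<close> makes the difference quotient at most a
    constant times \<open>\<bar>h\<bar>\<close>.\<close>
  have "(\<lambda>h. (flat m (0 + h) - flat m 0) / h) \<midarrow>0\<rightarrow> 0"
  proof (rule tendsto_rabs_zero_cancel, rule tendsto_sandwich[of "\<lambda>_. 0" _ _ "\<lambda>h::real. fact (m + 2) * \<bar>h\<bar>"])
    show "\<forall>\<^sub>F h in at 0. \<bar>(flat m (0 + h) - flat m 0) / h\<bar> \<le> fact (m + 2) * \<bar>h\<bar>"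
      unfolding eventually_at_filter
    proof (intro always_eventually allI impI)
      fix h :: real assume "h \<noteq> 0"
      then show "\<bar>(flat m (0 + h) - flat m 0) / h\<bar> \<le> fact (m + 2) * \<bar>h\<bar>"
        using flat_bound[of m h 2] by (simp add: flat_def[of m 0] divide_le_eq power2_eq_square mult.assoc)
    qed
    show "((\<lambda>h::real. fact (m + 2) * \<bar>h\<bar>) \<longlongrightarrow> 0) (at 0)"
    proof -
      have "((\<lambda>h. fact (m + 2) * \<bar>h\<bar>) \<longlongrightarrow> fact (m + 2) * \<bar>0::real\<bar>) (at 0)"
        by (intro tendsto_mult tendsto_const tendsto_rabs tendsto_ident_at)
      then show ?thesis by simp
    qed
  qed auto
  then show ?thesis using equal by (simp add: DERIV_def flat_def[of _ 0])
qed

text \<open>The derivative involves indices \<open>m + 1\<close> and \<open>m + 2\<close>, hence the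
  induction for all \<open>m\<close> at once. The argument \<open>x \<bullet> x\<close> is smooth
  also at the origin, where the norm is not.\<close>

lemma Ck_flat_radial:
  shows "Ck k (\<lambda>x::'a::real_inner. flat m (c - x \<bullet> x))"
proof (induction k arbitrary: m)
  case 0
  have "continuous_on UNIV (flat m)" for m
    using flat_has_derivative by (intro continuous_at_imp_continuous_on ballI DERIV_isCont)
  then have "continuous_on UNIV (\<lambda>x::'a. flat m (c - x \<bullet> x))"
    by (rule continuous_on_compose2) (auto intro!: continuous_intros)
  then show ?case by simp
next
  case (Suc k)
  have der: "((\<lambda>x::'a. flat m (c - x \<bullet> x)) has_derivative
      (\<lambda>h. (- 2 * (x \<bullet> h)) * (flat (m + 2) (c - x \<bullet> x) - real m * flat (m + 1) (c - x \<bullet> x)))) (at x)" for x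
  proof -
    have "((\<lambda>x::'a. c - x \<bullet> x) has_derivative (\<lambda>h. - 2 * (x \<bullet> h))) (at x)"
      by (rule has_derivative_eq_rhs[OF has_derivative_diff[OF has_derivative_const
            has_derivative_inner[OF has_derivative_ident has_derivative_ident]]])
         (simp add: fun_eq_iff inner_commute)
    then show ?thesis by (rule DERIV_compose_FDERIV[OF flat_has_derivative])
  qed
  show ?case
  proof (rule Ck_SucI[OF der])
    fix h :: 'a
    have 1: "Ck k (\<lambda>x::'a. - 2 * (x \<bullet> h))"
      by (rule Ck_linear_map) (rule bounded_linear_const_mult[OF bounded_linear_inner_left])
    have 2: "Ck k (\<lambda>x::'a. real m * flat (m + 1) (c - x \<bullet> x))"
      by (rule Ck_bounded_linear[OF bounded_linear_mult_right Suc])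
    show "Ck k (\<lambda>x. (- 2 * (x \<bullet> h)) * (flat (m + 2) (c - x \<bullet> x) - real m * flat (m + 1) (c - x \<bullet> x)))"
      by (rule Ck_mult[OF 1 Ck_diff[OF Suc 2]])
  qed
qed

section \<open>Mollifiers and convolution\<close>

lemma integrable_continuous_compact_support:
  fixes g :: "'a::euclidean_space \<Rightarrow> 'b::euclidean_space"
  assumes "continuous_on UNIV g" "compact K" "\<And>x. x \<notin> K \<Longrightarrow> g x = 0"
  shows "integrable lborel g"
proof -
  have "integrable lborel (\<lambda>x. indicator K x *\<^sub>R g x)"
    using assms(1,2) by (intro borel_integrable_compact) (auto intro: continuous_on_subset)
  also have "(\<lambda>x. indicator K x *\<^sub>R g x) = g"
    using assms(3) by (auto simp: indicator_def)
  finally show ?thesis .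
qed

lemma exists_mollifier:
  fixes \<epsilon> :: real
  assumes \<epsilon>: "0 < \<epsilon>"
  obtains \<eta> :: "'a::euclidean_space \<Rightarrow> real" where "\<And>k. Ck k \<eta>" "\<And>x. 0 \<le> \<eta> x" "\<And>x. \<eta> (- x) = \<eta> x"
    "\<And>x. \<epsilon> \<le> norm x \<Longrightarrow> \<eta> x = 0" "(\<integral>\<^sup>+x. ennreal (\<eta> x) \<partial>lborel) = 1"
proof -
  define \<zeta> :: "'a \<Rightarrow> real" where "\<zeta> x = flat 0 (\<epsilon>\<^sup>2 - x \<bullet> x)" for x
  have C: "Ck k \<zeta>" for k unfolding \<zeta>_def by (rule Ck_flat_radial)
  have cont: "continuous_on UNIV \<zeta>" using C[of 0] by simp
  have 0: "0 \<le> \<zeta> x" for x by (simp add: \<zeta>_def flat_def)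
  have van: "\<zeta> x = 0" if "\<epsilon> \<le> norm x" for x
  proof -
    have "\<epsilon>\<^sup>2 \<le> (norm x)\<^sup>2" using that \<epsilon> by (intro power_mono) auto
    then show ?thesis by (simp add: \<zeta>_def flat_def power2_norm_eq_inner)
  qed
  have pos: "0 < \<zeta> 0" using \<epsilon> by (simp add: \<zeta>_def flat_def)
  have int: "integrable lborel \<zeta>"
    by (rule integrable_continuous_compact_support[OF cont compact_cball[of 0 \<epsilon>]]) (simp add: van)
  define I where "I = (LINT x|lborel. \<zeta> x)"
  have nn: "(\<integral>\<^sup>+x. ennreal (\<zeta> x) \<partial>lborel) = ennreal I"
    unfolding I_def by (rule nn_integral_eq_integral[OF int]) (simp add: 0)
  \<comment> \<open>The bump is continuous and positive at 0, hence positive on a set of positive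
    measure; this permits normalization.\<close>
  have "I \<noteq> 0"
  proof
    assume "I = 0"
    then have "AE x in lborel. \<zeta> x = 0"
      using integral_nonneg_eq_0_iff_AE[OF int] 0 by (simp add: I_def)
    then have "AE x in lborel. x \<notin> {x. 0 < \<zeta> x}" by eventually_elim simp
    moreover have "open {x. 0 < \<zeta> x}" by (intro open_Collect_less continuous_intros cont)
    ultimately have "{x. 0 < \<zeta> x} = {}" by (intro open_AE_not_mem_imp_empty)
    then show False using pos by blast
  qed
  moreover have "0 \<le> I" unfolding I_def using 0 by simp
  ultimately have I: "0 < I" by simp
  show ?thesis
  proof (rule that[of "\<lambda>x. inverse I * \<zeta> x"])
    show "Ck k (\<lambda>x. inverse I * \<zeta> x)" for k
      by (rule Ck_bounded_linear[OF bounded_linear_mult_right C])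
    have [measurable]: "\<zeta> \<in> borel_measurable borel" by (rule borel_measurable_continuous_onI[OF cont])
    have "(\<integral>\<^sup>+x. ennreal (inverse I * \<zeta> x) \<partial>lborel) = ennreal (inverse I) * ennreal I"
      using I by (simp add: ennreal_mult 0 nn_integral_cmult nn)
    also have "\<dots> = 1" using I by (simp flip: ennreal_mult)
    finally show "(\<integral>\<^sup>+x. ennreal (inverse I * \<zeta> x) \<partial>lborel) = 1" .
  qed (use I 0 van in \<open>auto simp: \<zeta>_def\<close>)
qed

context
  fixes v :: "'a::euclidean_space \<Rightarrow> real" and K :: "'a set"
  assumes cv: "continuous_on UNIV v" and K: "compact K" and vK: "\<And>x. x \<notin> K \<Longrightarrow> v x = 0"
begin

lemma integrable_convolution:
  assumes "continuous_on UNIV \<zeta>"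
  shows "integrable lborel (\<lambda>y. v y * \<zeta> (x - y))"
  by (rule integrable_continuous_compact_support[OF _ K])
     (auto intro!: continuous_intros cv continuous_on_compose2[OF assms] simp: vK)

lemma convolution_eq_integral:
  assumes "continuous_on UNIV \<zeta>" "K \<subseteq> cbox a b"
  shows "(LINT y|lborel. v y * \<zeta> (x - y)) = integral (cbox a b) (\<lambda>y. v y * \<zeta> (x - y))"
proof -
  have eq: "indicator (cbox a b) y *\<^sub>R (v y * \<zeta> (x - y)) = v y * \<zeta> (x - y)" for y
    using assms(2) vK[of y] by (auto simp: indicator_def)
  have "set_integrable lborel (cbox a b) (\<lambda>y. v y * \<zeta> (x - y))"
    unfolding set_integrable_def eq by (rule integrable_convolution[OF assms(1)])
  from set_borel_integral_eq_integral(2)[OF this] show ?thesis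
    unfolding set_lebesgue_integral_def eq .
qed

text \<open>Derivatives fall on the kernel \<open>\<zeta>\<close>, so continuity of \<open>v\<close>
  suffices. The compact support reduces the integral to a fixed box, over which one differentiates
  under the integral sign; the derivative is again a convolution with a kernel one degree less
  smooth.\<close>

lemma Ck_convolution:
  shows "Ck k \<zeta> \<Longrightarrow> Ck k (\<lambda>x. LINT y|lborel. v y * \<zeta> (x - y))"
proof (induction k arbitrary: \<zeta>)
  case 0
  obtain a b where ab: "K \<subseteq> cbox a b" using bounded_subset_cbox_symmetric[OF compact_imp_bounded[OF K]] by blast
  have c: "continuous_on UNIV \<zeta>" using 0 by simp
  have "continuous_on (UNIV \<times> cbox a b) (\<lambda>(x, y). v y * \<zeta> (x - y))"
    unfolding split_beta
    by (intro continuous_intros continuous_on_compose2[OF cv] continuous_on_compose2[OF c]) auto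
  then have "continuous_on UNIV (\<lambda>x. integral (cbox a b) (\<lambda>y. v y * \<zeta> (x - y)))"
    by (rule integral_continuous_on_param)
  then show ?case by (simp add: convolution_eq_integral[OF c ab])
next
  case (Suc k)
  obtain a b where ab: "K \<subseteq> cbox a b" using bounded_subset_cbox_symmetric[OF compact_imp_bounded[OF K]] by blast
  let ?D = "\<lambda>x. frechet_derivative \<zeta> (at x)"
  have der: "(\<zeta> has_derivative ?D x) (at x)" for x by (rule Ck_SucD(1)[OF Suc.prems])
  have CD: "Ck k (\<lambda>x. ?D x h)" for h by (rule Ck_SucD(2)[OF Suc.prems])
  have C0: "Ck 0 g" if "Ck k g" for g :: "'a \<Rightarrow> real"
    using that by (induction k) (auto intro: Ck_Suc_imp simp del: Ck.simps)
  have cD: "continuous_on UNIV (\<lambda>x. ?D x h)" for h using C0[OF CD] by simp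
  have c: "continuous_on UNIV \<zeta>"
    using der by (intro continuous_at_imp_continuous_on) (auto intro: has_derivative_continuous)
  \<comment> \<open>The Leibniz rule wants the derivative as a continuous map into the bounded
    linear operators; in finite dimension continuity may be checked in each direction
    \<open>h\<close>.\<close>
  define Z where "Z x = Blinfun (?D x)" for x
  have Z: "blinfun_apply (Z x) = ?D x" for x
    unfolding Z_def using der by (intro bounded_linear_Blinfun_apply has_derivative_bounded_linear)
  have cZ: "continuous_on UNIV Z"
    by (rule continuous_on_blinfun_componentwise) (simp add: Z cD)
  have int: "(\<lambda>t. v t *\<^sub>R Z (x - t)) integrable_on cbox a b" for x
    by (intro integrable_continuous continuous_intros continuous_on_subset[OF cv] continuous_on_compose2[OF cZ]) auto
  have "((\<lambda>x. integral (cbox a b) (\<lambda>y. v y * \<zeta> (x - y))) has_derivative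
      blinfun_apply (integral (cbox a b) (\<lambda>y. v y *\<^sub>R Z (x - y)))) (at x within UNIV)" for x
  proof (rule leibniz_rule)
    show "((\<lambda>x. v t * \<zeta> (x - t)) has_derivative blinfun_apply (v t *\<^sub>R Z (x - t))) (at x within UNIV)" for x t
    proof -
      have "((\<lambda>x. \<zeta> (x - t)) has_derivative (\<lambda>h. ?D (x - t) h)) (at x)"
        by (rule has_derivative_compose[OF _ der]) (auto intro!: derivative_eq_intros)
      then have "((\<lambda>x. v t * \<zeta> (x - t)) has_derivative (\<lambda>h. v t * ?D (x - t) h)) (at x)"
        by (rule has_derivative_mult_right)
      then show ?thesis by (simp add: blinfun.scaleR_left[abs_def] Z)
    qed
    show "(\<lambda>y. v y * \<zeta> (x - y)) integrable_on cbox a b" for x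
      by (intro integrable_continuous continuous_intros continuous_on_subset[OF cv] continuous_on_compose2[OF c]) auto
    show "continuous_on (UNIV \<times> cbox a b) (\<lambda>(x, t). v t *\<^sub>R Z (x - t))"
      unfolding split_beta
      by (intro continuous_intros continuous_on_compose2[OF cv] continuous_on_compose2[OF cZ]) auto
  qed auto
  moreover have "blinfun_apply (integral (cbox a b) (\<lambda>y. v y *\<^sub>R Z (x - y))) h = (LINT y|lborel. v y * ?D (x - y) h)" for x h
    by (subst blinfun_apply_integral[OF int])
       (simp add: blinfun.scaleR_left Z convolution_eq_integral[OF cD ab])
  then have "blinfun_apply (integral (cbox a b) (\<lambda>y. v y *\<^sub>R Z (x - y))) = (\<lambda>h. LINT y|lborel. v y * ?D (x - y) h)" for x
    by blast
  ultimately have "((\<lambda>x. LINT y|lborel. v y * \<zeta> (x - y)) has_derivative (\<lambda>h. LINT y|lborel. v y * ?D (x - y) h)) (at x)" for x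
    by (simp add: convolution_eq_integral[OF c ab])
  then show ?case by (rule Ck_SucI) (rule Suc.IH[OF CD])
qed

end

lemma integral_lborel_translate:
  fixes g :: "'a::euclidean_space \<Rightarrow> 'b::{banach, second_countable_topology}"
  assumes [measurable]: "g \<in> borel_measurable borel"
  shows "(LINT x|lborel. g (x + a)) = (LINT x|lborel. g x)"
proof -
  have "(LINT x|distr lborel borel ((+) a). g x) = (LINT x|lborel. g (x + a))"
    by (subst integral_distr) (auto simp: add.commute)
  then show ?thesis by (simp add: lborel_distr_plus)
qed

text \<open>Convolution with an even probability density supported in the ball of radius
  \<open>\<epsilon>\<close> averages translates of \<open>v\<close> by vectors shorter than
  \<open>\<epsilon>\<close>. The support grows by at most \<open>\<epsilon>\<close>, values move by
  at most \<open>L * \<epsilon>\<close>, and by convexity of the square the energies do not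
  grow.\<close>

theorem exists_smooth_approximation:
  fixes v :: "'a::euclidean_space \<Rightarrow> real"
  assumes lip: "\<And>x y. \<bar>v x - v y\<bar> \<le> L * norm (x - y)" and L: "0 \<le> L"
    and van: "\<And>x. r < norm (x - c) \<Longrightarrow> v x = 0" and \<epsilon>: "0 < \<epsilon>"
  obtains f :: "'a \<Rightarrow> real" where "\<And>k. Ck k f" "\<And>x. r + \<epsilon> < norm (x - c) \<Longrightarrow> f x = 0"
    "\<And>x. \<bar>f x - v x\<bar> \<le> L * \<epsilon>" "\<And>t. energy t f \<le> energy t v"
proof -
  obtain \<eta> :: "'a \<Rightarrow> real" where C: "\<And>k. Ck k \<eta>" and \<eta>0: "\<And>x. 0 \<le> \<eta> x" and even: "\<And>x. \<eta> (- x) = \<eta> x"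
    and \<eta>van: "\<And>x. \<epsilon> \<le> norm x \<Longrightarrow> \<eta> x = 0" and one: "(\<integral>\<^sup>+x. ennreal (\<eta> x) \<partial>lborel) = 1"
    using exists_mollifier[OF \<epsilon>, where 'a='a] by blast
  have c\<eta>: "continuous_on UNIV \<eta>" using C[of 0] by simp
  have cv: "continuous_on UNIV v" by (rule lipschitz_imp_continuous[OF lip])
  have [measurable]: "\<eta> \<in> borel_measurable borel" "v \<in> borel_measurable borel"
    by (auto intro: borel_measurable_continuous_onI c\<eta> cv)
  have vK: "v x = 0" if "x \<notin> cball c r" for x
    using that by (intro van) (simp add: dist_norm norm_minus_commute)
  define f where "f x = (LINT y|lborel. v y * \<eta> (x - y))" for x
  have Cf: "Ck k f" for k unfolding f_def by (rule Ck_convolution[OF cv compact_cball vK C])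
  have fm[measurable]: "f \<in> borel_measurable borel"
    using Cf[of 0] by (auto intro: borel_measurable_continuous_onI)
  have int: "integrable lborel (\<lambda>y. v y * \<eta> (x - y))" for x
    by (rule integrable_convolution[OF cv compact_cball vK c\<eta>])
  have onel: "(\<integral>\<^sup>+y. ennreal (\<eta> (x - y)) \<partial>lborel) = 1" and oner: "(\<integral>\<^sup>+z. ennreal (\<eta> (z - x)) \<partial>lborel) = 1" for x
  proof -
    show "(\<integral>\<^sup>+z. ennreal (\<eta> (z - x)) \<partial>lborel) = 1"
      using nn_integral_lborel_translate[of "\<lambda>z. ennreal (\<eta> z)" "- x"] one by simp
    moreover have "\<eta> (x - y) = \<eta> (y - x)" for y using even[of "y - x"] by simp
    ultimately show "(\<integral>\<^sup>+y. ennreal (\<eta> (x - y)) \<partial>lborel) = 1" by simp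
  qed
  have int\<eta>: "integrable lborel (\<lambda>y. \<eta> (x - y))" for x
    by (rule integrableI_nonneg) (simp_all add: \<eta>0 onel)
  have int1: "(LINT y|lborel. \<eta> (x - y)) = 1" for x
    using integral_eq_nn_integral[of "\<lambda>y. \<eta> (x - y)" lborel] by (simp add: \<eta>0 onel)
  have supp: "f x = 0" if x: "r + \<epsilon> < norm (x - c)" for x
  proof -
    have "v y * \<eta> (x - y) = 0" for y
    proof (cases "norm (x - y) < \<epsilon>")
      case True
      have "norm (x - c) \<le> norm (x - y) + norm (y - c)" using norm_triangle_ineq[of "x - y" "y - c"] by simp
      then show ?thesis using True x van[of y] by simp
    qed (simp add: \<eta>van)
    then have "(\<lambda>y. v y * \<eta> (x - y)) = (\<lambda>_. 0)" by blast
    then show ?thesis unfolding f_def by simp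
  qed
  have close: "\<bar>f x - v x\<bar> \<le> L * \<epsilon>" for x
  proof -
    have "f x - v x = (LINT y|lborel. v y * \<eta> (x - y)) - (LINT y|lborel. v x * \<eta> (x - y))"
      by (simp add: f_def int1)
    also have "\<dots> = (LINT y|lborel. (v y - v x) * \<eta> (x - y))"
      by (subst Bochner_Integration.integral_diff[symmetric]) (auto simp: int int\<eta> left_diff_distrib)
    finally have "\<bar>f x - v x\<bar> \<le> (LINT y|lborel. \<bar>(v y - v x) * \<eta> (x - y)\<bar>)"
      using integral_abs_bound[of lborel "\<lambda>y. (v y - v x) * \<eta> (x - y)"] by simp
    also have "\<dots> \<le> (LINT y|lborel. (L * \<epsilon>) * \<eta> (x - y))"
    proof (rule integral_mono)
      show "integrable lborel (\<lambda>y. \<bar>(v y - v x) * \<eta> (x - y)\<bar>)"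
        using Bochner_Integration.integrable_diff[OF int[of x] integrable_mult_right[OF int\<eta>[of x], of "v x"]]
        by (intro integrable_abs) (simp add: left_diff_distrib)
      show "\<bar>(v y - v x) * \<eta> (x - y)\<bar> \<le> (L * \<epsilon>) * \<eta> (x - y)" for y
      proof (cases "norm (x - y) < \<epsilon>")
        case True
        have "\<bar>v y - v x\<bar> \<le> L * norm (y - x)" by (rule lip)
        also have "\<dots> \<le> L * \<epsilon>" using True L by (intro mult_left_mono) (auto simp: norm_minus_commute)
        finally show ?thesis by (simp add: abs_mult \<eta>0 mult_right_mono)
      qed (simp add: \<eta>van)
    qed (simp add: int\<eta>)
    also have "\<dots> = L * \<epsilon>" by (simp add: int1)
    finally show ?thesis .
  qed
  have diff: "ennreal ((norm (f (x + h) - f x))\<^sup>2)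
      \<le> (\<integral>\<^sup>+y. ennreal ((norm (v (y + h) - v y))\<^sup>2) * ennreal (\<eta> (x - y)) \<partial>lborel)" for x h
  proof -
    have "f (x + h) = (LINT y|lborel. v (y + h) * \<eta> (x - y))"
      using integral_lborel_translate[of "\<lambda>y. v y * \<eta> (x + h - y)" h] by (simp add: f_def)
    moreover have "integrable lborel (\<lambda>y. v (y + h) * \<eta> (x - y))"
    proof (rule integrable_continuous_compact_support[of _ "cball (c - h) r"])
      show "continuous_on UNIV (\<lambda>y. v (y + h) * \<eta> (x - y))"
        by (intro continuous_intros continuous_on_compose2[OF cv] continuous_on_compose2[OF c\<eta>]) auto
      show "v (y + h) * \<eta> (x - y) = 0" if "y \<notin> cball (c - h) r" for y
        using that vK[of "y + h"] by (simp add: dist_norm algebra_simps)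
    qed auto
    ultimately have eq: "f (x + h) - f x = (LINT y|lborel. (v (y + h) - v y) * \<eta> (x - y))"
      and i: "integrable lborel (\<lambda>y. (v (y + h) - v y) * \<eta> (x - y))"
      by (simp_all add: f_def[of x] left_diff_distrib int)
    \<comment> \<open>Splitting the density into two square roots makes Cauchy-Schwarz yield
      Jensen's inequality, since the density has integral 1.\<close>
    let ?g = "\<lambda>y. ennreal (norm (v (y + h) - v y) * sqrt (\<eta> (x - y)))"
    let ?s = "\<lambda>y. ennreal (sqrt (\<eta> (x - y)))"
    have "ennreal (norm (f (x + h) - f x)) \<le> (\<integral>\<^sup>+y. norm ((v (y + h) - v y) * \<eta> (x - y)) \<partial>lborel)"
      unfolding eq by (rule integral_norm_bound_ennreal[OF i])
    also have "\<dots> = (\<integral>\<^sup>+y. ?g y * ?s y \<partial>lborel)"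
      by (intro nn_integral_cong) (simp add: \<eta>0 abs_mult mult.assoc flip: ennreal_mult)
    finally have "(ennreal (norm (f (x + h) - f x)))\<^sup>2 \<le> (\<integral>\<^sup>+y. ?g y * ?s y \<partial>lborel)\<^sup>2"
      by (rule power_mono) simp
    also have "\<dots> \<le> (\<integral>\<^sup>+y. (?g y)\<^sup>2 \<partial>lborel) * (\<integral>\<^sup>+y. (?s y)\<^sup>2 \<partial>lborel)"
      by (rule Cauchy_Schwarz_nn_integral) measurable
    also have "(\<integral>\<^sup>+y. (?s y)\<^sup>2 \<partial>lborel) = 1" by (simp add: ennreal_power \<eta>0 onel)
    also have "(\<integral>\<^sup>+y. (?g y)\<^sup>2 \<partial>lborel) = (\<integral>\<^sup>+y. ennreal ((norm (v (y + h) - v y))\<^sup>2) * ennreal (\<eta> (x - y)) \<partial>lborel)"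
      by (intro nn_integral_cong) (simp add: ennreal_power \<eta>0 power_mult_distrib ennreal_mult)
    finally show ?thesis by (simp add: ennreal_power)
  qed
  have en: "energy t f \<le> energy t v" for t
    unfolding energy_Fubini[OF fm] energy_Fubini[OF \<open>v \<in> borel_measurable borel\<close>]
  proof (rule nn_integral_mono, rule mult_left_mono)
    fix h :: 'a
    let ?w = "\<lambda>y. ennreal ((norm (v (y + h) - v y))\<^sup>2)"
    have "(\<integral>\<^sup>+x. ennreal ((norm (f (x + h) - f x))\<^sup>2) \<partial>lborel) \<le> (\<integral>\<^sup>+x. \<integral>\<^sup>+y. ?w y * ennreal (\<eta> (x - y)) \<partial>lborel \<partial>lborel)"
      by (intro nn_integral_mono diff)
    also have "\<dots> = (\<integral>\<^sup>+y. \<integral>\<^sup>+x. ?w y * ennreal (\<eta> (x - y)) \<partial>lborel \<partial>lborel)"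
      by (rule lborel_pair.Fubini'[symmetric]) measurable
    also have "\<dots> = (\<integral>\<^sup>+y. ?w y \<partial>lborel)" by (simp add: nn_integral_cmult oner)
    finally show "(\<integral>\<^sup>+x. ennreal ((norm (f (x + h) - f x))\<^sup>2) \<partial>lborel) \<le> (\<integral>\<^sup>+y. ?w y \<partial>lborel)" .
  qed simp
  show ?thesis by (rule that[OF Cf supp close en])
qed

subsection \<open>Test functions in \<open>W\<^sup>1\<^sup>,\<^sup>2\<^sub>0\<close>\<close>

text \<open>Sobolev norms are integrals over \<open>D\<close> with respect to the completed measure,
  while translations and rotations act on \<open>lborel\<close>. This passes from one to the other
  for Borel functions extended by 0.\<close>

lemma nn_integral_lebesgue_on:
  fixes g :: "'a::euclidean_space \<Rightarrow> ennreal"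
  assumes [measurable]: "g \<in> borel_measurable borel" and D[measurable]: "D \<in> sets borel"
    and van: "\<And>x. x \<notin> D \<Longrightarrow> g x = 0"
  shows "(\<integral>\<^sup>+x. g x \<partial>lebesgue_on D) = (\<integral>\<^sup>+x. g x \<partial>lborel)"
proof -
  have "(\<integral>\<^sup>+x. g x \<partial>lebesgue_on D) = (\<integral>\<^sup>+x. g x * indicator D x \<partial>lebesgue)"
    by (simp add: nn_integral_restrict_space)
  also have "(\<lambda>x. g x * indicator D x) = g" using van by (auto simp: indicator_def)
  also have "(\<integral>\<^sup>+x. g x \<partial>lebesgue) = (\<integral>\<^sup>+x. g x \<partial>lborel)" by (simp add: nn_integral_completion)
  finally show ?thesis .
qed

lemma integral_lebesgue_on:
  fixes g :: "'a::euclidean_space \<Rightarrow> 'b::{banach, second_countable_topology}"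
  assumes [measurable]: "g \<in> borel_measurable borel" and D[measurable]: "D \<in> sets borel"
    and van: "\<And>x. x \<notin> D \<Longrightarrow> g x = 0"
  shows "(LINT x|lebesgue_on D. g x) = (LINT x|lborel. g x)"
proof -
  have "(LINT x|lebesgue_on D. g x) = (LINT x|lebesgue. indicator D x *\<^sub>R g x)"
    by (rule integral_restrict_space) (use D in \<open>simp add: sets_completionI_sets\<close>)
  also have "(\<lambda>x. indicator D x *\<^sub>R g x) = g" using van by (auto simp: indicator_def)
  also have "(LINT x|lebesgue. g x) = (LINT x|lborel. g x)" by (rule integral_completion) simp
  finally show ?thesis .
qed

lemma borel_measurable_lebesgue_on:
  "g \<in> borel_measurable borel \<Longrightarrow> g \<in> borel_measurable (lebesgue_on D)"
  by (rule measurable_restrict_space1) (simp add: measurable_completion)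

lemma ennpow_ennreal: "0 \<le> x \<Longrightarrow> ennpow (ennreal x) a = ennreal (x powr a)"
  by (simp add: ennpow_def)

lemma Lp_norm_eq:
  fixes f :: "'a::euclidean_space \<Rightarrow> 'b::euclidean_space"
  assumes [measurable]: "f \<in> borel_measurable borel" and "D \<in> sets borel" and "\<And>x. x \<notin> D \<Longrightarrow> f x = 0" and "p \<noteq> \<infinity>"
  shows "Lp_norm p D f = ennpow (\<integral>\<^sup>+x. ennreal (norm (f x) powr enn2real p) \<partial>lborel) (1 / enn2real p)"
  using assms unfolding Lp_norm_def by (subst nn_integral_lebesgue_on) auto

lemma test_function_vanishes:
  assumes "\<phi> \<in> test_functions D" "x \<notin> D"
  shows "\<phi> x = 0" "frechet_derivative \<phi> (at x) = (\<lambda>_. 0)" "gradient \<phi> x = 0"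
proof -
  have x: "x \<notin> closure {x. \<phi> x \<noteq> 0}" using assms by (auto simp: test_functions_def)
  then show "\<phi> x = 0" using closure_subset[of "{x. \<phi> x \<noteq> 0}"] by auto
  show "frechet_derivative \<phi> (at x) = (\<lambda>_. 0)" by (rule frechet_derivative_vanishes[OF x])
  then show "gradient \<phi> x = 0" by (simp add: gradient_def vec_eq_iff)
qed

lemma continuous_gradient:
  assumes "\<phi> \<in> test_functions D"
  shows "continuous_on UNIV (gradient \<phi>)"
  unfolding gradient_def[abs_def] by (intro continuous_on_vec_lambda test_functions_differentiable(2)[OF assms])

lemma test_function_measurable:
  assumes "\<phi> \<in> test_functions D"
  shows "\<phi> \<in> borel_measurable borel" "gradient \<phi> \<in> borel_measurable borel"
  by (auto intro: borel_measurable_continuous_onI test_functions_differentiable(3)[OF assms] continuous_gradient[OF assms])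

lemma test_function_nn_integral_finite:
  fixes g :: "real^'n \<Rightarrow> 'b::euclidean_space"
  assumes \<phi>: "\<phi> \<in> test_functions D" and g: "continuous_on UNIV g"
    and van: "\<And>x. x \<notin> closure {x. \<phi> x \<noteq> 0} \<Longrightarrow> g x = 0" and p: "0 < p"
  shows "(\<integral>\<^sup>+x. ennreal (norm (g x) powr p) \<partial>lborel) < \<infinity>"
proof -
  have "integrable lborel (\<lambda>x. norm (g x) powr p)"
  proof (rule integrable_continuous_compact_support)
    show "compact (closure {x. \<phi> x \<noteq> 0})" using \<phi> by (simp add: test_functions_def)
    show "continuous_on UNIV (\<lambda>x. norm (g x) powr p)"
      using p by (intro continuous_on_powr' continuous_intros g) auto
  qed (simp add: van)
  then show ?thesis by (subst nn_integral_eq_integral) auto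
qed

lemma test_function_finite:
  assumes \<phi>: "\<phi> \<in> test_functions D" and p: "0 < p"
  shows "(\<integral>\<^sup>+x. ennreal (norm (\<phi> x) powr p) \<partial>lborel) < \<infinity>"
    and "(\<integral>\<^sup>+x. ennreal (norm (gradient \<phi> x) powr p) \<partial>lborel) < \<infinity>"
    and "(\<integral>\<^sup>+x. ennreal ((norm (gradient \<phi> x))\<^sup>2) \<partial>lborel) < \<infinity>"
proof -
  show "(\<integral>\<^sup>+x. ennreal (norm (\<phi> x) powr p) \<partial>lborel) < \<infinity>"
    using closure_subset[of "{x. \<phi> x \<noteq> 0}"]
    by (intro test_function_nn_integral_finite[OF \<phi> test_functions_differentiable(3)[OF \<phi>] _ p]) auto
  have g: "(\<integral>\<^sup>+x. ennreal (norm (gradient \<phi> x) powr p) \<partial>lborel) < \<infinity>" if "0 < p" for p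
    by (intro test_function_nn_integral_finite[OF \<phi> continuous_gradient[OF \<phi>] _ that])
       (simp add: gradient_def frechet_derivative_vanishes vec_eq_iff)
  show "(\<integral>\<^sup>+x. ennreal (norm (gradient \<phi> x) powr p) \<partial>lborel) < \<infinity>" by (rule g[OF p])
  show "(\<integral>\<^sup>+x. ennreal ((norm (gradient \<phi> x))\<^sup>2) \<partial>lborel) < \<infinity>"
    using g[of 2] by (simp add: powr_numeral)
qed

section \<open>Operations on test functions and their gradients\<close>

lemma test_functions_subset_closure:
  assumes "\<phi> \<in> test_functions D" "\<And>k. Ck k \<psi>" "\<And>x. \<psi> x \<noteq> 0 \<Longrightarrow> \<phi> x \<noteq> 0"
  shows "\<psi> \<in> test_functions D"
proof -
  have "closure {x. \<psi> x \<noteq> 0} \<subseteq> closure {x. \<phi> x \<noteq> 0}" using assms(3) by (intro closure_mono) auto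
  moreover have "compact (closure {x. \<psi> x \<noteq> 0})"
    using assms(1) calculation unfolding test_functions_def
    by (metis (no_types, lifting) bounded_subset closed_closure compact_eq_bounded_closed mem_Collect_eq)
  ultimately show ?thesis using assms(1,2) by (auto simp: test_functions_def)
qed

lemma test_functions_Ck: "\<phi> \<in> test_functions D \<Longrightarrow> Ck k \<phi>"
  by (simp add: test_functions_def)

lemma test_functions_diff:
  assumes "\<phi> \<in> test_functions D" "\<psi> \<in> test_functions D"
  shows "(\<lambda>x. \<phi> x - \<psi> x) \<in> test_functions D"
proof -
  have "{x. \<phi> x - \<psi> x \<noteq> 0} \<subseteq> {x. \<phi> x \<noteq> 0} \<union> {x. \<psi> x \<noteq> 0}" by auto
  then have sub: "closure {x. \<phi> x - \<psi> x \<noteq> 0} \<subseteq> closure {x. \<phi> x \<noteq> 0} \<union> closure {x. \<psi> x \<noteq> 0}"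
    unfolding closure_Un[symmetric] by (rule closure_mono)
  have "compact (closure {x. \<phi> x \<noteq> 0} \<union> closure {x. \<psi> x \<noteq> 0})"
    using assms by (intro compact_Un) (simp_all add: test_functions_def)
  from bounded_subset[OF compact_imp_bounded[OF this] sub]
  have "compact (closure {x. \<phi> x - \<psi> x \<noteq> 0})" by (simp only: compact_eq_bounded_closed closed_closure)
  moreover have "closure {x. \<phi> x - \<psi> x \<noteq> 0} \<subseteq> D"
    using sub assms by (auto simp only: test_functions_def)
  moreover have "Ck k (\<lambda>x. \<phi> x - \<psi> x)" for k
    by (rule Ck_diff[OF test_functions_Ck[OF assms(1)] test_functions_Ck[OF assms(2)]])
  ultimately show ?thesis unfolding test_functions_def by simp
qed

lemma test_functions_mult:
  assumes "\<phi> \<in> test_functions D" "\<psi> \<in> test_functions D"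
  shows "(\<lambda>x. \<phi> x * \<psi> x) \<in> test_functions D"
  by (rule test_functions_subset_closure[OF assms(1)])
     (rule Ck_mult[OF test_functions_Ck[OF assms(1)] test_functions_Ck[OF assms(2)]], simp)

lemma test_functions_cnj:
  assumes "\<phi> \<in> test_functions D"
  shows "(\<lambda>x. cnj (\<phi> x)) \<in> test_functions D"
  by (rule test_functions_subset_closure[OF assms(1)])
     (rule Ck_bounded_linear[OF bounded_linear_cnj test_functions_Ck[OF assms]], simp)

lemma test_function_has_derivative:
  "\<phi> \<in> test_functions D \<Longrightarrow> (\<phi> has_derivative frechet_derivative \<phi> (at x)) (at x)"
  by (rule frechet_derivative_works[THEN iffD1, OF test_functions_differentiable(1)])

lemma gradient_diff:
  assumes "\<phi> \<in> test_functions D" "\<psi> \<in> test_functions D"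
  shows "gradient (\<lambda>x. \<phi> x - \<psi> x) x = gradient \<phi> x - gradient \<psi> x"
  unfolding gradient_def
  by (simp add: vec_eq_iff frechet_derivative_at[OF has_derivative_diff[OF
        test_function_has_derivative[OF assms(1)] test_function_has_derivative[OF assms(2)]], symmetric])

lemma gradient_cnj:
  assumes "\<phi> \<in> test_functions D"
  shows "gradient (\<lambda>x. cnj (\<phi> x)) x $ i = cnj (gradient \<phi> x $ i)"
  unfolding gradient_def
  by (simp add: frechet_derivative_at[OF bounded_linear.has_derivative[OF bounded_linear_cnj
        test_function_has_derivative[OF assms(1)]], symmetric])

text \<open>Difference quotients have integral 0 by translation invariance, and they converge to the
  derivative under a common majorant.\<close>

lemma integral_derivative_eq_0:
  assumes F: "F \<in> test_functions D"
  shows "(LINT x|lborel. frechet_derivative F (at x) h) = 0"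
proof -
  obtain L where L: "0 \<le> L" "\<And>x y. norm (F x - F y) \<le> L * norm (x - y)"
    using test_function_lipschitz[OF F] by blast
  have "bounded (closure {x. F x \<noteq> 0})" using F by (simp add: test_functions_def compact_imp_bounded)
  then obtain R where R: "\<And>x. F x \<noteq> 0 \<Longrightarrow> norm x \<le> R"
    using closure_subset[of "{x. F x \<noteq> 0}"] unfolding bounded_iff by blast
  have cF: "continuous_on UNIV F" by (rule test_functions_differentiable(3)[OF F])
  have [measurable]: "F \<in> borel_measurable borel" by (rule borel_measurable_continuous_onI[OF cF])
  have intF: "integrable lborel F"
    using closure_subset[of "{x. F x \<noteq> 0}"] F
    by (intro integrable_continuous_compact_support[OF cF, of "closure {x. F x \<noteq> 0}"]) (auto simp: test_functions_def)
  define T where "T k = inverse (real (Suc k))" for k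
  have T: "0 < T k" "T k \<le> 1" for k by (auto simp: T_def inverse_le_1_iff)
  have T0: "T \<longlonglongrightarrow> 0" unfolding T_def[abs_def] by (rule LIMSEQ_inverse_real_of_nat)
  define g where "g k x = (F (x + T k *\<^sub>R h) - F x) /\<^sub>R T k" for k x
  have "(\<lambda>k. LINT x|lborel. g k x) \<longlonglongrightarrow> (LINT x|lborel. frechet_derivative F (at x) h)"
  \<comment> \<open>The Lipschitz constant bounds the quotients by \<open>L * norm h\<close>. Since
    \<open>T k \<le> 1\<close>, the shifted function has its support within
    \<open>R + norm h\<close> of the origin.\<close>
  proof (rule integral_dominated_convergence[where w = "\<lambda>x. L * norm h * indicator (cball 0 (R + norm h)) x"])
    show "(\<lambda>x. frechet_derivative F (at x) h) \<in> borel_measurable lborel"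
      using borel_measurable_continuous_onI[OF test_functions_differentiable(2)[OF F, of h]] by simp
    show "g k \<in> borel_measurable lborel" for k unfolding g_def by measurable
    show "integrable lborel (\<lambda>x::real^'a. L * norm h * indicator (cball 0 (R + norm h)) x)"
      using emeasure_lborel_cball_finite[of "0::real^'a" "R + norm h"]
      by (intro integrable_mult_right integrable_real_indicator) (auto simp: less_top)
    show "AE x in lborel. (\<lambda>k. g k x) \<longlonglongrightarrow> frechet_derivative F (at x) h"
      unfolding g_def by (rule AE_I2) (rule difference_quotient_tendsto[OF test_function_has_derivative[OF F] T(1) T0])
    show "AE x in lborel. norm (g k x) \<le> L * norm h * indicator (cball 0 (R + norm h)) x" for k
    proof (rule AE_I2)
      fix x
      show "norm (g k x) \<le> L * norm h * indicator (cball 0 (R + norm h)) x"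
      proof (cases "norm x \<le> R + norm h")
        case True
        have "norm (F (x + T k *\<^sub>R h) - F x) \<le> L * (T k * norm h)"
          using L(2)[of "x + T k *\<^sub>R h" x] T(1)[of k] by simp
        moreover have "norm (g k x) = norm (F (x + T k *\<^sub>R h) - F x) / T k"
          using T(1)[of k] by (simp add: g_def divide_inverse_commute)
        ultimately have "norm (g k x) \<le> L * norm h"
          using T(1)[of k] by (simp add: pos_divide_le_eq mult_ac)
        then show ?thesis using True by simp
      next
        case False
        have "T k * norm h \<le> norm h" using T[of k] by (simp add: mult_left_le_one_le)
        then have "R < norm (x + T k *\<^sub>R h)"
          using False norm_triangle_ineq4[of "x + T k *\<^sub>R h" "T k *\<^sub>R h"] T(1)[of k] by simp
        moreover have "R < norm x" using False norm_ge_zero[of h] by linarith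
        ultimately have "F (x + T k *\<^sub>R h) = 0" "F x = 0" using R by (meson not_le)+
        then show ?thesis using L by (simp add: g_def)
      qed
    qed
  qed
  moreover have "(LINT x|lborel. g k x) = 0" for k
  proof -
    have "integrable lborel (\<lambda>x. F (x + T k *\<^sub>R h))"
    proof (rule integrable_continuous_compact_support[of _ "cball 0 (R + norm h)"])
      show "continuous_on UNIV (\<lambda>x. F (x + T k *\<^sub>R h))"
        by (intro continuous_on_compose2[OF cF] continuous_intros) auto
      show "F (x + T k *\<^sub>R h) = 0" if "x \<notin> cball 0 (R + norm h)" for x
      proof -
        have "T k * norm h \<le> norm h" using T[of k] by (simp add: mult_left_le_one_le)
        then have "R < norm (x + T k *\<^sub>R h)"
          using that norm_triangle_ineq4[of "x + T k *\<^sub>R h" "T k *\<^sub>R h"] T(1)[of k] by simp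
        then show ?thesis using R by (meson not_le)
      qed
    qed simp
    then show ?thesis using integral_lborel_translate[of F "T k *\<^sub>R h"]
      by (simp add: g_def Bochner_Integration.integral_diff intF)
  qed
  ultimately show ?thesis by (simp add: LIMSEQ_const_iff)
qed

text \<open>Integration by parts is the vanishing integral of the derivative of the product
  \<open>\<phi> * \<psi>\<close>; the constant sequence \<open>\<phi>\<close> serves as
  approximating sequence.\<close>

lemma test_function_W12_0:
  fixes \<phi> :: "real^'n \<Rightarrow> complex"
  assumes \<phi>: "\<phi> \<in> test_functions D" and D: "open D"
  shows "W12_0 D \<phi> (gradient \<phi>)"
proof -
  have Db: "D \<in> sets borel" using D by simp
  have L2: "\<phi> \<in> Lp_space 2 D" "gradient \<phi> \<in> Lp_space 2 D"
    unfolding Lp_space_def using test_function_measurable[OF \<phi>] test_function_finite(1,2)[OF \<phi>, of 2]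
    by (auto simp: borel_measurable_lebesgue_on Lp_norm_eq[OF _ Db] test_function_vanishes[OF \<phi>] ennpow_def)
  have parts: "(LINT x|lebesgue_on D. \<phi> x * gradient \<psi> x $ i) = - (LINT x|lebesgue_on D. gradient \<phi> x $ i * \<psi> x)"
    if \<psi>: "\<psi> \<in> test_functions D" for \<psi> i
  proof -
    define K where "K = closure {x. \<phi> x \<noteq> 0}"
    have K: "compact K" unfolding K_def using \<phi> by (simp add: test_functions_def)
    have cd: "continuous_on UNIV (\<lambda>x. frechet_derivative f (at x) h)" "continuous_on UNIV f" if "f \<in> test_functions D" for f h
      using test_functions_differentiable[OF that] by auto
    have c1: "continuous_on UNIV (\<lambda>x. \<phi> x * gradient \<psi> x $ i)" and c2: "continuous_on UNIV (\<lambda>x. gradient \<phi> x $ i * \<psi> x)"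
      unfolding gradient_def vec_lambda_beta
      by (rule continuous_on_mult[OF cd(2)[OF \<phi>] cd(1)[OF \<psi>]], rule continuous_on_mult[OF cd(1)[OF \<phi>] cd(2)[OF \<psi>]])
    have v: "\<phi> x = 0" "gradient \<phi> x = 0" if "x \<notin> K" for x
      using that closure_subset[of "{x. \<phi> x \<noteq> 0}"] frechet_derivative_vanishes[OF that[unfolded K_def]]
      by (auto simp: gradient_def vec_eq_iff K_def)
    have i1: "integrable lborel (\<lambda>x. \<phi> x * gradient \<psi> x $ i)"
      by (rule integrable_continuous_compact_support[OF c1 K]) (simp add: v)
    have i2: "integrable lborel (\<lambda>x. gradient \<phi> x $ i * \<psi> x)"
      by (rule integrable_continuous_compact_support[OF c2 K]) (simp add: v)
    have "frechet_derivative (\<lambda>x. \<phi> x * \<psi> x) (at x) (axis i 1) = \<phi> x * gradient \<psi> x $ i + gradient \<phi> x $ i * \<psi> x" for x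
      by (simp add: gradient_def frechet_derivative_at[OF has_derivative_mult[OF
        test_function_has_derivative[OF \<phi>] test_function_has_derivative[OF \<psi>]], symmetric])
    then have "(LINT x|lborel. \<phi> x * gradient \<psi> x $ i) + (LINT x|lborel. gradient \<phi> x $ i * \<psi> x) = 0"
      using integral_derivative_eq_0[OF test_functions_mult[OF \<phi> \<psi>], of "axis i 1"]
      by (simp add: Bochner_Integration.integral_add[OF i1 i2])
    moreover have "(LINT x|lebesgue_on D. \<phi> x * gradient \<psi> x $ i) = (LINT x|lborel. \<phi> x * gradient \<psi> x $ i)"
      "(LINT x|lebesgue_on D. gradient \<phi> x $ i * \<psi> x) = (LINT x|lborel. gradient \<phi> x $ i * \<psi> x)"
      by (rule integral_lebesgue_on[OF borel_measurable_continuous_onI[OF c1] Db];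
          simp add: test_function_vanishes[OF \<phi>])
         (rule integral_lebesgue_on[OF borel_measurable_continuous_onI[OF c2] Db];
          simp add: test_function_vanishes[OF \<phi>])
    ultimately show ?thesis by (simp add: add_eq_0_iff2)
  qed
  have z: "Lp_norm 2 D (\<lambda>x. 0 :: 'b::euclidean_space) = 0" by (simp add: Lp_norm_def ennpow_def)
  show ?thesis unfolding W12_0_def W12_def
    using L2 parts \<phi> by (auto intro!: exI[of _ "\<lambda>_. \<phi>"] simp: z)
qed

text \<open>The supremum becomes an inequality between integrals in which \<open>A\<close> may be
  any bound for the Dirichlet integral, here the one inherited from the energies.\<close>

lemma sobolev_constant_test_function:
  fixes \<phi> :: "real^'n \<Rightarrow> complex"
  assumes \<phi>: "\<phi> \<in> test_functions \<Omega>" and \<Omega>: "open \<Omega>"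
    and K: "sobolev_constant q \<Omega> = ennreal \<kappa>" "0 \<le> \<kappa>"
    and q: "2 * q \<noteq> \<infinity>" "0 < enn2real (2 * q)" and A: "(\<integral>\<^sup>+x. ennreal ((norm (gradient \<phi> x))\<^sup>2) \<partial>lborel) \<le> ennreal A" "0 \<le> A"
  shows "(\<integral>\<^sup>+x. ennreal (norm (\<phi> x) powr enn2real (2 * q)) \<partial>lborel) \<le> ennreal ((\<kappa> * sqrt A) powr enn2real (2 * q))"
proof -
  define e where "e = enn2real (2 * q)"
  have e: "0 < e" using q by (simp add: e_def)
  have Ob: "\<Omega> \<in> sets borel" using \<Omega> by simp
  define i where "i = enn2real (\<integral>\<^sup>+x. ennreal (norm (\<phi> x) powr e) \<partial>lborel)"
  have i: "0 \<le> i" "(\<integral>\<^sup>+x. ennreal (norm (\<phi> x) powr e) \<partial>lborel) = ennreal i"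
    using test_function_finite(1)[OF \<phi> e] by (simp_all add: i_def)
  define g where "g = enn2real (\<integral>\<^sup>+x. ennreal ((norm (gradient \<phi> x))\<^sup>2) \<partial>lborel)"
  have g: "0 \<le> g" "(\<integral>\<^sup>+x. ennreal ((norm (gradient \<phi> x))\<^sup>2) \<partial>lborel) = ennreal g"
    using test_function_finite(3)[OF \<phi> e] by (simp_all add: g_def)
  have X: "Lp_norm (2 * q) \<Omega> \<phi> = ennreal (i powr (1 / e))"
    using q i Lp_norm_eq[OF test_function_measurable(1)[OF \<phi>] Ob test_function_vanishes(1)[OF \<phi>], of "2 * q"]
    by (simp add: e_def[symmetric] ennpow_ennreal)
  have Y: "Lp_norm 2 \<Omega> (gradient \<phi>) = ennreal (sqrt g)"
    using g Lp_norm_eq[OF test_function_measurable(2)[OF \<phi>] Ob test_function_vanishes(3)[OF \<phi>], of 2]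
    by (simp add: ennpow_ennreal powr_numeral powr_half_sqrt)
  have "i \<le> (\<kappa> * sqrt A) powr e"
  proof (cases "i = 0")
    case False
    then have i0: "0 < i" using i by simp
    have "nontrivial_on \<Omega> \<phi>" unfolding nontrivial_on_def
    proof
      assume "AE x in lebesgue_on \<Omega>. \<phi> x = 0"
      then have "(\<integral>\<^sup>+x. ennreal (norm (\<phi> x) powr e) \<partial>lebesgue_on \<Omega>) = (\<integral>\<^sup>+x. 0 \<partial>lebesgue_on \<Omega>)"
        by (intro nn_integral_cong_AE) auto
      moreover have "(\<integral>\<^sup>+x. ennreal (norm (\<phi> x) powr e) \<partial>lebesgue_on \<Omega>) = ennreal i"
        using test_function_measurable(1)[OF \<phi>] Ob
        by (subst nn_integral_lebesgue_on) (auto simp: test_function_vanishes(1)[OF \<phi>] i)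
      ultimately show False using i0 by simp
    qed
    then have le: "ennreal (i powr (1 / e)) / ennreal (sqrt g) \<le> ennreal \<kappa>"
      unfolding K(1)[symmetric] sobolev_constant_def X[symmetric] Y[symmetric]
      using test_function_W12_0[OF \<phi> \<Omega>] by (intro Sup_upper) blast
    \<comment> \<open>A positive number divided by 0 is infinite in \<open>ennreal\<close>, which
      the finite constant \<open>\<kappa>\<close> excludes.\<close>
    have "g \<noteq> 0"
    proof
      assume "g = 0"
      then have "ennreal (i powr (1 / e)) / ennreal (sqrt g) = \<infinity>"
        using i0 by (simp add: ennreal_divide_zero)
      then show False using le by (simp add: top_unique)
    qed
    then have g0: "0 < sqrt g" using g by simp
    then have "ennreal (i powr (1 / e) / sqrt g) \<le> ennreal \<kappa>" using le by (simp add: divide_ennreal)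
    then have "i powr (1 / e) / sqrt g \<le> \<kappa>" using K by (simp add: ennreal_le_iff)
    then have "i powr (1 / e) \<le> \<kappa> * sqrt g" using g0 by (simp add: pos_divide_le_eq)
    also have "\<dots> \<le> \<kappa> * sqrt A" using A g K by (intro mult_left_mono) (auto simp: ennreal_le_iff)
    finally have "(i powr (1 / e)) powr e \<le> (\<kappa> * sqrt A) powr e" using e by (intro powr_mono2) auto
    then show ?thesis using e i0 by (simp add: powr_powr)
  qed simp
  then show ?thesis using i by (simp add: e_def ennreal_leI)
qed

subsection \<open>Comparison with the ball\<close>

lemma nn_integral_lborel_affine:
  fixes g :: "'a::euclidean_space \<Rightarrow> ennreal"
  assumes [measurable]: "g \<in> borel_measurable borel" and l: "0 < l"
  shows "(\<integral>\<^sup>+x. g (l *\<^sub>R (x - c)) \<partial>lborel) = ennreal (l powr - real DIM('a)) * (\<integral>\<^sup>+x. g x \<partial>lborel)"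
proof -
  have "(\<integral>\<^sup>+x. g (l *\<^sub>R (x + - c)) \<partial>lborel) = (\<integral>\<^sup>+x. g (l *\<^sub>R x) \<partial>lborel)"
    by (rule nn_integral_lborel_translate) measurable
  also have "\<dots> = ennreal (l powr - real DIM('a)) * (\<integral>\<^sup>+x. g x \<partial>lborel)"
    by (rule nn_integral_lborel_scale[OF _ l]) measurable
  finally show ?thesis by simp
qed

text \<open>Each of the two integration variables contributes one Jacobian, and the scale
  \<open>t\<close> becomes \<open>l * t\<close>.\<close>

lemma energy_affine:
  fixes v :: "'a::euclidean_space \<Rightarrow> real"
  assumes [measurable]: "v \<in> borel_measurable borel" and l: "0 < l"
  shows "energy t (\<lambda>x. v (l *\<^sub>R (x - c))) =
    ennreal (l powr - real DIM('a)) * (ennreal (l powr - real DIM('a)) * energy (l * t) v)"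
proof -
  have [measurable]: "ball (0::'a) s \<in> sets borel" for s by simp
  define H where "H x y = ennreal (indicat_real (ball 0 (l * t)) (x - y) * (norm (v x - v y))\<^sup>2)" for x y
  have [measurable]: "(\<lambda>z. v (fst z)) \<in> borel_measurable (borel \<Otimes>\<^sub>M borel)"
    "(\<lambda>z. v (snd z)) \<in> borel_measurable (borel \<Otimes>\<^sub>M borel)" by measurable
  have Hm[measurable]: "case_prod H \<in> borel_measurable (borel \<Otimes>\<^sub>M borel)"
    unfolding H_def by measurable
  have Hx[measurable]: "H x \<in> borel_measurable borel" for x
    using measurable_Pair2[OF Hm, of x] by simp
  have H: "ennreal (indicat_real (ball 0 t) (x - y) * (norm (v (l *\<^sub>R (x - c)) - v (l *\<^sub>R (y - c))))\<^sup>2)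
      = H (l *\<^sub>R (x - c)) (l *\<^sub>R (y - c))" for x y
  proof -
    have "norm (l *\<^sub>R (x - c) - l *\<^sub>R (y - c)) = l * norm (x - y)"
      using l by (simp flip: scaleR_diff_right)
    then show ?thesis using l by (simp add: H_def indicator_def)
  qed
  have "energy t (\<lambda>x. v (l *\<^sub>R (x - c))) =
      (\<integral>\<^sup>+x. ennreal (l powr - real DIM('a)) * (\<integral>\<^sup>+y. H (l *\<^sub>R (x - c)) y \<partial>lborel) \<partial>lborel)"
    unfolding energy_def H by (simp add: nn_integral_lborel_affine[OF _ l])
  also have "\<dots> = ennreal (l powr - real DIM('a)) * (\<integral>\<^sup>+x. \<integral>\<^sup>+y. H (l *\<^sub>R (x - c)) y \<partial>lborel \<partial>lborel)"
    by (rule nn_integral_cmult) measurable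
  also have "(\<integral>\<^sup>+x. \<integral>\<^sup>+y. H (l *\<^sub>R (x - c)) y \<partial>lborel \<partial>lborel) =
      ennreal (l powr - real DIM('a)) * (\<integral>\<^sup>+x. \<integral>\<^sup>+y. H x y \<partial>lborel \<partial>lborel)"
    by (rule nn_integral_lborel_affine[OF _ l]) measurable
  finally show ?thesis by (simp add: energy_def H_def)
qed

text \<open>The complement of the compact support in \<open>D\<close> is open. Were it empty,
  \<open>D\<close> would be closed as well as open, hence the whole space by connectedness, against
  boundedness. The strict inequality is the room for mollification.\<close>

lemma test_function_support_measure:
  assumes \<phi>: "\<phi> \<in> test_functions D" and D: "open D" "connected D" "D \<noteq> {}" "bounded D"
  shows "emeasure lborel {x. \<phi> x \<noteq> 0} < emeasure lborel D"
proof -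
  define K where "K = closure {x. \<phi> x \<noteq> 0}"
  have K: "compact K" "K \<subseteq> D" using \<phi> by (auto simp: test_functions_def K_def)
  have Kb: "K \<in> sets lborel" using compact_imp_closed[OF K(1)] by simp
  have op: "open (D - K)" using D(1) compact_imp_closed[OF K(1)] by (rule open_Diff)
  then have Db: "D - K \<in> sets lborel" by simp
  have "D - K \<noteq> {}"
  proof
    assume "D - K = {}"
    then have "D = K" using K by blast
    then have "closed D" using K compact_imp_closed by blast
    then have "D = UNIV" using D clopen by blast
    then show False using D not_bounded_UNIV by blast
  qed
  then have "\<not> negligible (D - K)" by (rule open_not_negligible[OF op])
  then have "emeasure lborel (D - K) \<noteq> 0"
    using Db by (auto simp: negligible_iff_null_sets null_sets_completion_iff null_sets_def)
  moreover have "emeasure lborel K \<noteq> \<infinity>" using emeasure_compact_finite[OF K(1)] by auto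
  moreover have "emeasure lborel K + emeasure lborel (D - K) = emeasure lborel (K \<union> (D - K))"
    by (rule plus_emeasure[OF Kb Db]) auto
  moreover have "K \<union> (D - K) = D" using K by blast
  ultimately have "emeasure lborel K < emeasure lborel D"
    by (metis add.right_neutral ennreal_add_left_cancel_less not_gr_zero)
  moreover have "emeasure lborel {x. \<phi> x \<noteq> 0} \<le> emeasure lborel K"
    by (rule emeasure_mono[OF _ Kb]) (simp add: K_def closure_subset)
  ultimately show ?thesis by simp
qed

text \<open>The radial replacement reduces the bound to radially decreasing functions, for which the
  dyadic estimate holds. The value of \<open>S\<close> is immaterial: its finiteness serves the case
  of an infinite constant of the ball.\<close>

lemma finite_sobolev_constant:
  assumes D: "bounded D" and e: "0 < e" "e * (real CARD('n::finite) / 2 - 1) < real CARD('n)"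
  obtains S where "0 \<le> S" "\<And>(\<phi> :: real^'n \<Rightarrow> complex) A. \<lbrakk>\<phi> \<in> test_functions D; 0 \<le> A;
      (\<integral>\<^sup>+x. ennreal ((norm (gradient \<phi> x))\<^sup>2) \<partial>lborel) \<le> ennreal A\<rbrakk>
    \<Longrightarrow> (\<integral>\<^sup>+x. ennreal (norm (\<phi> x) powr e) \<partial>lborel) \<le> ennreal ((S * sqrt A) powr e)"
proof -
  obtain R where R: "0 < R" "\<forall>x\<in>D. norm x \<le> R"
    using D unfolding bounded_pos by blast
  have DR: "D \<subseteq> cball 0 R" using R(2) by auto
  show ?thesis
  proof (rule radial_sobolev[OF e R(1)])
    fix C :: real assume C: "0 \<le> C" and Cb: "\<And>v G. \<lbrakk>\<And>x y :: real^'n. norm x < norm y \<Longrightarrow> v y \<le> v x; v \<in> borel_measurable borel;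
      \<And>x. 0 \<le> v x; \<And>x. R < norm x \<Longrightarrow> v x = 0; 0 \<le> G;
      \<And>t. 0 < t \<Longrightarrow> energy t v \<le> ennreal (G\<^sup>2) * ball_moment TYPE('n) t\<rbrakk>
    \<Longrightarrow> (\<integral>\<^sup>+x. ennreal (v x powr e) \<partial>lborel) \<le> ennreal (C * G powr e)"
  show ?thesis
  proof (rule that[of "C powr (1 / e)"])
    fix \<phi> :: "real^'n \<Rightarrow> complex" and A
    assume \<phi>: "\<phi> \<in> test_functions D" and A: "0 \<le> A"
      and le: "(\<integral>\<^sup>+x. ennreal ((norm (gradient \<phi> x))\<^sup>2) \<partial>lborel) \<le> ennreal A"
    obtain v L where v: "0 \<le> L" "\<And>x y. \<bar>v x - v y\<bar> \<le> L * norm (x - y)" "\<And>x. 0 \<le> v x"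
      "\<And>x :: real^'n. R < norm x \<Longrightarrow> v x = 0"
      "(\<integral>\<^sup>+x. ennreal (norm (\<phi> x) powr e) \<partial>lborel) \<le> (\<integral>\<^sup>+x. ennreal (v x powr e) \<partial>lborel)"
      "\<And>t. energy t v \<le> (\<integral>\<^sup>+x. ennreal ((norm (gradient \<phi> x))\<^sup>2) \<partial>lborel) * ball_moment TYPE('n) t"
      "\<And>x y. norm x < norm y \<Longrightarrow> v y \<le> v x"
      by (rule test_function_radial_rearrangement[OF \<phi> DR less_imp_le[OF R(1)] e(1)]) (rule that; assumption)
    have "(\<integral>\<^sup>+x. ennreal (v x powr e) \<partial>lborel) \<le> ennreal (C * sqrt A powr e)"
    proof (rule Cb)
      show "v \<in> borel_measurable borel"
        by (rule borel_measurable_continuous_onI[OF lipschitz_imp_continuous[OF v(2)]])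
      show "energy t v \<le> ennreal ((sqrt A)\<^sup>2) * ball_moment TYPE('n) t" for t
        using A order_trans[OF v(6)[of t] mult_right_mono[OF le zero_le]] by simp
    qed (use A v in auto)
    also have "C * sqrt A powr e = (C powr (1 / e) * sqrt A) powr e"
      using C A e by (simp add: powr_mult powr_powr)
    finally show "(\<integral>\<^sup>+x. ennreal (norm (\<phi> x) powr e) \<partial>lborel) \<le> ennreal ((C powr (1 / e) * sqrt A) powr e)"
      using v(5) by (rule order_trans[rotated])
  qed simp
  qed
qed

text \<open>The radial replacement of \<open>\<phi>\<close>, shrunk by the factor \<open>l\<close>
  and centred at \<open>c\<close>, is supported strictly inside the ball of volume 1. Its
  mollifications are test functions there, their Dirichlet integrals are recovered from the energies
  at small scales, and Fatou brings the power integral back.\<close>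

theorem sobolev_comparison:
  fixes \<phi> :: "real^'n \<Rightarrow> complex"
  assumes D: "open D" "connected D" "D \<noteq> {}" "bounded D" and \<phi>: "\<phi> \<in> test_functions D"
    and B: "measure lebesgue (ball (c :: real^'n) \<rho>) = 1"
    and K: "sobolev_constant q (ball c \<rho>) = ennreal \<kappa>" "0 \<le> \<kappa>"
    and q: "2 * q \<noteq> \<infinity>" "enn2real (2 * q) = e" "0 < e"
    and A: "0 \<le> A" "(\<integral>\<^sup>+x. ennreal ((norm (gradient \<phi> x))\<^sup>2) \<partial>lborel) \<le> ennreal A"
  shows "(\<integral>\<^sup>+x. ennreal (norm (\<phi> x) powr e) \<partial>lborel) \<le>
    ennreal ((\<kappa> * measure lebesgue D powr (1 / e + 1 / real CARD('n) - 1 / 2) * sqrt A) powr e)"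
proof -
  define N where "N = real CARD('n)"
  have N: "0 < N" by (simp add: N_def)
  define \<omega> where "\<omega> = unit_ball_vol N"
  have \<omega>: "0 < \<omega>" by (simp add: \<omega>_def N_def)
  have vol: "emeasure lborel (ball a s) = ennreal (\<omega> * s powr N)" if "0 < s" for a :: "real^'n" and s
    using that by (simp add: emeasure_ball \<omega>_def N_def powr_realpow)
  have \<rho>: "0 < \<rho>" using B by (cases "0 < \<rho>") (auto simp: ball_empty)
  have \<omega>\<rho>: "\<omega> * \<rho> powr N = 1"
    using B vol[OF \<rho>, of c] \<omega> by (simp add: measure_completion measure_def)
  define V where "V = measure lebesgue D"
  define M where "M = enn2real (emeasure lborel {x. \<phi> x \<noteq> 0})"
  have Db: "D \<in> sets lborel" using D by simp
  have Dfin: "emeasure lborel D < \<infinity>" using emeasure_bounded_finite[OF D(4)] by simp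
  have V: "emeasure lborel D = ennreal V"
    using Db Dfin by (simp add: V_def measure_completion emeasure_eq_ennreal_measure less_top)
  have lt: "emeasure lborel {x. \<phi> x \<noteq> 0} < ennreal V"
    using test_function_support_measure[OF \<phi> D] unfolding V .
  then have "emeasure lborel {x. \<phi> x \<noteq> 0} < top" by (rule less_trans) simp
  then have M1: "emeasure lborel {x. \<phi> x \<noteq> 0} = ennreal M" by (simp add: M_def)
  have M2: "0 \<le> M" by (simp add: M_def)
  have "M < V" using lt unfolding M1 using M2 by (simp add: ennreal_less_iff)
  with M1 M2 have M: "emeasure lborel {x. \<phi> x \<noteq> 0} = ennreal M" "0 \<le> M" "M < V" by simp_all
  define l where "l = V powr (1 / N)"
  have l: "0 < l" using M by (simp add: l_def)
  \<comment> \<open>The radius of a ball of volume \<open>M\<close>; it is below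
    \<open>l * \<rho>\<close> because \<open>M < V\<close>.\<close>
  define r1 where "r1 = \<rho> * M powr (1 / N)"
  have r1: "0 \<le> r1" "r1 < l * \<rho>"
    using \<rho> M N by (auto simp: r1_def l_def mult.commute intro!: powr_less_mono2)
  obtain R where R: "0 < R" "\<forall>x\<in>D. norm x \<le> R"
    using D(4) unfolding bounded_pos by blast
  have DR: "D \<subseteq> cball 0 R" using R(2) by auto
  obtain v L where v: "0 \<le> L" "\<And>x y. \<bar>v x - v y\<bar> \<le> L * norm (x - y)" "\<And>x. 0 \<le> v x"
    "emeasure lborel {x. 0 < v x} \<le> emeasure lborel {x. \<phi> x \<noteq> 0}"
    "(\<integral>\<^sup>+x. ennreal (norm (\<phi> x) powr e) \<partial>lborel) \<le> (\<integral>\<^sup>+x. ennreal (v x powr e) \<partial>lborel)"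
    "\<And>t. energy t v \<le> (\<integral>\<^sup>+x. ennreal ((norm (gradient \<phi> x))\<^sup>2) \<partial>lborel) * ball_moment TYPE('n) t"
    "\<And>x y :: real^'n. norm x < norm y \<Longrightarrow> v y \<le> v x"
    by (rule test_function_radial_rearrangement[OF \<phi> DR less_imp_le[OF R(1)] q(3)]) (rule that; assumption)
  have vc: "continuous_on UNIV v" by (rule lipschitz_imp_continuous[OF v(2)])
  have vm[measurable]: "v \<in> borel_measurable borel" by (rule borel_measurable_continuous_onI[OF vc])
  have vsupp: "v x = 0" if "r1 < norm x" for x
  proof (rule ccontr)
    assume "v x \<noteq> 0"
    then have pos: "0 < v x" using v(3)[of x] by simp
    have s: "0 < norm x" using that r1 by linarith
    \<comment> \<open>A radially decreasing function that is positive at \<open>x\<close> is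
      positive on the whole ball of radius \<open>norm x\<close>, whose volume is therefore at most
      \<open>M\<close>.\<close>
    have "ball 0 (norm x) \<subseteq> {x. 0 < v x}"
    proof
      fix y :: "real^'n" assume "y \<in> ball 0 (norm x)"
      then have "v x \<le> v y" using v(7)[of y x] by simp
      then show "y \<in> {x. 0 < v x}" using pos by simp
    qed
    then have "ennreal (\<omega> * norm x powr N) \<le> emeasure lborel {x. 0 < v x}"
      unfolding vol[OF s, of 0, symmetric] by (rule emeasure_mono) simp
    also have "\<dots> \<le> ennreal M" using v(4) M by simp
    finally have "\<omega> * norm x powr N \<le> M" using M by simp
    also have "M = \<omega> * (\<rho> powr N * M)" using \<omega>\<rho> by simp
    finally have "norm x powr N \<le> \<rho> powr N * M" using \<omega> by simp
    then have "(norm x powr N) powr (1 / N) \<le> (\<rho> powr N * M) powr (1 / N)"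
      using N by (intro powr_mono2) auto
    also have "\<dots> = r1" using \<rho> M N by (simp add: powr_mult powr_powr r1_def)
    finally have "norm x \<le> r1" using N by (simp add: powr_powr)
    then show False using that by simp
  qed
  define w where "w x = v (l *\<^sub>R (x - c))" for x
  have wlip: "\<bar>w x - w y\<bar> \<le> (L * l) * norm (x - y)" for x y
    using v(2)[of "l *\<^sub>R (x - c)" "l *\<^sub>R (y - c)"] l by (simp add: w_def mult.assoc flip: scaleR_diff_right)
  have Ll: "0 \<le> L * l" using v l by simp
  have wsupp: "w x = 0" if "r1 / l < norm (x - c)" for x
    using that l unfolding w_def by (intro vsupp) (simp add: pos_divide_less_eq mult.commute)
  \<comment> \<open>Half of the gap between the support of \<open>w\<close> and the boundary of the
    ball: mollification at scale at most \<open>\<delta>\<close> keeps the support compact inside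
    the ball.\<close>
  define \<delta> where "\<delta> = (\<rho> - r1 / l) / 2"
  have \<delta>: "0 < \<delta>" "r1 / l + \<delta> < \<rho>" using r1 l by (auto simp: \<delta>_def field_simps)
  \<comment> \<open>\<open>X\<close> is \<open>A\<close> transformed like a Dirichlet integral: two
    factors \<open>l\<close> from the gradient, \<open>l powr - N\<close> from the Jacobian. For
    energies the same power arises as \<open>- N - N + (N + 2)\<close>.\<close>
  define X where "X = l powr (2 - N) * A"
  have X: "0 \<le> X" using A by (simp add: X_def)
  have wen: "energy t w \<le> ennreal X * ball_moment TYPE('n) t" if t: "0 < t" for t
  proof -
    have "energy (l * t) v \<le> ennreal A * ball_moment TYPE('n) (l * t)"
      using v(6)[of "l * t"] A by (meson mult_right_mono order_trans zero_le)
    then have "energy t w \<le> ennreal (l powr - N) * (ennreal (l powr - N) * (ennreal A * ball_moment TYPE('n) (l * t)))"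
      unfolding w_def energy_affine[OF vm l] N_def by (simp add: mult_left_mono)
    also have "\<dots> = ennreal (l powr - N * (l powr - N * (A * (l * t) powr (N + 2)))) * ball_moment TYPE('n) 1"
      using A l t by (subst ball_moment_scale) (simp_all add: N_def ennreal_mult mult.assoc)
    also have "l powr - N * (l powr - N * (A * (l * t) powr (N + 2))) = X * t powr (N + 2)"
    proof -
      have "l powr - N * (l powr - N * l powr (N + 2)) = l powr (2 - N)" by (simp flip: powr_add)
      then show ?thesis using l t by (simp add: X_def powr_mult mult_ac)
    qed
    also have "ennreal (X * t powr (N + 2)) * ball_moment TYPE('n) 1 = ennreal X * ball_moment TYPE('n) t"
      using X t by (subst ball_moment_scale[OF t]) (simp add: N_def ennreal_mult mult.assoc)
    finally show ?thesis .
  qed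
  define Y where "Y = (\<kappa> * sqrt X) powr e"
  have approx: "\<exists>f. (\<forall>x. \<bar>f x - w x\<bar> \<le> (L * l) * (\<delta> / real (Suc k))) \<and> f \<in> borel_measurable borel \<and>
      (\<integral>\<^sup>+x. ennreal (\<bar>f x\<bar> powr e) \<partial>lborel) \<le> ennreal Y" for k
  proof -
    have pos: "0 < \<delta> / real (Suc k)" using \<delta> by simp
    have small: "\<delta> / real (Suc k) \<le> \<delta>" using \<delta> by (simp add: field_simps)
    obtain f where f: "\<And>k. Ck k f" "\<And>x. r1 / l + \<delta> / real (Suc k) < norm (x - c) \<Longrightarrow> f x = 0"
      "\<And>x. \<bar>f x - w x\<bar> \<le> (L * l) * (\<delta> / real (Suc k))" "\<And>t. energy t f \<le> energy t w"
      by (rule exists_smooth_approximation[where r = "r1 / l" and c = c, OF wlip Ll wsupp pos])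
        (assumption, (rule that; assumption))
    define F where "F x = complex_of_real (f x)" for x
    have "{x. F x \<noteq> 0} \<subseteq> cball c (r1 / l + \<delta>)"
      using f(2) small by (force simp: F_def dist_norm norm_minus_commute not_le)
    then have cl: "closure {x. F x \<noteq> 0} \<subseteq> cball c (r1 / l + \<delta>)" by (rule closure_minimal) simp
    have "compact (closure {x. F x \<noteq> 0})"
      using bounded_subset[OF bounded_cball cl] by (simp only: compact_eq_bounded_closed closed_closure)
    moreover have "closure {x. F x \<noteq> 0} \<subseteq> ball c \<rho>" using cl \<delta>(2) by fastforce
    moreover have "Ck k F" for k unfolding F_def by (rule Ck_bounded_linear[OF bounded_linear_of_real f(1)])
    ultimately have F: "F \<in> test_functions (ball c \<rho>)" by (simp add: test_functions_def)
    have "energy t F = energy t f" for t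
      unfolding energy_def F_def by (simp flip: of_real_diff)
    then have "energy t F \<le> ennreal X * ball_moment TYPE('n) t" if "0 < t" for t
      using f(4)[of t] wen[OF that] by (simp add: order_trans)
    then have "(\<integral>\<^sup>+x. ennreal ((norm (gradient F x))\<^sup>2) \<partial>lborel) \<le> ennreal X"
      by (rule gradient_le_energy[OF test_functions_differentiable(1,2)[OF F]])
    then have "(\<integral>\<^sup>+x. ennreal (norm (F x) powr e) \<partial>lborel) \<le> ennreal Y"
      using sobolev_constant_test_function[OF F open_ball K q(1) _ _ X] q by (simp add: Y_def)
    moreover have "f \<in> borel_measurable borel" using f(1)[of 0] by (auto intro: borel_measurable_continuous_onI)
    ultimately show ?thesis using f(3) by (intro exI[of _ f]) (simp add: F_def)
  qed
  then obtain f where f: "\<And>k x. \<bar>f k x - w x\<bar> \<le> (L * l) * (\<delta> / real (Suc k))"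
    and fm[measurable]: "\<And>k. f k \<in> borel_measurable borel"
    and fY: "\<And>k. (\<integral>\<^sup>+x. ennreal (\<bar>f k x\<bar> powr e) \<partial>lborel) \<le> ennreal Y" by metis
  have lim: "(\<lambda>k. f k x) \<longlonglongrightarrow> w x" for x
  proof (rule LIM_zero_cancel, rule tendsto_rabs_zero_cancel, rule tendsto_sandwich[of "\<lambda>_. 0"])
    show "\<forall>\<^sub>F k in sequentially. \<bar>f k x - w x\<bar> \<le> (L * l) * (\<delta> / real (Suc k))" using f by simp
    show "(\<lambda>k. (L * l) * (\<delta> / real (Suc k))) \<longlonglongrightarrow> 0"
      using tendsto_mult[OF tendsto_const[of "L * l * \<delta>"] LIMSEQ_inverse_real_of_nat] by (simp add: divide_inverse mult.assoc)
  qed auto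
  have "ennreal (l powr - N) * (\<integral>\<^sup>+x. ennreal (v x powr e) \<partial>lborel) = (\<integral>\<^sup>+x. ennreal (w x powr e) \<partial>lborel)"
    using nn_integral_lborel_affine[OF _ l, of "\<lambda>x. ennreal (v x powr e)" c] by (simp add: w_def N_def)
  also have "\<dots> = (\<integral>\<^sup>+x. liminf (\<lambda>k. ennreal (\<bar>f k x\<bar> powr e)) \<partial>lborel)"
  proof (rule nn_integral_cong)
    fix x
    have "(\<lambda>k. \<bar>f k x\<bar> powr e) \<longlonglongrightarrow> \<bar>w x\<bar> powr e"
      by (rule tendsto_powr2[OF tendsto_rabs[OF lim] tendsto_const]) (simp_all add: q)
    then have "(\<lambda>k. ennreal (\<bar>f k x\<bar> powr e)) \<longlonglongrightarrow> ennreal (w x powr e)"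
      using v(3) by (intro tendsto_ennrealI) (simp add: w_def)
    then show "ennreal (w x powr e) = liminf (\<lambda>k. ennreal (\<bar>f k x\<bar> powr e))"
      by (intro lim_imp_Liminf[symmetric]) simp_all
  qed
  also have "\<dots> \<le> liminf (\<lambda>k. \<integral>\<^sup>+x. ennreal (\<bar>f k x\<bar> powr e) \<partial>lborel)"
    by (rule nn_integral_liminf) measurable
  also have "\<dots> \<le> ennreal Y" by (rule Liminf_le) (simp_all add: fY)
  \<comment> \<open>Multiplying by \<open>l powr N\<close> undoes the Jacobian of the
    scaling.\<close>
  finally have "ennreal (l powr N) * (ennreal (l powr - N) * (\<integral>\<^sup>+x. ennreal (v x powr e) \<partial>lborel)) \<le> ennreal (l powr N) * ennreal Y"
    by (rule mult_left_mono) simp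
  moreover have "ennreal (l powr N) * ennreal (l powr - N) = 1"
    using l by (simp flip: ennreal_mult powr_add)
  ultimately have "(\<integral>\<^sup>+x. ennreal (v x powr e) \<partial>lborel) \<le> ennreal (l powr N * Y)"
    by (simp add: ennreal_mult Y_def flip: mult.assoc)
  also have "l powr N * Y = (\<kappa> * V powr (1 / e + 1 / N - 1 / 2) * sqrt A) powr e"
  proof -
    have VN: "V powr a = l powr (N * a)" for a using N M by (simp add: l_def powr_powr)
    have "sqrt X = l powr (1 - N / 2) * sqrt A"
      using l by (simp add: X_def real_sqrt_mult powr_half_sqrt[symmetric] powr_powr diff_divide_distrib)
    then have "Y = (\<kappa> * l powr (1 - N / 2) * sqrt A) powr e" by (simp add: Y_def mult.assoc)
    moreover have "l powr N = (l powr (N / e)) powr e" using q by (simp add: powr_powr)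
    ultimately have "l powr N * Y = (l powr (N / e) * (\<kappa> * l powr (1 - N / 2) * sqrt A)) powr e"
      using K A by (simp add: powr_mult)
    also have "l powr (N / e) * (\<kappa> * l powr (1 - N / 2) * sqrt A) = \<kappa> * (l powr (N / e) * l powr (1 - N / 2)) * sqrt A"
      by simp
    also have "l powr (N / e) * l powr (1 - N / 2) = V powr (1 / e + 1 / N - 1 / 2)"
      unfolding VN powr_add[symmetric] using N by (simp add: algebra_simps)
    finally show ?thesis .
  qed
  finally show ?thesis using v(5) by (auto simp: V_def N_def intro: order_trans)
qed

subsection \<open>The equation\<close>

lemma Holder_nn_integral:
  fixes W h :: "'a \<Rightarrow> real"
  assumes [measurable]: "W \<in> borel_measurable M" "h \<in> borel_measurable M"
    and W0: "\<And>x. 0 \<le> W x" and h0: "\<And>x. 0 \<le> h x"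
    and ps: "1 < p" "1 < s" "1 / p + 1 / s = 1" and n: "0 \<le> n" and B: "0 \<le> B"
    and W: "(\<integral>\<^sup>+x. ennreal (W x powr s) \<partial>M) \<le> ennreal (n powr s)"
    and h: "(\<integral>\<^sup>+x. ennreal (h x powr p) \<partial>M) \<le> ennreal (B powr p)"
  shows "(\<integral>\<^sup>+x. ennreal (W x * h x) \<partial>M) \<le> ennreal (n * B)"
proof -
  \<comment> \<open>Young's inequality is applied after division by the bounds for the two norms.
    These may be 0, so both are enlarged by \<open>\<delta>\<close>, which tends to 0 at the
    end.\<close>
  have approx: "(\<integral>\<^sup>+x. ennreal (W x * h x) \<partial>M) \<le> ennreal ((n + \<delta>) * (B + \<delta>))" if \<delta>: "0 < \<delta>" for \<delta>
  proof -
    define a b where "a = n + \<delta>" and "b = B + \<delta>"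
    have ab: "0 < a" "0 < b" using n B \<delta> by (auto simp: a_def b_def)
    have pt: "W x * h x \<le> a * b / (s * a powr s) * W x powr s + a * b / (p * b powr p) * h x powr p" for x
    proof -
      have "(W x / a) * (h x / b) \<le> (W x / a) powr s / s + (h x / b) powr p / p"
        using ps W0 h0 ab by (intro Youngs_inequality) (auto simp: add.commute)
      then have "(a * b) * ((W x / a) * (h x / b)) \<le> (a * b) * ((W x / a) powr s / s + (h x / b) powr p / p)"
        using ab by (intro mult_left_mono) auto
      moreover have "(a * b) * ((W x / a) * (h x / b)) = W x * h x" using ab by simp
      moreover have "(a * b) * ((W x / a) powr s / s + (h x / b) powr p / p)
          = a * b / (s * a powr s) * W x powr s + a * b / (p * b powr p) * h x powr p"
        using ab W0 h0 by (simp add: powr_divide distrib_left mult_ac)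
      ultimately show ?thesis by simp
    qed
    have "(\<integral>\<^sup>+x. ennreal (W x * h x) \<partial>M) \<le>
        (\<integral>\<^sup>+x. ennreal (a * b / (s * a powr s)) * ennreal (W x powr s) + ennreal (a * b / (p * b powr p)) * ennreal (h x powr p) \<partial>M)"
    proof (rule nn_integral_mono)
      fix x
      show "ennreal (W x * h x) \<le> ennreal (a * b / (s * a powr s)) * ennreal (W x powr s) + ennreal (a * b / (p * b powr p)) * ennreal (h x powr p)"
        using pt[of x] ab ps by (simp flip: ennreal_mult ennreal_plus add: ennreal_leI)
    qed
    also have "\<dots> = ennreal (a * b / (s * a powr s)) * (\<integral>\<^sup>+x. ennreal (W x powr s) \<partial>M)
        + ennreal (a * b / (p * b powr p)) * (\<integral>\<^sup>+x. ennreal (h x powr p) \<partial>M)"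
      by (simp add: nn_integral_add nn_integral_cmult)
    also have "\<dots> \<le> ennreal (a * b / (s * a powr s)) * ennreal (a powr s) + ennreal (a * b / (p * b powr p)) * ennreal (b powr p)"
    proof (intro add_mono mult_left_mono)
      show "(\<integral>\<^sup>+x. ennreal (W x powr s) \<partial>M) \<le> ennreal (a powr s)"
        using n \<delta> ps by (intro order_trans[OF W] ennreal_leI powr_mono2) (auto simp: a_def)
      show "(\<integral>\<^sup>+x. ennreal (h x powr p) \<partial>M) \<le> ennreal (b powr p)"
        using B \<delta> ps by (intro order_trans[OF h] ennreal_leI powr_mono2) (auto simp: b_def)
    qed auto
    also have "\<dots> = ennreal (a * b)"
    proof -
      have "a * b / p + a * b / s = a * b * (1 / p + 1 / s)" by (simp only: distrib_left times_divide_eq_right mult_1_right)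
      then have "a * b / p + a * b / s = a * b" by (simp only: ps(3) mult_1_right)
      then show ?thesis using ab ps by (simp add: add.commute flip: ennreal_mult ennreal_plus)
    qed
    finally show ?thesis by (simp add: a_def b_def)
  qed
  show ?thesis
  proof (rule tendsto_lowerbound)
    have "((\<lambda>\<delta>. (n + \<delta>) * (B + \<delta>)) \<longlongrightarrow> (n + 0) * (B + 0)) (at_right 0)"
      by (intro tendsto_intros)
    then show "((\<lambda>\<delta>. ennreal ((n + \<delta>) * (B + \<delta>))) \<longlongrightarrow> ennreal (n * B)) (at_right 0)"
      by (intro tendsto_ennrealI) simp
    show "\<forall>\<^sub>F \<delta> in at_right 0. (\<integral>\<^sup>+x. ennreal (W x * h x) \<partial>M) \<le> ennreal ((n + \<delta>) * (B + \<delta>))"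
      using approx by (auto simp: eventually_at_right_field intro: exI[of _ 1])
  qed simp
qed

text \<open>The potential may have exponent \<open>\<infinity>\<close>, but then its conjugate is 1;
  the exponent on the side of the solution is therefore always a real number.\<close>

definition conjugate_exponent :: "ennreal \<Rightarrow> real \<Rightarrow> bool" where
  "conjugate_exponent r p \<longleftrightarrow> (r = \<infinity> \<and> p = 1) \<or> (r < \<infinity> \<and> 1 < p \<and> 1 < enn2real r \<and> 1 / p + 1 / enn2real r = 1)"

lemma ennpow_mono: "x \<le> y \<Longrightarrow> 0 \<le> a \<Longrightarrow> ennpow x a \<le> ennpow y a"
  by (auto simp: ennpow_def top_unique less_top intro!: ennreal_leI powr_mono2 enn2real_mono)

text \<open>For \<open>r = \<infinity>\<close> the factor \<open>W\<close> is bounded by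
  \<open>n\<close> almost everywhere; otherwise this is Hoelder's inequality.\<close>

lemma Lp_norm_product:
  fixes W h :: "'a::euclidean_space \<Rightarrow> real"
  assumes W: "W \<in> borel_measurable (lebesgue_on D)" and hm: "h \<in> borel_measurable (lebesgue_on D)"
    and W0: "\<And>x. 0 \<le> W x" and h0: "\<And>x. 0 \<le> h x"
    and r: "conjugate_exponent r p" and n: "0 \<le> n" "Lp_norm r D W = ennreal n" and B: "0 \<le> B"
    and h: "(\<integral>\<^sup>+x. ennreal (h x powr p) \<partial>lebesgue_on D) \<le> ennreal (B powr p)"
  shows "(\<integral>\<^sup>+x. ennreal (W x * h x) \<partial>lebesgue_on D) \<le> ennreal (n * B)"
  using r unfolding conjugate_exponent_def
proof (elim disjE conjE)
  assume r: "r = \<infinity>" and p: "p = 1"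
  have "AE x in lebesgue_on D. ennreal (norm (W x)) \<le> esssup (lebesgue_on D) (\<lambda>x. ennreal (norm (W x)))"
    by (rule esssup_AE)
  then have "AE x in lebesgue_on D. ennreal (W x * h x) \<le> ennreal n * ennreal (h x)"
  proof eventually_elim
    case (elim x)
    then have "ennreal (W x) \<le> ennreal n" using n r W0 by (simp add: Lp_norm_def)
    then show ?case using W0[of x] h0[of x] by (simp add: ennreal_mult mult_right_mono)
  qed
  then have "(\<integral>\<^sup>+x. ennreal (W x * h x) \<partial>lebesgue_on D) \<le> (\<integral>\<^sup>+x. ennreal n * ennreal (h x) \<partial>lebesgue_on D)"
    by (rule nn_integral_mono_AE)
  also have "\<dots> = ennreal n * (\<integral>\<^sup>+x. ennreal (h x) \<partial>lebesgue_on D)"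
    using hm by (intro nn_integral_cmult) simp
  also have "\<dots> \<le> ennreal n * ennreal B"
    using h p h0 B by (intro mult_left_mono) simp_all
  finally show ?thesis using n B by (simp add: ennreal_mult)
next
  assume r: "r < \<infinity>" and p: "1 < p" "1 < enn2real r" "1 / p + 1 / enn2real r = 1"
  define X where "X = (\<integral>\<^sup>+x. ennreal (norm (W x) powr enn2real r) \<partial>lebesgue_on D)"
  have "r \<noteq> \<infinity>" using r by simp
  then have eq: "ennpow X (1 / enn2real r) = ennreal n" using n(2) unfolding Lp_norm_def X_def by simp
  then have Xfin: "X \<noteq> \<infinity>" by (auto simp: ennpow_def)
  then have "enn2real X powr (1 / enn2real r) = n" using eq n by (simp add: ennpow_def)
  then have "n powr enn2real r = enn2real X" using p by (auto simp: powr_powr)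
  then have "X = ennreal (n powr enn2real r)" using Xfin by (simp add: less_top)
  then have W': "(\<integral>\<^sup>+x. ennreal (W x powr enn2real r) \<partial>lebesgue_on D) \<le> ennreal (n powr enn2real r)"
    using W0 by (simp add: X_def)
  show ?thesis by (rule Holder_nn_integral[OF W hm W0 h0 p n(1) B W' h])
qed

text \<open>A weighted triangle inequality for squares. The factor \<open>1 + \<delta>\<close> at
  the main term can be taken arbitrarily close to 1, so that the Sobolev constant is not enlarged in
  the limit.\<close>

lemma norm_diff_sq_le:
  fixes a b c :: "'a::real_inner"
  assumes "0 < \<delta>"
  shows "(norm (a - b))\<^sup>2 \<le> (1 + \<delta>) * (norm (c - b))\<^sup>2 + (1 + 1 / \<delta>) * (norm (a - c))\<^sup>2"
proof -
  have "0 \<le> (sqrt \<delta> * norm (c - b) - norm (a - c) / sqrt \<delta>)\<^sup>2" by simp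
  also have "\<dots> = \<delta> * (norm (c - b))\<^sup>2 - 2 * norm (c - b) * norm (a - c) + (norm (a - c))\<^sup>2 / \<delta>"
    using assms by (simp add: power2_diff power_mult_distrib power_divide)
  finally have "2 * norm (c - b) * norm (a - c) \<le> \<delta> * (norm (c - b))\<^sup>2 + (norm (a - c))\<^sup>2 / \<delta>" by simp
  moreover have "(norm (a - b))\<^sup>2 \<le> (norm (a - c) + norm (c - b))\<^sup>2"
    using norm_triangle_ineq[of "a - c" "c - b"] by (intro power_mono) auto
  ultimately show ?thesis by (simp add: power2_sum algebra_simps)
qed

section \<open>From test functions to Sobolev functions\<close>

lemma Lp_norm_2_tendsto_0:
  fixes F :: "nat \<Rightarrow> 'a::euclidean_space \<Rightarrow> 'b::real_normed_vector"
  assumes "(\<lambda>k. Lp_norm 2 D (F k)) \<longlonglongrightarrow> 0"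
  shows "(\<lambda>k. \<integral>\<^sup>+x. ennreal ((norm (F k x))\<^sup>2) \<partial>lebesgue_on D) \<longlonglongrightarrow> 0"
proof -
  define X where "X k = (\<integral>\<^sup>+x. ennreal ((norm (F k x))\<^sup>2) \<partial>lebesgue_on D)" for k
  have eq: "Lp_norm 2 D (F k) = ennpow (X k) (1 / 2)" for k by (simp add: Lp_norm_def X_def powr_numeral)
  have sq: "(ennpow x (1 / 2))\<^sup>2 = x" for x
    by (auto simp: ennpow_def ennreal_power powr_half_sqrt less_top)
  have "(\<lambda>k. (Lp_norm 2 D (F k))\<^sup>2) \<longlonglongrightarrow> 0\<^sup>2"
    unfolding power2_eq_square by (rule tendsto_mult_ennreal) (use assms in auto)
  then show ?thesis unfolding eq sq by (simp add: X_def)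
qed

text \<open>Here \<open>S\<close> is any Sobolev constant valid for test functions on
  \<open>D\<close>, so that the argument serves both the constant inherited from the ball and the
  crude one. The sequence \<open>\<phi>\<close> approximates \<open>u\<close> together with its
  gradient \<open>g\<close>.\<close>

locale sobolev_approximation =
  fixes D :: "(real^'n) set" and e S :: real and u :: "real^'n \<Rightarrow> complex" and g :: "real^'n \<Rightarrow> complex^'n"
    and \<phi> :: "nat \<Rightarrow> real^'n \<Rightarrow> complex"
  assumes D: "open D" and e: "0 < e" and S: "0 \<le> S"
    and sob: "\<And>\<psi> A. \<lbrakk>\<psi> \<in> test_functions D; 0 \<le> A; (\<integral>\<^sup>+x. ennreal ((norm (gradient \<psi> x))\<^sup>2) \<partial>lborel) \<le> ennreal A\<rbrakk>
      \<Longrightarrow> (\<integral>\<^sup>+x. ennreal (norm (\<psi> x) powr e) \<partial>lborel) \<le> ennreal ((S * sqrt A) powr e)"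
    and um: "u \<in> borel_measurable (lebesgue_on D)" and gm: "g \<in> borel_measurable (lebesgue_on D)"
    and gfin: "(\<integral>\<^sup>+x. ennreal ((norm (g x))\<^sup>2) \<partial>lebesgue_on D) < \<infinity>"
    and \<phi>: "\<And>k. \<phi> k \<in> test_functions D"
    and lim_g: "(\<lambda>k. \<integral>\<^sup>+x. ennreal ((norm (gradient (\<phi> k) x - g x))\<^sup>2) \<partial>lebesgue_on D) \<longlonglongrightarrow> 0"
    and lim_u: "(\<lambda>k. \<integral>\<^sup>+x. ennreal ((norm (\<phi> k x - u x))\<^sup>2) \<partial>lebesgue_on D) \<longlonglongrightarrow> 0"
begin

lemma Db: "D \<in> sets borel" using D by simp

lemma test_measurable:
  "\<psi> \<in> test_functions D \<Longrightarrow> \<psi> \<in> borel_measurable (lebesgue_on D)"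
  "\<psi> \<in> test_functions D \<Longrightarrow> gradient \<psi> \<in> borel_measurable (lebesgue_on D)"
  by (rule borel_measurable_lebesgue_on[OF test_function_measurable(1)], assumption,
      rule borel_measurable_lebesgue_on[OF test_function_measurable(2)], assumption)

lemma AE_subsequence: "\<exists>\<tau>. strict_mono \<tau> \<and> (AE x in lebesgue_on D. (\<lambda>k. \<phi> (\<tau> k) x) \<longlonglongrightarrow> u x)"
proof -
  note [measurable] = um test_measurable(1)[OF \<phi>]
  have "\<forall>\<^sub>F k in sequentially. (\<integral>\<^sup>+x. ennreal ((norm (\<phi> k x - u x))\<^sup>2) \<partial>lebesgue_on D) < 1"
    using lim_u by (rule order_tendstoD) simp
  \<comment> \<open>From this index on the squared distances are integrable, and an
    \<open>L\<^sup>1\<close> convergent sequence has an almost everywhere convergent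
    subsequence.\<close>
  then obtain N where N: "\<And>k. N \<le> k \<Longrightarrow> (\<integral>\<^sup>+x. ennreal ((norm (\<phi> k x - u x))\<^sup>2) \<partial>lebesgue_on D) < 1"
    unfolding eventually_sequentially by blast
  define w where "w k x = (norm (\<phi> (k + N) x - u x))\<^sup>2" for k x
  have wm[measurable]: "w k \<in> borel_measurable (lebesgue_on D)" for k unfolding w_def by measurable
  have wn: "(\<integral>\<^sup>+x. ennreal (w k x) \<partial>lebesgue_on D) < \<infinity>" for k
    using N[of "k + N"] by (auto simp: w_def intro: less_trans)
  have w0: "0 \<le> w k x" for k x by (simp add: w_def)
  have int: "integrable (lebesgue_on D) (w k)" for k
    by (rule integrableI_nonneg) (use wn w0 in auto)
  have eq: "ennreal (LINT x|lebesgue_on D. norm (w k x)) = (\<integral>\<^sup>+x. ennreal (w k x) \<partial>lebesgue_on D)" for k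
    using nn_integral_eq_integral[OF int, of k] w0 by simp
  have "(\<lambda>k. ennreal (LINT x|lebesgue_on D. norm (w k x))) \<longlonglongrightarrow> ennreal 0"
    unfolding eq using LIMSEQ_ignore_initial_segment[OF lim_u, of N] by (simp add: w_def)
  then have "(\<lambda>k. (LINT x|lebesgue_on D. norm (w k x))) \<longlonglongrightarrow> 0"
    by (subst (asm) tendsto_ennreal_iff) auto
  then obtain \<tau> where \<tau>: "strict_mono \<tau>" "AE x in lebesgue_on D. (\<lambda>k. w (\<tau> k) x) \<longlonglongrightarrow> 0"
    using tendsto_L1_AE_subseq[of "lebesgue_on D" w] int by blast
  have "AE x in lebesgue_on D. (\<lambda>k. \<phi> (\<tau> k + N) x) \<longlonglongrightarrow> u x"
    using \<tau>(2)
  proof eventually_elim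
    case (elim x)
    then have "(\<lambda>k. sqrt (w (\<tau> k) x)) \<longlonglongrightarrow> sqrt 0" by (rule tendsto_real_sqrt)
    then have "(\<lambda>k. norm (\<phi> (\<tau> k + N) x - u x)) \<longlonglongrightarrow> 0" by (simp add: w_def)
    then show ?case by (simp add: tendsto_norm_zero_iff LIM_zero_iff)
  qed
  moreover have "strict_mono (\<lambda>k. \<tau> k + N)" using \<tau>(1) by (simp add: strict_mono_def)
  ultimately show ?thesis by blast
qed

text \<open>The inequality is applied to \<open>\<phi> k - \<psi>\<close>, and Fatou is used along
  an almost everywhere convergent subsequence. The choice \<open>\<psi> = 0\<close> bounds
  \<open>u\<close> itself, \<open>\<psi> = \<phi> k\<close> bounds the error
  \<open>u - \<phi> k\<close>.\<close>

lemma sobolev_limit: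
  assumes \<psi>: "\<psi> \<in> test_functions D" and H: "0 \<le> H" "(\<integral>\<^sup>+x. ennreal ((norm (g x - gradient \<psi> x))\<^sup>2) \<partial>lebesgue_on D) \<le> ennreal H"
  shows "(\<integral>\<^sup>+x. ennreal (norm (u x - \<psi> x) powr e) \<partial>lebesgue_on D) \<le> ennreal ((S * sqrt H) powr e)"
proof -
  note [measurable] = um gm test_measurable[OF \<phi>] test_measurable[OF \<psi>]
  obtain \<tau> where \<tau>: "strict_mono \<tau>" "AE x in lebesgue_on D. (\<lambda>k. \<phi> (\<tau> k) x) \<longlonglongrightarrow> u x"
    using AE_subsequence by blast
  have approx: "(\<integral>\<^sup>+x. ennreal (norm (u x - \<psi> x) powr e) \<partial>lebesgue_on D) \<le> ennreal ((S * sqrt (H + \<eta>)) powr e)"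
    if \<eta>: "0 < \<eta>" for \<eta>
  proof -
    \<comment> \<open>The allowance \<open>\<eta>\<close> is shared equally: \<open>\<delta>\<close>
      keeps the inflation of \<open>H\<close> below \<open>\<eta> / 2\<close>, and
      \<open>\<theta>\<close> limits the gradient error, after its large factor
      \<open>1 + 1 / \<delta>\<close>, to the other half.\<close>
    define \<delta> where "\<delta> = \<eta> / (2 * (H + 1))"
    have \<delta>: "0 < \<delta>" using \<eta> H by (simp add: \<delta>_def)
    have \<delta>H: "\<delta> * H \<le> \<eta> / 2"
    proof -
      have "\<delta> * H \<le> \<delta> * (H + 1)" using \<delta> by simp
      also have "\<dots> = \<eta> / 2"
      proof -
        have "\<eta> / (2 * K) * K = \<eta> / 2" if "K \<noteq> 0" for K :: real using that by simp
        from this[of "H + 1"] show ?thesis using H unfolding \<delta>_def by simp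
      qed
      finally show ?thesis .
    qed
    define \<theta> where "\<theta> = \<eta> / (2 * (1 + 1 / \<delta>))"
    have \<theta>: "0 < \<theta>" "(1 + 1 / \<delta>) * \<theta> = \<eta> / 2"
    proof -
      have K: "0 < 1 + 1 / \<delta>" using \<delta> by (simp add: add_pos_pos)
      then show "0 < \<theta>" using \<eta> by (simp add: \<theta>_def)
      have "K * (\<eta> / (2 * K)) = \<eta> / 2" if "0 < K" for K :: real using that by simp
      from this[OF K] show "(1 + 1 / \<delta>) * \<theta> = \<eta> / 2" unfolding \<theta>_def .
    qed
    have ev: "\<forall>\<^sub>F k in sequentially. (\<integral>\<^sup>+x. ennreal ((norm (gradient (\<phi> k) x - g x))\<^sup>2) \<partial>lebesgue_on D) < ennreal \<theta>"
      using lim_g \<theta> by (intro order_tendstoD) auto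
    have "\<forall>\<^sub>F k in sequentially. (\<integral>\<^sup>+x. ennreal (norm (\<phi> k x - \<psi> x) powr e) \<partial>lebesgue_on D) \<le> ennreal ((S * sqrt (H + \<eta>)) powr e)"
      using ev
    proof eventually_elim
      case (elim k)
      have t: "(\<lambda>x. \<phi> k x - \<psi> x) \<in> test_functions D" by (rule test_functions_diff[OF \<phi> \<psi>])
      have "(\<integral>\<^sup>+x. ennreal ((norm (gradient (\<lambda>x. \<phi> k x - \<psi> x) x))\<^sup>2) \<partial>lborel)
          = (\<integral>\<^sup>+x. ennreal ((norm (gradient (\<phi> k) x - gradient \<psi> x))\<^sup>2) \<partial>lebesgue_on D)"
        unfolding gradient_diff[OF \<phi> \<psi>]
        using test_function_measurable[OF \<phi>] test_function_measurable[OF \<psi>]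
        by (intro nn_integral_lebesgue_on[symmetric] Db) (auto simp: test_function_vanishes[OF \<phi>] test_function_vanishes[OF \<psi>])
      also have "\<dots> \<le> (\<integral>\<^sup>+x. ennreal (1 + \<delta>) * ennreal ((norm (g x - gradient \<psi> x))\<^sup>2)
          + ennreal (1 + 1 / \<delta>) * ennreal ((norm (gradient (\<phi> k) x - g x))\<^sup>2) \<partial>lebesgue_on D)"
      proof (rule nn_integral_mono)
        fix x
        show "ennreal ((norm (gradient (\<phi> k) x - gradient \<psi> x))\<^sup>2) \<le> ennreal (1 + \<delta>) * ennreal ((norm (g x - gradient \<psi> x))\<^sup>2)
          + ennreal (1 + 1 / \<delta>) * ennreal ((norm (gradient (\<phi> k) x - g x))\<^sup>2)"
          using norm_diff_sq_le[OF \<delta>, of "gradient (\<phi> k) x" "gradient \<psi> x" "g x"] \<delta>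
          by (simp flip: ennreal_mult ennreal_plus add: ennreal_leI)
      qed
      also have "\<dots> = ennreal (1 + \<delta>) * (\<integral>\<^sup>+x. ennreal ((norm (g x - gradient \<psi> x))\<^sup>2) \<partial>lebesgue_on D)
          + ennreal (1 + 1 / \<delta>) * (\<integral>\<^sup>+x. ennreal ((norm (gradient (\<phi> k) x - g x))\<^sup>2) \<partial>lebesgue_on D)"
        by (simp add: nn_integral_add nn_integral_cmult)
      also have "\<dots> \<le> ennreal (1 + \<delta>) * ennreal H + ennreal (1 + 1 / \<delta>) * ennreal \<theta>"
        using H elim by (intro add_mono mult_left_mono) auto
      also have "\<dots> = ennreal ((1 + \<delta>) * H + (1 + 1 / \<delta>) * \<theta>)"
        using \<delta> \<theta> H by (simp flip: ennreal_mult ennreal_plus)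
      also have "\<dots> \<le> ennreal (H + \<eta>)"
        unfolding \<theta>(2) using \<delta>H by (intro ennreal_leI) (simp add: distrib_right)
      finally have "(\<integral>\<^sup>+x. ennreal (norm (\<phi> k x - \<psi> x) powr e) \<partial>lborel) \<le> ennreal ((S * sqrt (H + \<eta>)) powr e)"
        using H \<eta> by (intro sob[OF t]) auto
      moreover have "(\<integral>\<^sup>+x. ennreal (norm (\<phi> k x - \<psi> x) powr e) \<partial>lebesgue_on D) = (\<integral>\<^sup>+x. ennreal (norm (\<phi> k x - \<psi> x) powr e) \<partial>lborel)"
        using test_function_measurable[OF \<phi>] test_function_measurable[OF \<psi>]
        by (intro nn_integral_lebesgue_on Db) (auto simp: test_function_vanishes[OF \<phi>] test_function_vanishes[OF \<psi>])
      ultimately show ?case by simp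
    qed
    then have ev2: "\<forall>\<^sub>F k in sequentially. (\<integral>\<^sup>+x. ennreal (norm (\<phi> (\<tau> k) x - \<psi> x) powr e) \<partial>lebesgue_on D) \<le> ennreal ((S * sqrt (H + \<eta>)) powr e)"
      by (rule eventually_subseq[OF \<tau>(1)])
    have "(\<integral>\<^sup>+x. ennreal (norm (u x - \<psi> x) powr e) \<partial>lebesgue_on D) = (\<integral>\<^sup>+x. liminf (\<lambda>k. ennreal (norm (\<phi> (\<tau> k) x - \<psi> x) powr e)) \<partial>lebesgue_on D)"
    proof (rule nn_integral_cong_AE)
      show "AE x in lebesgue_on D. ennreal (norm (u x - \<psi> x) powr e) = liminf (\<lambda>k. ennreal (norm (\<phi> (\<tau> k) x - \<psi> x) powr e))"
        using \<tau>(2)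
      proof eventually_elim
        case (elim x)
        have "(\<lambda>k. norm (\<phi> (\<tau> k) x - \<psi> x) powr e) \<longlonglongrightarrow> norm (u x - \<psi> x) powr e"
          by (rule tendsto_powr2[OF tendsto_norm[OF tendsto_diff[OF elim tendsto_const]] tendsto_const]) (simp_all add: e)
        then show ?case by (intro lim_imp_Liminf[symmetric] tendsto_ennrealI) simp_all
      qed
    qed
    also have "\<dots> \<le> liminf (\<lambda>k. \<integral>\<^sup>+x. ennreal (norm (\<phi> (\<tau> k) x - \<psi> x) powr e) \<partial>lebesgue_on D)"
      by (rule nn_integral_liminf) measurable
    also have "\<dots> \<le> ennreal ((S * sqrt (H + \<eta>)) powr e)"
      by (rule Liminf_le[OF _ ev2]) simp
    finally show ?thesis .
  qed
  show ?thesis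
  proof (rule tendsto_lowerbound)
    have "((\<lambda>\<eta>. (S * sqrt (H + \<eta>)) powr e) \<longlongrightarrow> (S * sqrt (H + 0)) powr e) (at_right 0)"
    proof (rule tendsto_powr2)
      show "((\<lambda>\<eta>. S * sqrt (H + \<eta>)) \<longlongrightarrow> S * sqrt (H + 0)) (at_right 0)" by (intro tendsto_intros)
      show "\<forall>\<^sub>F \<eta> in at_right 0. 0 \<le> S * sqrt (H + \<eta>)"
        using S H by (auto simp: eventually_at_right_field intro!: exI[of _ 1])
    qed (use e in auto)
    then show "((\<lambda>\<eta>. ennreal ((S * sqrt (H + \<eta>)) powr e)) \<longlongrightarrow> ennreal ((S * sqrt H) powr e)) (at_right 0)"
      by (intro tendsto_ennrealI) simp
    show "\<forall>\<^sub>F \<eta> in at_right 0. (\<integral>\<^sup>+x. ennreal (norm (u x - \<psi> x) powr e) \<partial>lebesgue_on D) \<le> ennreal ((S * sqrt (H + \<eta>)) powr e)"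
      using approx by (auto simp: eventually_at_right_field intro: exI[of _ 1])
  qed simp
qed

end

section \<open>Testing the equation\<close>

lemma integral_le_of_nn_integral_le:
  fixes h :: "'a \<Rightarrow> real"
  assumes m: "h \<in> borel_measurable M" and h0: "\<And>x. 0 \<le> h x" and c: "0 \<le> c" "(\<integral>\<^sup>+x. ennreal (h x) \<partial>M) \<le> ennreal c"
  shows "integrable M h" "(LINT x|M. h x) \<le> c"
proof -
  show i: "integrable M h"
    by (rule integrableI_nonneg[OF m]) (use h0 c in \<open>auto intro: le_less_trans\<close>)
  have "ennreal (LINT x|M. h x) \<le> ennreal c"
    using nn_integral_eq_integral[OF i] h0 c by simp
  then show "(LINT x|M. h x) \<le> c" using c by simp
qed

lemma powr_square: "0 \<le> x \<Longrightarrow> (x\<^sup>2) powr p = x powr (2 * p)" for x p :: real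
  using powr_powr[of x 2 p] by (simp add: powr_numeral)

lemma Re_sum_mult_cnj: "Re (\<Sum>i\<in>UNIV. a $ i * cnj (b $ i)) = a \<bullet> b" for a b :: "complex^'n"
  by (simp add: inner_vec_def inner_complex_def)

lemma norm_sum_mult_cnj: "norm (\<Sum>i\<in>UNIV. a $ i * cnj (b $ i)) \<le> (norm a)\<^sup>2 + (norm b)\<^sup>2" for a b :: "complex^'n"
proof -
  have "norm (\<Sum>i\<in>UNIV. a $ i * cnj (b $ i)) \<le> (\<Sum>i\<in>UNIV. (norm (a $ i))\<^sup>2 + (norm (b $ i))\<^sup>2)"
  proof (rule sum_norm_le)
    fix i
    have "2 * norm (a $ i) * norm (b $ i) \<le> (norm (a $ i))\<^sup>2 + (norm (b $ i))\<^sup>2"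
      using sum_squares_bound[of "norm (a $ i)" "norm (b $ i)"] by simp
    moreover have "0 \<le> norm (a $ i) * norm (b $ i)" by simp
    ultimately have "norm (a $ i) * norm (b $ i) \<le> (norm (a $ i))\<^sup>2 + (norm (b $ i))\<^sup>2" by linarith
    then show "norm (a $ i * cnj (b $ i)) \<le> (norm (a $ i))\<^sup>2 + (norm (b $ i))\<^sup>2" by (simp add: norm_mult)
  qed
  also have "\<dots> = (norm a)\<^sup>2 + (norm b)\<^sup>2"
    by (simp add: norm_vec_def L2_set_def sum_nonneg sum.distrib)
  finally show ?thesis .
qed

context sobolev_approximation
begin

text \<open>If the product were below 1, then \<open>n * S\<^sup>2 < 1\<close>. Testing with the
  conjugate of \<open>\<phi> k\<close> bounds \<open>(1 - n * S\<^sup>2) * (G + H k)\<close> by a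
  multiple of the squared gradient error \<open>a k\<close>, which tends to 0. So the gradient
  vanishes, and the Sobolev inequality makes \<open>u\<close> vanish too.\<close>

lemma equation_bound:
  fixes V :: "real^'n \<Rightarrow> real"
  assumes r: "conjugate_exponent r p" "e = 2 * p" and V: "V \<in> Lp_space r D" and nontriv: "nontrivial_on D u"
    and eq: "\<And>\<psi>. \<psi> \<in> test_functions D \<Longrightarrow>
      (LINT x|lebesgue_on D. (\<Sum>i\<in>UNIV. g x $ i * gradient \<psi> x $ i)) =
      (LINT x|lebesgue_on D. complex_of_real (V x) * u x * \<psi> x)"
  shows "1 \<le> ennreal (S\<^sup>2) * Lp_norm r D (\<lambda>x. max (V x) 0)"
proof (rule ccontr)
  assume contra: "\<not> 1 \<le> ennreal (S\<^sup>2) * Lp_norm r D (\<lambda>x. max (V x) 0)"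
  have Vm[measurable]: "V \<in> borel_measurable (lebesgue_on D)" and Vfin: "Lp_norm r D V < \<infinity>"
    using V by (auto simp: Lp_space_def)
  note [measurable] = um gm test_measurable[OF \<phi>]
  define nV where "nV = enn2real (Lp_norm r D (\<lambda>x. \<bar>V x\<bar>))"
  have nV: "0 \<le> nV" "Lp_norm r D (\<lambda>x. \<bar>V x\<bar>) = ennreal nV"
  proof -
    have "Lp_norm r D (\<lambda>x. \<bar>V x\<bar>) = Lp_norm r D V" by (simp add: Lp_norm_def)
    then show "Lp_norm r D (\<lambda>x. \<bar>V x\<bar>) = ennreal nV" using Vfin by (simp add: nV_def)
  qed (simp add: nV_def)
  define n where "n = enn2real (Lp_norm r D (\<lambda>x. max (V x) 0))"
  have n: "0 \<le> n" "Lp_norm r D (\<lambda>x. max (V x) 0) = ennreal n"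
  proof -
    have "Lp_norm r D (\<lambda>x. max (V x) 0) \<le> Lp_norm r D V"
      unfolding Lp_norm_def
      by (auto intro!: esssup_mono ennpow_mono nn_integral_mono ennreal_leI powr_mono2)
    then have "Lp_norm r D (\<lambda>x. max (V x) 0) < \<infinity>" using Vfin by (rule le_less_trans)
    then show "Lp_norm r D (\<lambda>x. max (V x) 0) = ennreal n" by (simp add: n_def)
  qed (simp add: n_def)
  have nS: "n * S\<^sup>2 < 1"
  proof -
    have "ennreal (S\<^sup>2 * n) < 1" using contra n by (simp add: ennreal_mult)
    then show ?thesis using n by (simp add: mult.commute flip: ennreal_1 add: ennreal_less_iff)
  qed
  let ?I = "\<lambda>f. LINT x|lebesgue_on D. f x"
  have iG: "integrable (lebesgue_on D) (\<lambda>x. (norm (g x))\<^sup>2)"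
    by (rule integrableI_nonneg) (use gfin in auto)
  define G where "G = ?I (\<lambda>x. (norm (g x))\<^sup>2)"
  have G: "0 \<le> G" "(\<integral>\<^sup>+x. ennreal ((norm (g x))\<^sup>2) \<partial>lebesgue_on D) = ennreal G"
    using nn_integral_eq_integral[OF iG] by (simp_all add: G_def)
  have iH: "integrable (lebesgue_on D) (\<lambda>x. (norm (gradient (\<phi> k) x))\<^sup>2)"
    and nH: "(\<integral>\<^sup>+x. ennreal ((norm (gradient (\<phi> k) x))\<^sup>2) \<partial>lborel) = (\<integral>\<^sup>+x. ennreal ((norm (gradient (\<phi> k) x))\<^sup>2) \<partial>lebesgue_on D)" for k
  proof -
    show nH: "(\<integral>\<^sup>+x. ennreal ((norm (gradient (\<phi> k) x))\<^sup>2) \<partial>lborel) = (\<integral>\<^sup>+x. ennreal ((norm (gradient (\<phi> k) x))\<^sup>2) \<partial>lebesgue_on D)"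
      using test_function_measurable[OF \<phi>]
      by (intro nn_integral_lebesgue_on[symmetric] Db) (auto simp: test_function_vanishes[OF \<phi>])
    show "integrable (lebesgue_on D) (\<lambda>x. (norm (gradient (\<phi> k) x))\<^sup>2)"
      by (rule integrableI_nonneg) (use test_function_finite(3)[OF \<phi> e, of k] nH in auto)
  qed
  define H where "H k = ?I (\<lambda>x. (norm (gradient (\<phi> k) x))\<^sup>2)" for k
  have H: "0 \<le> H k" "(\<integral>\<^sup>+x. ennreal ((norm (gradient (\<phi> k) x))\<^sup>2) \<partial>lborel) = ennreal (H k)" for k
    using nn_integral_eq_integral[OF iH] nH by (simp_all add: H_def)
  have iA: "integrable (lebesgue_on D) (\<lambda>x. (norm (gradient (\<phi> k) x - g x))\<^sup>2)" for k
  proof (rule Bochner_Integration.integrable_bound)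
    show "integrable (lebesgue_on D) (\<lambda>x. 2 * (norm (gradient (\<phi> k) x))\<^sup>2 + 2 * (norm (g x))\<^sup>2)"
      by (intro Bochner_Integration.integrable_add integrable_mult_right iG iH)
    show "AE x in lebesgue_on D. norm ((norm (gradient (\<phi> k) x - g x))\<^sup>2) \<le> norm (2 * (norm (gradient (\<phi> k) x))\<^sup>2 + 2 * (norm (g x))\<^sup>2)"
    proof (rule AE_I2)
      fix x
      show "norm ((norm (gradient (\<phi> k) x - g x))\<^sup>2) \<le> norm (2 * (norm (gradient (\<phi> k) x))\<^sup>2 + 2 * (norm (g x))\<^sup>2)"
        using norm_diff_sq_le[of 1 "gradient (\<phi> k) x" "g x" 0] by simp
    qed
  qed measurable
  define a where "a k = ?I (\<lambda>x. (norm (gradient (\<phi> k) x - g x))\<^sup>2)" for k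
  have a: "0 \<le> a k" "(\<integral>\<^sup>+x. ennreal ((norm (gradient (\<phi> k) x - g x))\<^sup>2) \<partial>lebesgue_on D) = ennreal (a k)" for k
    using nn_integral_eq_integral[OF iA] by (simp_all add: a_def)
  have a0: "a \<longlonglongrightarrow> 0"
  proof -
    have "(\<lambda>k. ennreal (a k)) \<longlonglongrightarrow> ennreal 0" using lim_g by (simp add: a)
    then show ?thesis by (subst (asm) tendsto_ennreal_iff) (auto simp: a)
  qed
  have zero: "(\<lambda>_. 0) \<in> test_functions D" using test_functions_diff[OF \<phi>[of 0] \<phi>[of 0]] by simp
  have grad0: "gradient (\<lambda>_. 0 :: complex) x = (0 :: complex^'n)" for x
    using gradient_diff[OF \<phi>[of 0] \<phi>[of 0], of x] by simp
  \<comment> \<open>As \<open>e = 2 * p\<close>, the Sobolev bounds become bounds in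
    \<open>L\<^sup>p\<close> for squared moduli, the factors that are paired with the potential in
    \<open>L\<^sup>r\<close>.\<close>
  have powr_S: "(S * sqrt A) powr e = (S\<^sup>2 * A) powr p" if "0 \<le> A" for A
    using powr_square[of "S * sqrt A" p] that S by (simp add: r power_mult_distrib)
  have Lu: "(\<integral>\<^sup>+x. ennreal (((norm (u x))\<^sup>2) powr p) \<partial>lebesgue_on D) \<le> ennreal ((S\<^sup>2 * G) powr p)"
    using sobolev_limit[OF zero G(1)] G by (simp add: grad0 powr_square powr_S flip: r(2))
  have L\<phi>: "(\<integral>\<^sup>+x. ennreal (((norm (\<phi> k x))\<^sup>2) powr p) \<partial>lebesgue_on D) \<le> ennreal ((S\<^sup>2 * H k) powr p)" for k
  proof -
    have "(\<integral>\<^sup>+x. ennreal (norm (\<phi> k x) powr e) \<partial>lebesgue_on D) = (\<integral>\<^sup>+x. ennreal (norm (\<phi> k x) powr e) \<partial>lborel)"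
      using test_function_measurable[OF \<phi>]
      by (intro nn_integral_lebesgue_on Db) (auto simp: test_function_vanishes[OF \<phi>])
    then show ?thesis
      using sob[OF \<phi>, of "H k" k] H by (simp add: powr_square powr_S flip: r(2))
  qed
  have Ld: "(\<integral>\<^sup>+x. ennreal (((norm (u x - \<phi> k x))\<^sup>2) powr p) \<partial>lebesgue_on D) \<le> ennreal ((S\<^sup>2 * a k) powr p)" for k
    using sobolev_limit[OF \<phi> a(1), of k k] a by (simp add: norm_minus_commute powr_square powr_S flip: r(2))
  have prod: "integrable (lebesgue_on D) (\<lambda>x. W x * h x)" "?I (\<lambda>x. W x * h x) \<le> m * (S\<^sup>2 * b)"
    if "W \<in> borel_measurable (lebesgue_on D)" "h \<in> borel_measurable (lebesgue_on D)" "\<And>x. 0 \<le> W x" "\<And>x. 0 \<le> h x"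
      "0 \<le> m" "Lp_norm r D W = ennreal m" "0 \<le> b" "(\<integral>\<^sup>+x. ennreal (h x powr p) \<partial>lebesgue_on D) \<le> ennreal ((S\<^sup>2 * b) powr p)"
    for W h :: "real^'n \<Rightarrow> real" and m b
  proof -
    have "0 \<le> S\<^sup>2 * b" using that by simp
    then have le: "(\<integral>\<^sup>+x. ennreal (W x * h x) \<partial>lebesgue_on D) \<le> ennreal (m * (S\<^sup>2 * b))"
      by (rule Lp_norm_product[OF that(1-4) r(1) that(5,6) _ that(8)])
    have 1: "(\<lambda>x. W x * h x) \<in> borel_measurable (lebesgue_on D)" using that(1,2) by (rule borel_measurable_times)
    have 2: "0 \<le> W x * h x" for x using that(3,4) by simp
    have 3: "0 \<le> m * (S\<^sup>2 * b)" using that by simp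
    show "integrable (lebesgue_on D) (\<lambda>x. W x * h x)" by (rule integral_le_of_nn_integral_le(1)[OF 1 2 3 le])
    show "?I (\<lambda>x. W x * h x) \<le> m * (S\<^sup>2 * b)" by (rule integral_le_of_nn_integral_le(2)[OF 1 2 3 le])
  qed
  have key: "(1 - n * S\<^sup>2) * (G + H k) \<le> (1 + nV * S\<^sup>2) * a k" for k
  proof -
    let ?F = "\<lambda>x. \<Sum>i\<in>UNIV. g x $ i * cnj (gradient (\<phi> k) x $ i)"
    let ?P = "\<lambda>x. complex_of_real (V x) * u x * cnj (\<phi> k x)"
    \<comment> \<open>The pairing in the equation is bilinear, so conjugating the test function is
      what makes the real part of the left side an inner product of gradients.\<close>
    have FP: "?I ?F = ?I ?P"
      using eq[OF test_functions_cnj[OF \<phi>[of k]]] by (simp only: gradient_cnj[OF \<phi>])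
    have iF: "integrable (lebesgue_on D) ?F"
    proof (rule Bochner_Integration.integrable_bound)
      show "integrable (lebesgue_on D) (\<lambda>x. (norm (g x))\<^sup>2 + (norm (gradient (\<phi> k) x))\<^sup>2)"
        by (intro Bochner_Integration.integrable_add iG iH)
      show "AE x in lebesgue_on D. norm (?F x) \<le> norm ((norm (g x))\<^sup>2 + (norm (gradient (\<phi> k) x))\<^sup>2)"
        using norm_sum_mult_cnj by (intro AE_I2) simp
      have comp: "(\<lambda>x. f x $ i) \<in> borel_measurable (lebesgue_on D)"
        if "f \<in> borel_measurable (lebesgue_on D)" for f :: "real^'n \<Rightarrow> complex^'n" and i
        by (rule measurable_compose[OF that]) (intro borel_measurable_continuous_onI continuous_intros)
      have cnj: "(\<lambda>x. cnj (f x)) \<in> borel_measurable (lebesgue_on D)"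
        if "f \<in> borel_measurable (lebesgue_on D)" for f :: "real^'n \<Rightarrow> complex"
        by (rule measurable_compose[OF that]) (intro borel_measurable_continuous_onI continuous_intros)
      show "?F \<in> borel_measurable (lebesgue_on D)"
        by (intro borel_measurable_sum borel_measurable_times comp cnj gm test_measurable(2)[OF \<phi>])
    qed
    then have "Re (?I ?F) = ?I (\<lambda>x. Re (?F x))" by (rule integral_Re[symmetric])
    also have "\<dots> = ?I (\<lambda>x. ((norm (g x))\<^sup>2 + (norm (gradient (\<phi> k) x))\<^sup>2 - (norm (gradient (\<phi> k) x - g x))\<^sup>2) / 2)"
      unfolding Re_sum_mult_cnj by (simp add: dot_norm_neg norm_minus_commute)
    also have "\<dots> = (G + H k - a k) / 2"
      by (simp add: G_def H_def a_def iG iH iA)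
    finally have L: "Re (?I ?F) = (G + H k - a k) / 2" .
    have mp: "(\<lambda>x. max (V x) 0) \<in> borel_measurable (lebesgue_on D)" "(\<lambda>x. \<bar>V x\<bar>) \<in> borel_measurable (lebesgue_on D)"
      by measurable
    have mu: "(\<lambda>x. (norm (u x))\<^sup>2) \<in> borel_measurable (lebesgue_on D)" "(\<lambda>x. (norm (\<phi> k x))\<^sup>2) \<in> borel_measurable (lebesgue_on D)"
      "(\<lambda>x. (norm (u x - \<phi> k x))\<^sup>2) \<in> borel_measurable (lebesgue_on D)"
      by measurable
    note P1 = prod[OF mp(1) mu(1) _ _ n G(1) Lu, simplified]
    note P2 = prod[OF mp(1) mu(2) _ _ n H(1) L\<phi>, simplified]
    note P3 = prod[OF mp(2) mu(3) _ _ nV a(1) Ld, simplified]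
    note Q1 = prod(1)[OF mp(2) mu(1) _ _ nV G(1) Lu, simplified]
    note Q2 = prod(1)[OF mp(2) mu(2) _ _ nV H(1) L\<phi>, simplified]
    have iP: "integrable (lebesgue_on D) ?P"
    proof (rule Bochner_Integration.integrable_bound)
      show "integrable (lebesgue_on D) (\<lambda>x. \<bar>V x\<bar> * (norm (u x))\<^sup>2 + \<bar>V x\<bar> * (norm (\<phi> k x))\<^sup>2)"
        by (rule Bochner_Integration.integrable_add[OF Q1 Q2])
      show "AE x in lebesgue_on D. norm (?P x) \<le> norm (\<bar>V x\<bar> * (norm (u x))\<^sup>2 + \<bar>V x\<bar> * (norm (\<phi> k x))\<^sup>2)"
      proof (rule AE_I2)
        fix x
        have "2 * norm (u x) * norm (\<phi> k x) \<le> (norm (u x))\<^sup>2 + (norm (\<phi> k x))\<^sup>2"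
          by (rule sum_squares_bound)
        moreover have "0 \<le> norm (u x) * norm (\<phi> k x)" by simp
        ultimately have "norm (u x) * norm (\<phi> k x) \<le> (norm (u x))\<^sup>2 + (norm (\<phi> k x))\<^sup>2" by linarith
        then have "\<bar>V x\<bar> * (norm (u x) * norm (\<phi> k x)) \<le> \<bar>V x\<bar> * ((norm (u x))\<^sup>2 + (norm (\<phi> k x))\<^sup>2)"
          by (rule mult_left_mono) simp
        then show "norm (?P x) \<le> norm (\<bar>V x\<bar> * (norm (u x))\<^sup>2 + \<bar>V x\<bar> * (norm (\<phi> k x))\<^sup>2)"
          by (simp add: norm_mult distrib_left mult.assoc)
      qed
      have "(\<lambda>x. cnj (\<phi> k x)) \<in> borel_measurable (lebesgue_on D)"
        by (rule test_measurable(1)[OF test_functions_cnj[OF \<phi>]])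
      then show "?P \<in> borel_measurable (lebesgue_on D)" by measurable
    qed
    then have "Re (?I ?P) = ?I (\<lambda>x. Re (?P x))" by (rule integral_Re[symmetric])
    also have "\<dots> \<le> ?I (\<lambda>x. (max (V x) 0 * (norm (u x))\<^sup>2 + max (V x) 0 * (norm (\<phi> k x))\<^sup>2 + \<bar>V x\<bar> * (norm (u x - \<phi> k x))\<^sup>2) / 2)"
    proof (rule integral_mono)
      show "integrable (lebesgue_on D) (\<lambda>x. Re (?P x))" by (rule integrable_Re[OF iP])
      show "integrable (lebesgue_on D) (\<lambda>x. (max (V x) 0 * (norm (u x))\<^sup>2 + max (V x) 0 * (norm (\<phi> k x))\<^sup>2 + \<bar>V x\<bar> * (norm (u x - \<phi> k x))\<^sup>2) / 2)"
        by (intro integrable_divide Bochner_Integration.integrable_add P1(1) P2(1) P3(1))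
      fix x
      \<comment> \<open>The product is half of the two squares minus the squared difference. In the
        squares \<open>V\<close> may be replaced by its positive part; the difference carries
        \<open>- V\<close>, bounded by the modulus, at the cost of an error that vanishes in the
        limit.\<close>
      have "Re (?P x) = V x * (u x \<bullet> \<phi> k x)" by (simp add: inner_complex_def algebra_simps)
      also have "\<dots> = (V x * ((norm (u x))\<^sup>2 + (norm (\<phi> k x))\<^sup>2) + (- V x) * (norm (u x - \<phi> k x))\<^sup>2) / 2"
        by (simp add: dot_norm_neg algebra_simps)
      also have "\<dots> \<le> (max (V x) 0 * ((norm (u x))\<^sup>2 + (norm (\<phi> k x))\<^sup>2) + \<bar>V x\<bar> * (norm (u x - \<phi> k x))\<^sup>2) / 2"
        by (intro divide_right_mono add_mono mult_right_mono) auto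
      finally show "Re (?P x) \<le> (max (V x) 0 * (norm (u x))\<^sup>2 + max (V x) 0 * (norm (\<phi> k x))\<^sup>2 + \<bar>V x\<bar> * (norm (u x - \<phi> k x))\<^sup>2) / 2"
        by (simp add: distrib_left)
    qed
    also have "\<dots> = (?I (\<lambda>x. max (V x) 0 * (norm (u x))\<^sup>2) + ?I (\<lambda>x. max (V x) 0 * (norm (\<phi> k x))\<^sup>2) + ?I (\<lambda>x. \<bar>V x\<bar> * (norm (u x - \<phi> k x))\<^sup>2)) / 2"
      by (simp add: P1(1) P2(1) P3(1))
    also have "\<dots> \<le> (n * (S\<^sup>2 * G) + n * (S\<^sup>2 * H k) + nV * (S\<^sup>2 * a k)) / 2"
      by (intro divide_right_mono add_mono P1(2) P2(2) P3(2)) simp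
    finally have "(G + H k - a k) / 2 \<le> (n * (S\<^sup>2 * G) + n * (S\<^sup>2 * H k) + nV * (S\<^sup>2 * a k)) / 2"
      using L unfolding FP by simp
    then show ?thesis by (simp add: algebra_simps)
  qed
  \<comment> \<open>The nonnegative \<open>H k\<close> may be dropped because its factor is
    positive.\<close>
  have "(1 - n * S\<^sup>2) * G \<le> (1 + nV * S\<^sup>2) * a k" for k
  proof -
    have "(1 - n * S\<^sup>2) * G \<le> (1 - n * S\<^sup>2) * (G + H k)" using nS H(1)[of k] by (intro mult_left_mono) auto
    then show ?thesis using key[of k] by linarith
  qed
  moreover have "(\<lambda>k. (1 + nV * S\<^sup>2) * a k) \<longlonglongrightarrow> (1 + nV * S\<^sup>2) * 0"
    by (intro tendsto_mult tendsto_const a0)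
  ultimately have "(1 - n * S\<^sup>2) * G \<le> (1 + nV * S\<^sup>2) * 0"
    by (intro LIMSEQ_le_const) auto
  then have "G \<le> 0" using nS by (simp add: mult_le_0_iff)
  then have G0: "G = 0" using G(1) by simp
  have "(\<integral>\<^sup>+x. ennreal (norm (u x - 0) powr e) \<partial>lebesgue_on D) \<le> ennreal ((S * sqrt G) powr e)"
    by (rule sobolev_limit[OF zero G(1)]) (simp add: grad0 G)
  then have "(\<integral>\<^sup>+x. ennreal (norm (u x) powr e) \<partial>lebesgue_on D) = 0" by (simp add: G0)
  then have "AE x in lebesgue_on D. ennreal (norm (u x) powr e) = 0"
    by (subst (asm) nn_integral_0_iff_AE) auto
  then have "AE x in lebesgue_on D. u x = 0" by eventually_elim simp
  then show False using nontriv by (simp add: nontrivial_on_def)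
qed

end

text \<open>The last inequality says that \<open>2 * p\<close> is subcritical for the Sobolev
  embedding in dimension \<open>N\<close>; it is the hypothesis \<open>N / 2 < r\<close> in terms of
  the conjugate exponent. Finiteness of \<open>q\<close> comes from \<open>1 < r\<close>.\<close>

lemma conjugate_exponents:
  fixes q r :: ennreal
  assumes r: "max 1 (ennreal (N / 2)) < r" and qr: "1 / q + 1 / r = 1" and N: "0 < N"
  obtains p where "0 < p" "q = ennreal p" "conjugate_exponent r p" "1 / p = 1 - enn2real (1 / r)"
    "(2 * p) * (N / 2 - 1) < N"
proof (cases r)
  case (real s)
  have s1: "1 < s" and sN: "N / 2 < s" using r real N by (auto simp: ennreal_less_iff simp flip: ennreal_1)
  have ir: "1 / r = ennreal (1 / s)"
    using real s1 by (simp add: divide_ennreal flip: ennreal_1)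
  show ?thesis
  proof (cases q)
    case (real p)
    have p0: "p \<noteq> 0"
    proof
      assume "p = 0"
      then have "1 / q = \<infinity>" using real by (simp add: ennreal_divide_zero)
      then show False using qr by simp
    qed
    then have p: "0 < p" using real by simp
    have "1 / q = ennreal (1 / p)" using real p by (simp add: divide_ennreal flip: ennreal_1)
    then have "ennreal (1 / p + 1 / s) = ennreal 1" using qr ir p s1 by simp
    then have ps: "1 / p + 1 / s = 1" using p s1 by (subst (asm) ennreal_inj) auto
    have "0 < 1 / s" using s1 by simp
    then have "1 / p < 1" using ps by linarith
    then have p1: "1 < p" using p by (simp add: field_simps)
    have es: "enn2real r = s" using \<open>r = ennreal s\<close> s1 by simp
    have "1 / s < 2 / N" using sN N s1 by (simp add: field_simps)
    then have "1 - 2 / N < 1 / p" using ps by linarith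
    then have "(1 - 2 / N) * (p * N) < 1 / p * (p * N)" using p N by (intro mult_strict_right_mono) auto
    then have "(2 * p) * (N / 2 - 1) < N" using p N by (simp add: algebra_simps)
    moreover have "conjugate_exponent r p"
      using ps p1 s1 \<open>r = ennreal s\<close> es by (auto simp: conjugate_exponent_def)
    moreover have "1 / p = 1 - enn2real (1 / r)" using ps ir s1 by simp
    ultimately show ?thesis using that[of p] p real by simp
  next
    case top
    then have "1 / r = 1" using qr by simp
    then have "ennreal (1 / s) = ennreal 1" using ir by simp
    then show ?thesis using s1 by (subst (asm) ennreal_inj) auto
  qed
next
  case top
  then have "1 / q = 1" using qr by simp
  have "q = 1"
  proof (cases q)
    case (real p)
    have "p \<noteq> 0"
    proof
      assume "p = 0"
      then have "1 / q = \<infinity>" using real by (simp add: ennreal_divide_zero)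
      then show False using \<open>1 / q = 1\<close> by simp
    qed
    then have "0 < p" using real by simp
    then have "ennreal (1 / p) = ennreal 1"
      using \<open>1 / q = 1\<close> real by (simp add: divide_ennreal flip: ennreal_1)
    then have "1 / p = 1" using \<open>0 < p\<close> by (subst (asm) ennreal_inj) auto
    then show ?thesis using real by simp
  next
    case top
    then show ?thesis using \<open>1 / q = 1\<close> by simp
  qed
  then show ?thesis using N top by (intro that[of 1]) (auto simp: conjugate_exponent_def)
qed

theorem theorem1p2:
  fixes D :: "(real ^ 'n) set"
    and V :: "real ^ 'n \<Rightarrow> real"
    and u :: "real ^ 'n \<Rightarrow> complex"
    and q r :: ennreal
    and c :: "real ^ 'n" and \<rho> :: real
  assumes "open D" and "connected D" and "D \<noteq> {}" and "bounded D"
    and "max 1 (ennreal (real CARD('n) / 2)) < r" and "r \<le> \<infinity>"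
    and "1 / q + 1 / r = 1"
    and "V \<in> Lp_space r D"
    and "distributional_solution D V u" and "nontrivial_on D u"
    and "measure lebesgue (ball c \<rho>) = 1"
  shows "(sobolev_constant q (ball c \<rho>))\<^sup>2
           * ennreal (measure lebesgue D powr (2 / real CARD('n) - enn2real (1 / r)))
           * Lp_norm r D (\<lambda>x. max (V x) 0) \<ge> 1"
proof -
  define N where "N = real CARD('n)"
  have N: "0 < N" by (simp add: N_def)
  have r: "max 1 (ennreal (N / 2)) < r" using assms(5) by (simp add: N_def)
  obtain p where p: "0 < p" "q = ennreal p" "conjugate_exponent r p" "1 / p = 1 - enn2real (1 / r)" "(2 * p) * (N / 2 - 1) < N"
    by (rule conjugate_exponents[OF r assms(7) N])
  define e where "e = 2 * p"
  have e: "0 < e" "e * (N / 2 - 1) < N" using p by (auto simp: e_def)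
  have "2 * q = ennreal e" using p by (simp add: e_def ennreal_mult)
  then have q: "2 * q \<noteq> \<infinity>" "enn2real (2 * q) = e" using e by auto
  obtain g where g: "W12_0 D u g" and eq: "\<And>\<psi>. \<psi> \<in> test_functions D \<Longrightarrow>
      (LINT x|lebesgue_on D. (\<Sum>i\<in>UNIV. g x $ i * gradient \<psi> x $ i)) =
      (LINT x|lebesgue_on D. complex_of_real (V x) * u x * \<psi> x)"
    using assms(9) unfolding distributional_solution_def by blast
  obtain \<phi> where \<phi>: "\<And>k. \<phi> k \<in> test_functions D"
    and lims: "(\<lambda>k. Lp_norm 2 D (\<lambda>x. gradient (\<phi> k) x - g x)) \<longlonglongrightarrow> 0" "(\<lambda>k. Lp_norm 2 D (\<lambda>x. \<phi> k x - u x)) \<longlonglongrightarrow> 0"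
    using g unfolding W12_0_def by blast
  have ug: "u \<in> Lp_space 2 D" "g \<in> Lp_space 2 D" using g by (auto simp: W12_0_def W12_def)
  have gfin: "(\<integral>\<^sup>+x. ennreal ((norm (g x))\<^sup>2) \<partial>lebesgue_on D) < \<infinity>"
    using ug(2) by (auto simp: Lp_space_def Lp_norm_def ennpow_def powr_numeral less_top split: if_splits)
  have bound: "1 \<le> ennreal (S\<^sup>2) * Lp_norm r D (\<lambda>x. max (V x) 0)"
    if "0 \<le> S" and sob: "\<And>\<psi> A. \<lbrakk>\<psi> \<in> test_functions D; 0 \<le> A; (\<integral>\<^sup>+x. ennreal ((norm (gradient \<psi> x))\<^sup>2) \<partial>lborel) \<le> ennreal A\<rbrakk>
      \<Longrightarrow> (\<integral>\<^sup>+x. ennreal (norm (\<psi> x) powr e) \<partial>lborel) \<le> ennreal ((S * sqrt A) powr e)" for S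
  proof -
    interpret sobolev_approximation D e S u g \<phi>
      using ug gfin \<phi> Lp_norm_2_tendsto_0[OF lims(1)] Lp_norm_2_tendsto_0[OF lims(2)] assms(1) e that
      by unfold_locales (auto simp: Lp_space_def)
    show ?thesis by (rule equation_bound[OF p(3) e_def assms(8,10) eq])
  qed
  have Vpos: "0 < measure lebesgue D"
  proof -
    have "\<not> negligible D" by (rule open_not_negligible[OF assms(1,3)])
    moreover have "D \<in> lmeasurable" using assms(1,4) by (simp add: bounded_set_imp_lmeasurable)
    ultimately show ?thesis by (simp add: negligible_iff_measure0 zero_less_measure_iff)
  qed
  show ?thesis
  proof (cases "sobolev_constant q (ball c \<rho>)")
    case (real \<kappa>)
    \<comment> \<open>The constant that comparison with the ball of volume 1 gives for
      \<open>D\<close>.\<close>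
    define S where "S = \<kappa> * measure lebesgue D powr (1 / e + 1 / N - 1 / 2)"
    have "1 \<le> ennreal (S\<^sup>2) * Lp_norm r D (\<lambda>x. max (V x) 0)"
    proof (rule bound)
      show "0 \<le> S" using real by (simp add: S_def)
      fix \<psi> :: "real^'n \<Rightarrow> complex" and A
      assume "\<psi> \<in> test_functions D" "0 \<le> A" "(\<integral>\<^sup>+x. ennreal ((norm (gradient \<psi> x))\<^sup>2) \<partial>lborel) \<le> ennreal A"
      then show "(\<integral>\<^sup>+x. ennreal (norm (\<psi> x) powr e) \<partial>lborel) \<le> ennreal ((S * sqrt A) powr e)"
        using sobolev_comparison[OF assms(1-4) _ assms(11) real(2,1) q e(1)] by (simp add: S_def N_def)
    qed
    also have "S\<^sup>2 = \<kappa>\<^sup>2 * measure lebesgue D powr (2 / N - enn2real (1 / r))"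
    proof -
      \<comment> \<open>With \<open>e = 2 * p\<close> the term \<open>2 / e - 1\<close> is
        \<open>1 / p - 1\<close>, the negative of \<open>1 / r\<close>.\<close>
      have 1: "2 * (1 / e + 1 / N - 1 / 2) = 2 / N - enn2real (1 / r)"
        using p(4) by (simp add: e_def algebra_simps)
      have 2: "(measure lebesgue D powr a)\<^sup>2 = measure lebesgue D powr (2 * a)" for a
        by (simp add: power2_eq_square flip: powr_add)
      show ?thesis by (simp only: S_def power_mult_distrib 1 2)
    qed
    also have "ennreal (\<kappa>\<^sup>2 * measure lebesgue D powr (2 / N - enn2real (1 / r)))
        = (sobolev_constant q (ball c \<rho>))\<^sup>2 * ennreal (measure lebesgue D powr (2 / N - enn2real (1 / r)))"
      using real by (simp add: ennreal_mult ennreal_power)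
    finally show ?thesis by (simp add: N_def)
  next
    case top
    \<comment> \<open>An infinite constant makes the product infinite unless the norm of the
      positive part is 0; a finite Sobolev constant for \<open>D\<close> shows that this norm is not
      0.\<close>
    obtain S where S: "0 \<le> S" "1 \<le> ennreal (S\<^sup>2) * Lp_norm r D (\<lambda>x. max (V x) 0)"
    proof (rule finite_sobolev_constant[OF assms(4) e(1) e(2)[unfolded N_def]])
      fix S :: real
      assume "0 \<le> S" "\<And>(\<psi> :: real^'n \<Rightarrow> complex) A. \<lbrakk>\<psi> \<in> test_functions D; 0 \<le> A;
        (\<integral>\<^sup>+x. ennreal ((norm (gradient \<psi> x))\<^sup>2) \<partial>lborel) \<le> ennreal A\<rbrakk>
        \<Longrightarrow> (\<integral>\<^sup>+x. ennreal (norm (\<psi> x) powr e) \<partial>lborel) \<le> ennreal ((S * sqrt A) powr e)"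
      then show thesis by (intro that[of S] bound) auto
    qed
    then have "Lp_norm r D (\<lambda>x. max (V x) 0) \<noteq> 0" by auto
    moreover have "ennreal (measure lebesgue D powr (2 / real CARD('n) - enn2real (1 / r))) \<noteq> 0"
      using Vpos by simp
    ultimately show ?thesis using top by (simp add: power2_eq_square ennreal_top_mult ennreal_mult_top)
  qed
qed

end
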